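(* Suppose $p$ is a computable real with $p \geq 1$. Then, whenever $\mathcal{B}_0$ and $\mathcal{B}_1$ are computable Banach spaces that are linearly isometric to $\ell^p$, the halting set computes a surjective linear isometry of $\mathcal{B}_0$ onto $\mathcal{B}_1$.
   Context: All Banach spaces are over $\mathbb{C}$, and $\mathbb{N}=\{0,1,2,\ldots\}$. $\ell^p$ is the Banach space of all $f:\mathbb{N}\to\mathbb{C}$ with $\|f\|_p=(\sum_n |f(n)|^p)^{1/p}<\infty$. A real $p$ is computable if there is an algorithm that, given $k\in\mathbb{N}$, computes a rational $q$ with $|p-q|<2^{-k}$. Let $\mathcal{B}$ be a Banach space and $F=\{f_0,f_1,\ldots\}\subseteq\mathcal{B}$ an indexed (finite or countable) set. $\mathcal{L}_{\mathbb{Q}(i)}(F)$ is the set of finite linear combinations of elements of $F$ with coefficients in $\mathbb{Q}(i)$; algorithms handle such vectors via codes of the coefficient lists. $F$ is a generating set for $\mathcal{B}$ if its closed linear span is $\mathcal{B}$; it is an effective generating set if moreover there is an algorithm that, given $f\in\mathcal{L}_{\mathbb{Q}(i)}(F)$ and $k\in\mathbb{N}$, computes a rational $q$ with $|\|f\|-q|<2^{-k}$. A computable Banach space is a pair $(\mathcal{B},F)$ where $F$ is an effective generating set for $\mathcal{B}$ ($F$ is usually suppressed from the notation). A rational ball with respect to $F$ is an open ball $B(f;r)$ with $f\in\mathcal{L}_{\mathbb{Q}(i)}(F)$ and $r$ a positive rational. A map $T:\mathcal{B}_0\to\mathcal{B}_1$ between computable Banach spaces $(\mathcal{B}_0,F_0)$,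 $(\mathcal{B}_1,F_1)$ is computable (with respect to $(F_0,F_1)$) if there is an algorithm $P$ such that: (1) given (a code of) a rational ball with respect to $F_0$, $P$ either does not halt or outputs (a code of) a rational ball with respect to $F_1$; (2) if $P$ outputs $B'$ on input $B$, then $T(f)\in B'$ for all $f\in B$; (3) if $V$ is a neighborhood of $T(f)$ and $U$ is a neighborhood of $f$, then $f$ belongs to a rational ball $B\subseteq U$ on which $P$ halts and outputs a rational ball included in $V$. An oracle $X$ (e.g. the halting set) computes $T$ if such a $P$ exists among algorithms with oracle $X$. A linear isometry is a linear map $T$ with $\|T(x)-T(y)\|=\|x-y\|$ for all $x,y$; two Banach spaces are linearly isometric if there is a surjective linear isometry from one onto the other. *)

theory Defs
  imports "HOL-Analysis.Analysis" "HOL-Library.Nat_Bijection" "HOL-Library.Extended_Nat"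
begin

section \<open>Partial recursive functions with an oracle\<close>

text \<open>
  Unary Kleene-style programs over the naturals; several arguments are passed as one number
  through the bijection \<^const>\<open>prod_encode\<close>. Partial values are options, \<^const>\<open>None\<close> meaning
  divergence. The initial functions, pairing, composition, primitive recursion and unbounded
  minimisation generate exactly the partial recursive functions (relative to the oracle).
\<close>

datatype prog =
    PZero
  | PSucc
  | PFst
  | PSnd
  | POracle
  | PPair prog prog
  | PComp prog prog
  | PRec prog prog
  | PMu prog

primrec run :: "nat set \<Rightarrow> prog \<Rightarrow> nat \<Rightarrow> nat option" where
  "run X PZero = (\<lambda>n. Some 0)"
| "run X PSucc = (\<lambda>n. Some (Suc n))"
| "run X PFst = (\<lambda>n. Some (fst (prod_decode n)))"
| "run X PSnd = (\<lambda>n. Some (snd (prod_decode n)))"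
| "run X POracle = (\<lambda>n. Some (if n \<in> X then 1 else 0))"
| "run X (PPair P Q) =
     (\<lambda>n. Option.bind (run X P n) (\<lambda>a.
          Option.bind (run X Q n) (\<lambda>b. Some (prod_encode (a, b)))))"
| "run X (PComp P Q) = (\<lambda>n. Option.bind (run X Q n) (run X P))"
| "run X (PRec P Q) =
     (\<lambda>n. rec_nat (run X P (fst (prod_decode n)))
            (\<lambda>k r. Option.bind r
               (\<lambda>v. run X Q (prod_encode (fst (prod_decode n), prod_encode (k, v)))))
            (snd (prod_decode n)))"
| "run X (PMu P) =
     (\<lambda>n. if \<exists>k. run X P (prod_encode (n, k)) = Some 0 \<and>
                 (\<forall>j<k. run X P (prod_encode (n, j)) \<noteq> None)
          then Some (LEAST k. run X P (prod_encode (n, k)) = Some 0)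
          else None)"

primrec oracle_free :: "prog \<Rightarrow> bool" where
  "oracle_free PZero \<longleftrightarrow> True"
| "oracle_free PSucc \<longleftrightarrow> True"
| "oracle_free PFst \<longleftrightarrow> True"
| "oracle_free PSnd \<longleftrightarrow> True"
| "oracle_free POracle \<longleftrightarrow> False"
| "oracle_free (PPair P Q) \<longleftrightarrow> oracle_free P \<and> oracle_free Q"
| "oracle_free (PComp P Q) \<longleftrightarrow> oracle_free P \<and> oracle_free Q"
| "oracle_free (PRec P Q) \<longleftrightarrow> oracle_free P \<and> oracle_free Q"
| "oracle_free (PMu P) \<longleftrightarrow> oracle_free P"

text \<open>On an oracle-free program the oracle argument of \<^const>\<open>run\<close> is irrelevant.\<close>

lemma run_oracle_free: "oracle_free P \<Longrightarrow> run X P = run Y P"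
  by (induction P) (simp_all cong: if_cong)

primrec prog_code :: "prog \<Rightarrow> nat" where
  "prog_code PZero = prod_encode (0, 0)"
| "prog_code PSucc = prod_encode (1, 0)"
| "prog_code PFst = prod_encode (2, 0)"
| "prog_code PSnd = prod_encode (3, 0)"
| "prog_code POracle = prod_encode (4, 0)"
| "prog_code (PPair P Q) = prod_encode (5, prod_encode (prog_code P, prog_code Q))"
| "prog_code (PComp P Q) = prod_encode (6, prod_encode (prog_code P, prog_code Q))"
| "prog_code (PRec P Q) = prod_encode (7, prod_encode (prog_code P, prog_code Q))"
| "prog_code (PMu P) = prod_encode (8, prog_code P)"

lemma prog_code_inject [simp]: "prog_code P = prog_code Q \<longleftrightarrow> P = Q"
proof (induction P arbitrary: Q)
  case PZero then show ?case by (cases Q) simp_all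
next
  case PSucc then show ?case by (cases Q) simp_all
next
  case PFst then show ?case by (cases Q) simp_all
next
  case PSnd then show ?case by (cases Q) simp_all
next
  case POracle then show ?case by (cases Q) simp_all
next
  case (PPair P1 P2) then show ?case by (cases Q) simp_all
next
  case (PComp P1 P2) then show ?case by (cases Q) simp_all
next
  case (PRec P1 P2) then show ?case by (cases Q) simp_all
next
  case (PMu P) then show ?case by (cases Q) simp_all
qed

definition halting_set :: "nat set" where
  "halting_set =
     {prod_encode (prog_code P, n) | P n. oracle_free P \<and> run {} P n \<noteq> None}"


section \<open>Codes of rationals and Gaussian rationals\<close>

text \<open>Every natural number is a code, and every value has (many) codes.\<close>

definition rat_of_code :: "nat \<Rightarrow> rat" where
  "rat_of_code c = (case prod_decode c of (a, b) \<Rightarrow> of_int (int_decode a) / of_nat (Suc b))"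

definition gauss_rat_of_code :: "nat \<Rightarrow> complex" where
  "gauss_rat_of_code c =
     (case prod_decode c of (a, b) \<Rightarrow>
        Complex (of_rat (rat_of_code a)) (of_rat (rat_of_code b)))"

definition computable_real :: "real \<Rightarrow> bool" where
  "computable_real x \<longleftrightarrow>
     (\<exists>P. oracle_free P \<and>
        (\<forall>k. \<exists>q. run {} P k = Some q \<and> \<bar>x - of_rat (rat_of_code q)\<bar> < 1 / 2 ^ k))"


section \<open>Complex Banach spaces\<close>

class complex_banach = banach +
  fixes scaleC :: "complex \<Rightarrow> 'a \<Rightarrow> 'a" (infixr \<open>*\<^sub>C\<close> 75)
  assumes scaleC_add_right: "a *\<^sub>C (x + y) = a *\<^sub>C x + a *\<^sub>C y"
    and scaleC_add_left: "(a + b) *\<^sub>C x = a *\<^sub>C x + b *\<^sub>C x"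
    and scaleC_scaleC: "a *\<^sub>C (b *\<^sub>C x) = (a * b) *\<^sub>C x"
    and scaleC_one: "1 *\<^sub>C x = x"
    and scaleR_scaleC: "r *\<^sub>R x = complex_of_real r *\<^sub>C x"
    and norm_scaleC: "norm (a *\<^sub>C x) = cmod a * norm x"

lemma vector_space_scaleC:
  "vector_space (scaleC :: complex \<Rightarrow> 'a \<Rightarrow> 'a::complex_banach)"
  by unfold_locales (simp_all add: scaleC_add_right scaleC_add_left scaleC_scaleC scaleC_one)

definition linear_isometry :: "('a::complex_banach \<Rightarrow> 'b::complex_banach) \<Rightarrow> bool" where
  "linear_isometry T \<longleftrightarrow>
     Vector_Spaces.linear scaleC scaleC T \<and> (\<forall>x y. norm (T x - T y) = norm (x - y))"

text \<open>
  The space \<open>\<ell>\<^sup>p\<close> depends on the number \<open>p\<close>, so it is a set of functions with a norm rather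
  than a type.
\<close>

definition lp :: "real \<Rightarrow> (nat \<Rightarrow> complex) set" where
  "lp p = {f. summable (\<lambda>n. cmod (f n) powr p)}"

definition lp_norm :: "real \<Rightarrow> (nat \<Rightarrow> complex) \<Rightarrow> real" where
  "lp_norm p f = (\<Sum>n. cmod (f n) powr p) powr (1 / p)"

definition linearly_isometric_to_lp :: "'a::complex_banach itself \<Rightarrow> real \<Rightarrow> bool" where
  "linearly_isometric_to_lp _ p \<longleftrightarrow>
     (\<exists>T :: 'a \<Rightarrow> nat \<Rightarrow> complex.
        range T = lp p \<and>
        (\<forall>x y. T (x + y) = (\<lambda>n. T x n + T y n)) \<and>
        (\<forall>c x. T (c *\<^sub>C x) = (\<lambda>n. c * T x n)) \<and>
        (\<forall>x y. lp_norm p (\<lambda>n. T x n - T y n) = norm (x - y)))"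


section \<open>Computable Banach spaces\<close>

text \<open>
  An indexed finite or countable set \<open>{f\<^sub>0, f\<^sub>1, \<dots>}\<close> is given by \<open>N :: enat\<close> and \<open>F\<close>; its members
  are the \<open>F i\<close> with \<open>i < N\<close>, and the values of \<open>F\<close> at other indices are irrelevant.
\<close>

definition members :: "enat \<Rightarrow> (nat \<Rightarrow> 'a) \<Rightarrow> 'a set" where
  "members N F = F ` {i. enat i < N}"

definition generating_set :: "enat \<Rightarrow> (nat \<Rightarrow> 'a::complex_banach) \<Rightarrow> bool" where
  "generating_set N F \<longleftrightarrow> closure (module.span scaleC (members N F)) = UNIV"

text \<open>
  The code of a coefficient list \<open>[c\<^sub>0, \<dots>, c\<^sub>m\<^sub>-\<^sub>1]\<close> names the vector
  \<open>c\<^sub>0 f\<^sub>0 + \<dots> + c\<^sub>m\<^sub>-\<^sub>1 f\<^sub>m\<^sub>-\<^sub>1\<close>, provided the list is not longer than the family.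
\<close>

definition vector_code :: "enat \<Rightarrow> nat \<Rightarrow> bool" where
  "vector_code N v \<longleftrightarrow> enat (length (list_decode v)) \<le> N"

definition vector_of_code :: "(nat \<Rightarrow> 'a::complex_banach) \<Rightarrow> nat \<Rightarrow> 'a" where
  "vector_of_code F v =
     (\<Sum>i<length (list_decode v). gauss_rat_of_code (list_decode v ! i) *\<^sub>C F i)"

definition effective_generating_set :: "enat \<Rightarrow> (nat \<Rightarrow> 'a::complex_banach) \<Rightarrow> bool" where
  "effective_generating_set N F \<longleftrightarrow>
     generating_set N F \<and>
     (\<exists>P. oracle_free P \<and>
        (\<forall>v k. vector_code N v \<longrightarrow>
           (\<exists>q. run {} P (prod_encode (v, k)) = Some q \<and>
                \<bar>norm (vector_of_code F v) - of_rat (rat_of_code q)\<bar> < 1 / 2 ^ k)))"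


section \<open>Computable maps\<close>

definition ball_code :: "enat \<Rightarrow> nat \<Rightarrow> bool" where
  "ball_code N b \<longleftrightarrow>
     vector_code N (fst (prod_decode b)) \<and> rat_of_code (snd (prod_decode b)) > 0"

definition ball_of_code :: "(nat \<Rightarrow> 'a::complex_banach) \<Rightarrow> nat \<Rightarrow> 'a set" where
  "ball_of_code F b =
     ball (vector_of_code F (fst (prod_decode b))) (of_rat (rat_of_code (snd (prod_decode b))))"

text \<open>A neighborhood of a point is a set with that point in its interior.\<close>

definition computes_map ::
    "nat set \<Rightarrow> prog \<Rightarrow> enat \<Rightarrow> (nat \<Rightarrow> 'a::complex_banach) \<Rightarrow>
     enat \<Rightarrow> (nat \<Rightarrow> 'b::complex_banach) \<Rightarrow> ('a \<Rightarrow> 'b) \<Rightarrow> bool" where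
  "computes_map X P N0 F0 N1 F1 T \<longleftrightarrow>
     (\<forall>b b'. ball_code N0 b \<and> run X P b = Some b' \<longrightarrow> ball_code N1 b') \<and>
     (\<forall>b b'. ball_code N0 b \<and> run X P b = Some b' \<longrightarrow>
        (\<forall>f\<in>ball_of_code F0 b. T f \<in> ball_of_code F1 b')) \<and>
     (\<forall>f U V. f \<in> interior U \<and> T f \<in> interior V \<longrightarrow>
        (\<exists>b b'. ball_code N0 b \<and> f \<in> ball_of_code F0 b \<and> ball_of_code F0 b \<subseteq> U \<and>
                run X P b = Some b' \<and> ball_of_code F1 b' \<subseteq> V))"

definition oracle_computes ::
    "nat set \<Rightarrow> enat \<Rightarrow> (nat \<Rightarrow> 'a::complex_banach) \<Rightarrow>
     enat \<Rightarrow> (nat \<Rightarrow> 'b::complex_banach) \<Rightarrow> ('a \<Rightarrow> 'b) \<Rightarrow> bool" where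
  "oracle_computes X N0 F0 N1 F1 T \<longleftrightarrow> (\<exists>P. computes_map X P N0 F0 N1 F1 T)"

end

theory Submission
  imports Defs
begin

text \<open>
  Call a sequence in a copy of \<open>\<ell>\<^sup>p\<close> a basis if some surjective isometry takes the standard unit vectors
  to it. Matching a basis of one copy with a basis of another gives a linear isometry between them, and
  this isometry is computable from any oracle that computes arbitrarily good rational approximations
  to both bases (\<open>recursive_bases_imp_computable_isometry\<close>). So it suffices that the halting set
  computes a basis of every computable copy of \<open>\<ell>\<^sup>p\<close>. What the halting set contributes is the ability
  to decide statements of the form ``for all rational vectors, some inequality between norms fails''.

  Let \<open>p \<noteq> 2\<close>. Every basis consists of atoms, the unit multiples of the unit vectors, one for each
  coordinate. An atom is a vector that is not the sum of two nonzero disjointly supported ones, and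
  disjointness leaves a trace in the norms: if \<open>g\<close> and \<open>f - g\<close> are disjoint, then \<open>g + \<mu> (f - g)\<close> has the
  norm of \<open>f\<close> for all \<open>\<mu>\<close> of modulus 1. If \<open>f\<close> is an atom and this holds for \<open>\<mu> = -1, \<i>, -\<i>\<close>, then \<open>g = 0\<close> or
  \<open>g = f\<close> (\<open>trivial_splitting\<close>; this fails for \<open>p = 2\<close>), and by compactness the implication survives
  small errors (\<open>atom_indecomposable\<close>). Hence a rational vector close to an atom can be recognized
  by a universal statement about rational vectors (\<open>quasi_atom\<close>), which the halting set decides.
  Refining such vectors yields atoms, and choosing one for each coordinate yields a basis
  (\<open>recursive_basis_neq_2\<close>).

  For \<open>p = 2\<close> the basis is the Gram-Schmidt orthonormalization of the generating set. The distance \<open>d\<close> of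
  the \<open>n\<close>-th generator from the span of its predecessors is an infimum of computable norms, so lower
  bounds of \<open>d\<close> can be decided with the halting set, and they suffice to certify that a rational
  vector is close to the \<open>n\<close>-th orthonormal vector (\<open>near_orthonormal_sound\<close>).
\<close>

section \<open>Recursive functions and decidable predicates relative to an oracle\<close>

abbreviation first :: "nat \<Rightarrow> nat" where "first n \<equiv> fst (prod_decode n)"
abbreviation second :: "nat \<Rightarrow> nat" where "second n \<equiv> snd (prod_decode n)"
abbreviation pair :: "nat \<Rightarrow> nat \<Rightarrow> nat" where "pair a b \<equiv> prod_encode (a, b)"

text \<open>
  Only total functions are considered. Partial information is expressed instead by the
  semidecidable predicates below, which need no reasoning about divergence.
\<close>

definition recursive_in :: "nat set \<Rightarrow> (nat \<Rightarrow> nat) \<Rightarrow> bool" where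
  "recursive_in X f \<longleftrightarrow> (\<exists>P. \<forall>n. run X P n = Some (f n))"

definition decidable_in :: "nat set \<Rightarrow> (nat \<Rightarrow> bool) \<Rightarrow> bool" where
  "decidable_in X A \<longleftrightarrow> recursive_in X (\<lambda>n. of_bool (A n))"

named_theorems recursive_intros

lemma recursive_in_id [recursive_intros]: "recursive_in X (\<lambda>n. n)"
  unfolding recursive_in_def by (rule exI [of _ "PPair PFst PSnd"]) simp

text \<open>
  The empty oracle answers every question by 0, so asking it is the same as computing 0.
\<close>

primrec without_oracle :: "prog \<Rightarrow> prog" where
  "without_oracle PZero = PZero"
| "without_oracle PSucc = PSucc"
| "without_oracle PFst = PFst"
| "without_oracle PSnd = PSnd"
| "without_oracle POracle = PZero"
| "without_oracle (PPair P Q) = PPair (without_oracle P) (without_oracle Q)"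
| "without_oracle (PComp P Q) = PComp (without_oracle P) (without_oracle Q)"
| "without_oracle (PRec P Q) = PRec (without_oracle P) (without_oracle Q)"
| "without_oracle (PMu P) = PMu (without_oracle P)"

lemma recursive_in_oracle_free:
  assumes "recursive_in {} f"
  obtains P where "oracle_free P" "\<And>X n. run X P n = Some (f n)"
proof -
  have free: "oracle_free (without_oracle P)" for P
    by (induction P) simp_all
  have "run {} (without_oracle P) = run {} P" for P
    by (induction P) (simp_all cong: if_cong)
  with free assms obtain Q where "oracle_free Q" "\<forall>n. run {} Q n = Some (f n)"
    unfolding recursive_in_def by metis
  then show thesis
    using that run_oracle_free by metis
qed

lemma recursive_in_relativize: "recursive_in {} f \<Longrightarrow> recursive_in X f"
  by (metis recursive_in_oracle_free recursive_in_def)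

lemma recursive_in_compose:
  assumes "recursive_in X f" "recursive_in X g"
  shows "recursive_in X (\<lambda>n. f (g n))"
proof -
  from assms obtain P Q where "\<forall>n. run X P n = Some (f n)" "\<forall>n. run X Q n = Some (g n)"
    unfolding recursive_in_def by blast
  then show ?thesis
    unfolding recursive_in_def by (intro exI [of _ "PComp P Q"]) simp
qed

lemma recursive_in_Suc [recursive_intros]:
  assumes "recursive_in X f"
  shows "recursive_in X (\<lambda>n. Suc (f n))"
proof -
  have "recursive_in X (\<lambda>n. Suc n)"
    unfolding recursive_in_def by (rule exI [of _ PSucc]) simp
  then show ?thesis using assms by (rule recursive_in_compose)
qed

lemma recursive_in_const [recursive_intros]: "recursive_in X (\<lambda>n. c)"
proof (induction c)
  case 0
  show ?case unfolding recursive_in_def by (rule exI [of _ PZero]) simp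
qed (rule recursive_in_Suc)

lemma recursive_in_first [recursive_intros]:
  assumes "recursive_in X f"
  shows "recursive_in X (\<lambda>n. first (f n))"
proof -
  have "recursive_in X (\<lambda>n. first n)"
    unfolding recursive_in_def by (rule exI [of _ PFst]) simp
  then show ?thesis using assms by (rule recursive_in_compose)
qed

lemma recursive_in_second [recursive_intros]:
  assumes "recursive_in X f"
  shows "recursive_in X (\<lambda>n. second (f n))"
proof -
  have "recursive_in X (\<lambda>n. second n)"
    unfolding recursive_in_def by (rule exI [of _ PSnd]) simp
  then show ?thesis using assms by (rule recursive_in_compose)
qed

lemma recursive_in_pair [recursive_intros]:
  assumes "recursive_in X f" "recursive_in X g"
  shows "recursive_in X (\<lambda>n. pair (f n) (g n))"
proof -
  from assms obtain P Q where "\<forall>n. run X P n = Some (f n)" "\<forall>n. run X Q n = Some (g n)"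
    unfolding recursive_in_def by blast
  then show ?thesis
    unfolding recursive_in_def by (intro exI [of _ "PPair P Q"]) simp
qed

lemma recursive_in_compose2:
  assumes "recursive_in X (\<lambda>m. h (first m) (second m))" "recursive_in X f" "recursive_in X g"
  shows "recursive_in X (\<lambda>n. h (f n) (g n))"
  using recursive_in_compose [OF assms(1) recursive_in_pair [OF assms(2,3)]] by simp

lemma decidable_in_compose2:
  assumes "decidable_in X (\<lambda>m. A (first m) (second m))" "recursive_in X f" "recursive_in X g"
  shows "decidable_in X (\<lambda>n. A (f n) (g n))"
  using recursive_in_compose2 [where h = "\<lambda>a b. of_bool (A a b)"] assms
  unfolding decidable_in_def by blast

lemma decidable_in_compose:
  assumes "decidable_in X A" "recursive_in X f"
  shows "decidable_in X (\<lambda>n. A (f n))"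
  using recursive_in_compose [where f = "\<lambda>n. of_bool (A n)"] assms
  unfolding decidable_in_def by blast

lemma recursive_in_rec_nat [recursive_intros]:
  assumes "recursive_in X f"
    and "recursive_in X (\<lambda>m. g (first m) (first (second m)) (second (second m)))"
    and "recursive_in X h"
  shows "recursive_in X (\<lambda>n. rec_nat (f n) (\<lambda>k r. g n k r) (h n))"
proof -
  from assms obtain P Q H where P: "\<forall>n. run X P n = Some (f n)"
    and Q: "\<forall>m. run X Q m = Some (g (first m) (first (second m)) (second (second m)))"
    and H: "\<forall>n. run X H n = Some (h n)"
    unfolding recursive_in_def by blast
  have *: "rec_nat (Some (f n)) (\<lambda>k r. Option.bind r (\<lambda>v. Some (g n k v))) j
      = Some (rec_nat (f n) (\<lambda>k r. g n k r) j)" for n j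
    by (induction j) auto
  have "\<forall>n. run X (PComp (PRec P Q) (PPair (PPair PFst PSnd) H)) n
      = Some (rec_nat (f n) (\<lambda>k r. g n k r) (h n))"
    by (simp add: P Q H *)
  then show ?thesis unfolding recursive_in_def by blast
qed

lemma recursive_in_add [recursive_intros]:
  assumes "recursive_in X f" "recursive_in X g"
  shows "recursive_in X (\<lambda>n. f n + g n)"
proof -
  have "rec_nat a (\<lambda>k r. Suc r) b = a + b" for a b :: nat
    by (induction b) auto
  moreover have "recursive_in X (\<lambda>n. rec_nat (f n) (\<lambda>k r. Suc r) (g n))"
    by (intro recursive_intros assms)
  ultimately show ?thesis by simp
qed

lemma recursive_in_mult [recursive_intros]:
  assumes "recursive_in X f" "recursive_in X g"
  shows "recursive_in X (\<lambda>n. f n * g n)"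
proof -
  have "rec_nat 0 (\<lambda>k r. r + a) b = a * b" for a b :: nat
    by (induction b) auto
  moreover have "recursive_in X (\<lambda>n. rec_nat 0 (\<lambda>k r. r + f n) (g n))"
    by (intro recursive_intros recursive_in_compose [OF assms(1)] assms(2))
  ultimately show ?thesis by simp
qed

lemma recursive_in_power [recursive_intros]:
  assumes "recursive_in X f" "recursive_in X g"
  shows "recursive_in X (\<lambda>n. f n ^ g n)"
proof -
  have "rec_nat 1 (\<lambda>k r. r * a) b = a ^ b" for a b :: nat
    by (induction b) auto
  moreover have "recursive_in X (\<lambda>n. rec_nat 1 (\<lambda>k r. r * f n) (g n))"
    by (intro recursive_intros recursive_in_compose [OF assms(1)] assms(2))
  ultimately show ?thesis by simp
qed

lemma recursive_in_diff [recursive_intros]: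
  assumes "recursive_in X f" "recursive_in X g"
  shows "recursive_in X (\<lambda>n. f n - g n)"
proof -
  have pred: "rec_nat 0 (\<lambda>k r. k) a = a - 1" for a :: nat
    by (cases a) auto
  have "rec_nat a (\<lambda>k r. rec_nat 0 (\<lambda>k r. k) r) b = a - b" for a b :: nat
    by (induction b) (auto simp: pred)
  moreover have "recursive_in X (\<lambda>n. rec_nat (f n) (\<lambda>k r. rec_nat 0 (\<lambda>k r. k) r) (g n))"
    by (intro recursive_intros assms)
  ultimately show ?thesis by simp
qed

lemma recursive_in_of_bool [recursive_intros]:
  "decidable_in X A \<Longrightarrow> recursive_in X (\<lambda>n. of_bool (A n))"
  by (simp add: decidable_in_def)

lemma decidable_in_less [recursive_intros]:
  assumes "recursive_in X f" "recursive_in X g"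
  shows "decidable_in X (\<lambda>n. f n < g n)"
proof -
  have "recursive_in X (\<lambda>n. 1 - (1 - (g n - f n)))"
    by (intro recursive_intros assms)
  moreover have "1 - (1 - (g n - f n)) = of_bool (f n < g n)" for n
    by auto
  ultimately show ?thesis by (simp add: decidable_in_def)
qed

lemma decidable_in_not [recursive_intros]:
  assumes "decidable_in X A"
  shows "decidable_in X (\<lambda>n. \<not> A n)"
proof -
  have "recursive_in X (\<lambda>n. 1 - of_bool (A n))"
    by (intro recursive_intros assms)
  moreover have "1 - of_bool (A n) = (of_bool (\<not> A n) :: nat)" for n
    by auto
  ultimately show ?thesis by (simp add: decidable_in_def)
qed

lemma decidable_in_conj [recursive_intros]:
  assumes "decidable_in X A" "decidable_in X B"
  shows "decidable_in X (\<lambda>n. A n \<and> B n)"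
proof -
  have "recursive_in X (\<lambda>n. of_bool (A n) * of_bool (B n))"
    by (intro recursive_intros assms)
  then show ?thesis by (simp add: decidable_in_def of_bool_conj)
qed

lemma decidable_in_disj [recursive_intros]:
  assumes "decidable_in X A" "decidable_in X B"
  shows "decidable_in X (\<lambda>n. A n \<or> B n)"
proof -
  have "decidable_in X (\<lambda>n. \<not> (\<not> A n \<and> \<not> B n))"
    by (intro recursive_intros assms)
  then show ?thesis by simp
qed

lemma decidable_in_imp [recursive_intros]:
  assumes "decidable_in X A" "decidable_in X B"
  shows "decidable_in X (\<lambda>n. A n \<longrightarrow> B n)"
proof -
  have "decidable_in X (\<lambda>n. \<not> A n \<or> B n)"
    by (intro recursive_intros assms)
  then show ?thesis by (simp only: imp_conv_disj)
qed

lemma decidable_in_le [recursive_intros]: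
  assumes "recursive_in X f" "recursive_in X g"
  shows "decidable_in X (\<lambda>n. f n \<le> g n)"
proof -
  have "decidable_in X (\<lambda>n. \<not> g n < f n)"
    by (intro recursive_intros assms)
  then show ?thesis by (simp add: not_less)
qed

lemma decidable_in_eq [recursive_intros]:
  assumes "recursive_in X f" "recursive_in X g"
  shows "decidable_in X (\<lambda>n. f n = g n)"
proof -
  have "decidable_in X (\<lambda>n. f n \<le> g n \<and> g n \<le> f n)"
    by (intro recursive_intros assms)
  then show ?thesis by (simp add: eq_iff)
qed

lemma recursive_in_if [recursive_intros]:
  assumes "decidable_in X A" "recursive_in X f" "recursive_in X g"
  shows "recursive_in X (\<lambda>n. if A n then f n else g n)"
proof -
  have "recursive_in X (\<lambda>n. of_bool (A n) * f n + (1 - of_bool (A n)) * g n)"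
    by (intro recursive_intros assms)
  moreover have "of_bool (A n) * f n + (1 - of_bool (A n)) * g n = (if A n then f n else g n)" for n
    by auto
  ultimately show ?thesis by simp
qed

lemma decidable_in_const [recursive_intros]: "decidable_in X (\<lambda>n. c)"
  unfolding decidable_in_def by (rule recursive_in_const)

lemma decidable_in_member [recursive_intros]:
  assumes "recursive_in X f"
  shows "decidable_in X (\<lambda>n. f n \<in> X)"
proof -
  have "recursive_in X (\<lambda>n. of_bool (n \<in> X))"
    unfolding recursive_in_def by (rule exI [of _ POracle]) simp
  then show ?thesis
    using decidable_in_compose [where A = "\<lambda>n. n \<in> X"] assms unfolding decidable_in_def by blast
qed

lemma decidable_in_relativize: "decidable_in {} A \<Longrightarrow> decidable_in X A"
  unfolding decidable_in_def by (rule recursive_in_relativize)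

lemma decidable_in_bounded_all [recursive_intros]:
  assumes "decidable_in X (\<lambda>m. A (first m) (second m))" "recursive_in X h"
  shows "decidable_in X (\<lambda>n. \<forall>i<h n. A n i)"
proof -
  have "rec_nat 1 (\<lambda>k r. r * of_bool (A n k)) b = (of_bool (\<forall>i<b. A n i) :: nat)" for n b
    by (induction b) (auto simp: less_Suc_eq)
  moreover have "recursive_in X (\<lambda>n. rec_nat 1 (\<lambda>k r. r * of_bool (A n k)) (h n))"
    by (intro recursive_intros assms decidable_in_compose2 [OF assms(1)])
  ultimately show ?thesis by (simp add: decidable_in_def)
qed

lemma recursive_in_Least:
  assumes dec: "decidable_in X (\<lambda>m. A (first m) (second m))" and ex: "\<And>n. \<exists>k. A n k"
  shows "recursive_in X (\<lambda>n. LEAST k. A n k)"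
proof -
  have "recursive_in X (\<lambda>m. of_bool (\<not> A (first m) (second m)))"
    by (intro recursive_intros dec)
  then obtain P where P: "\<forall>m. run X P m = Some (of_bool (\<not> A (first m) (second m)))"
    unfolding recursive_in_def by blast
  have "\<forall>n. run X (PMu P) n = Some (LEAST k. A n k)"
    using ex by (simp add: P)
  then show ?thesis unfolding recursive_in_def by blast
qed

text \<open>
  Whatever program decides the base predicate, the search for a least witness halts exactly when
  a witness exists, so one question to the halting set settles an existential statement.
\<close>

lemma decidable_in_halting_set_ex:
  assumes "decidable_in {} (\<lambda>m. A (first m) (second m))"
  shows "decidable_in halting_set (\<lambda>n. \<exists>k. A n k)"
proof -
  have "recursive_in {} (\<lambda>m. of_bool (\<not> A (first m) (second m)))"
    by (intro recursive_intros assms)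
  then obtain P where P: "oracle_free P"
      "\<And>X m. run X P m = Some (of_bool (\<not> A (first m) (second m)))"
    by (rule recursive_in_oracle_free) blast
  have "run {} (PMu P) n \<noteq> None \<longleftrightarrow> (\<exists>k. A n k)" for n
    by (simp add: P)
  moreover have "pair (prog_code (PMu P)) n \<in> halting_set \<longleftrightarrow> run {} (PMu P) n \<noteq> None" for n
    using P(1) unfolding halting_set_def
    by (auto simp del: run.simps prog_code.simps intro!: exI [of _ "PMu P"])
  ultimately have "(\<exists>k. A n k) \<longleftrightarrow> pair (prog_code (PMu P)) n \<in> halting_set" for n
    by blast
  moreover have "decidable_in halting_set (\<lambda>n. pair (prog_code (PMu P)) n \<in> halting_set)"
    by (intro recursive_intros)
  ultimately show ?thesis by simp
qed

section \<open>Semidecidable predicates\<close>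

text \<open>
  Taking projections of decidable predicates, rather than domains of programs, makes conjunctions
  and existential quantifiers easy to handle: no simulation of programs step by step is involved.
\<close>

definition semidecidable_in :: "nat set \<Rightarrow> (nat \<Rightarrow> bool) \<Rightarrow> bool" where
  "semidecidable_in X A \<longleftrightarrow>
     (\<exists>D. decidable_in X (\<lambda>m. D (first m) (second m)) \<and> (\<forall>n. A n \<longleftrightarrow> (\<exists>k. D n k)))"

named_theorems semidecidable_intros

lemma decidable_imp_semidecidable:
  assumes "decidable_in X A"
  shows "semidecidable_in X A"
  unfolding semidecidable_in_def
proof (intro exI [of _ "\<lambda>n k. A n"] conjI)
  show "decidable_in X (\<lambda>m. A (first m))"
    by (intro recursive_intros decidable_in_compose [OF assms])
qed auto

lemma semidecidable_in_conj [semidecidable_intros]: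
  assumes "semidecidable_in X A" "semidecidable_in X B"
  shows "semidecidable_in X (\<lambda>n. A n \<and> B n)"
proof -
  from assms obtain D E where D: "decidable_in X (\<lambda>m. D (first m) (second m))" "\<forall>n. A n \<longleftrightarrow> (\<exists>k. D n k)"
    and E: "decidable_in X (\<lambda>m. E (first m) (second m))" "\<forall>n. B n \<longleftrightarrow> (\<exists>k. E n k)"
    unfolding semidecidable_in_def by blast
  show ?thesis
    unfolding semidecidable_in_def
  proof (intro exI [of _ "\<lambda>n k. D n (first k) \<and> E n (second k)"] conjI allI)
    show "decidable_in X (\<lambda>m. D (first m) (first (second m)) \<and> E (first m) (second (second m)))"
      by (intro recursive_intros decidable_in_compose2 [OF D(1)] decidable_in_compose2 [OF E(1)])
    show "(A n \<and> B n) = (\<exists>k. D n (first k) \<and> E n (second k))" for n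
      using D(2) E(2) by (metis fst_conv snd_conv prod_encode_inverse)
  qed
qed

lemma semidecidable_in_ex [semidecidable_intros]:
  assumes "semidecidable_in X (\<lambda>m. A (first m) (second m))"
  shows "semidecidable_in X (\<lambda>n. \<exists>k. A n k)"
proof -
  from assms obtain D where D: "decidable_in X (\<lambda>m. D (first m) (second m))"
      "\<forall>m. A (first m) (second m) \<longleftrightarrow> (\<exists>k. D m k)"
    unfolding semidecidable_in_def by blast
  show ?thesis
    unfolding semidecidable_in_def
  proof (intro exI [of _ "\<lambda>n k. D (pair n (first k)) (second k)"] conjI allI)
    show "decidable_in X (\<lambda>m. D (pair (first m) (first (second m))) (second (second m)))"
      by (intro recursive_intros decidable_in_compose2 [OF D(1)])
    show "(\<exists>k. A n k) = (\<exists>k. D (pair n (first k)) (second k))" for n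
      using D(2) by (metis fst_conv snd_conv prod_encode_inverse)
  qed
qed

lemma semidecidable_in_compose:
  assumes "semidecidable_in X A" "recursive_in X f"
  shows "semidecidable_in X (\<lambda>n. A (f n))"
proof -
  from assms obtain D where D: "decidable_in X (\<lambda>m. D (first m) (second m))" "\<forall>n. A n \<longleftrightarrow> (\<exists>k. D n k)"
    unfolding semidecidable_in_def by blast
  show ?thesis
    unfolding semidecidable_in_def
  proof (intro exI [of _ "\<lambda>n k. D (f n) k"] conjI allI)
    show "decidable_in X (\<lambda>m. D (f (first m)) (second m))"
      by (intro recursive_intros decidable_in_compose2 [OF D(1)] recursive_in_compose [OF assms(2)])
  qed (use D(2) in blast)
qed

lemma semidecidable_in_relativize: "semidecidable_in {} A \<Longrightarrow> semidecidable_in X A"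
  unfolding semidecidable_in_def using decidable_in_relativize by blast

lemma semidecidable_imp_decidable_in_halting_set:
  assumes "semidecidable_in {} A"
  shows "decidable_in halting_set A"
proof -
  from assms obtain D where D: "decidable_in {} (\<lambda>m. D (first m) (second m))" "\<forall>n. A n \<longleftrightarrow> (\<exists>k. D n k)"
    unfolding semidecidable_in_def by blast
  have "A = (\<lambda>n. \<exists>k. D n k)" by (rule ext) (use D(2) in blast)
  then show ?thesis
    using decidable_in_halting_set_ex [OF D(1)] by simp
qed

text \<open>
  Searching for a witness together with a proof that it is one yields a total function, provided it
  can be decided beforehand whether there is anything to be found.
\<close>

lemma semidecidable_uniformization:
  assumes R: "semidecidable_in X (\<lambda>m. R (first m) (second m))" and A: "decidable_in X A"
    and ex: "\<And>n. A n \<Longrightarrow> \<exists>v. R n v"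
  obtains f where "recursive_in X f" "\<And>n. A n \<Longrightarrow> R n (f n)"
proof -
  from R obtain D where D: "decidable_in X (\<lambda>m. D (first m) (second m))"
      "\<forall>m. R (first m) (second m) \<longleftrightarrow> (\<exists>k. D m k)"
    unfolding semidecidable_in_def by blast
  define S where "S = (\<lambda>n k. A n \<longrightarrow> D (pair n (first k)) (second k))"
  have exS: "\<exists>k. S n k" for n
  proof (cases "A n")
    case True
    with ex obtain v where "R n v" by blast
    then obtain k where "D (pair n v) k"
      using D(2) by (metis fst_conv snd_conv prod_encode_inverse)
    then have "S n (pair v k)" by (simp add: S_def)
    then show ?thesis by blast
  qed (simp add: S_def)
  have decS: "decidable_in X (\<lambda>m. S (first m) (second m))"
    unfolding S_def
    by (intro recursive_intros decidable_in_compose2 [OF D(1)] decidable_in_compose [OF A])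
  have L: "recursive_in X (\<lambda>n. LEAST k. S n k)"
    by (rule recursive_in_Least [OF decS exS])
  have S: "S n (LEAST k. S n k)" for n
    by (rule LeastI_ex [OF exS])
  show thesis
  proof (rule that)
    show "recursive_in X (\<lambda>n. first (LEAST k. S n k))"
      by (intro recursive_intros L)
    show "R n (first (LEAST k. S n k))" if "A n" for n
    proof -
      have "D (pair n (first (LEAST k. S n k))) (second (LEAST k. S n k))"
        using S [of n] that unfolding S_def by blast
      then show ?thesis using D(2) [rule_format, of "pair n (first (LEAST k. S n k))"] by auto
    qed
  qed
qed

text \<open>
  In an infinite semidecidable set, the pairs of an element and its least witness form a decidable
  set on which the first projection is injective; listing these pairs in increasing order
  enumerates the elements without repetition.
\<close>

lemma semidecidable_enumeration:
  assumes M: "semidecidable_in X (\<lambda>n. n \<in> M)" and inf: "infinite M"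
  obtains f where "recursive_in X f" "bij_betw f UNIV M"
proof -
  from M obtain D where D: "decidable_in X (\<lambda>m. D (first m) (second m))" "\<And>n. n \<in> M \<longleftrightarrow> (\<exists>k. D n k)"
    unfolding semidecidable_in_def by blast
  define A where "A = {m. D (first m) (second m) \<and> (\<forall>j<second m. \<not> D (first m) j)}"
  have decA: "decidable_in X (\<lambda>m. m \<in> A)"
    unfolding A_def mem_Collect_eq by (intro recursive_intros decidable_in_compose2 [OF D(1)])
  have inj: "inj_on first A"
  proof (rule inj_onI)
    fix m m' assume "m \<in> A" "m' \<in> A" "first m = first m'"
    then have "second m = second m'"
      unfolding A_def by (metis (mono_tags, lifting) linorder_cases mem_Collect_eq)
    with \<open>first m = first m'\<close> show "m = m'"
      by (metis prod_decode_eq prod_eqI)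
  qed
  have img: "first ` A = M"
  proof
    show "first ` A \<subseteq> M" using D(2) unfolding A_def by blast
    show "M \<subseteq> first ` A"
    proof
      fix n assume "n \<in> M"
      then have "\<exists>k. D n k" using D(2) by blast
      then have "pair n (LEAST k. D n k) \<in> A"
        unfolding A_def by (auto intro: LeastI_ex dest: not_less_Least)
      then show "n \<in> first ` A" by (metis fst_conv imageI prod_encode_inverse)
    qed
  qed
  then have infA: "infinite A" using inf by blast
  define S where "S = (\<lambda>m s. s \<in> A \<and> m < s)"
  have ex: "\<exists>s. S m s" for m
    using infA infinite_nat_iff_unbounded S_def by auto
  have least: "recursive_in X (\<lambda>m. LEAST s. S m s)"
  proof (rule recursive_in_Least [OF _ ex])
    show "decidable_in X (\<lambda>m. S (first m) (second m))"
      unfolding S_def by (intro recursive_intros decidable_in_compose [OF decA])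
  qed
  have next_rec: "recursive_in X (\<lambda>m. rec_nat (enumerate A 0) (\<lambda>k r. LEAST s. S r s) m)"
    by (intro recursive_intros recursive_in_compose [OF least])
  have "rec_nat (enumerate A 0) (\<lambda>k r. LEAST s. S r s) m = enumerate A m" for m
    by (induction m) (simp_all add: S_def enumerate_Suc'' [OF infA] del: enumerate_0)
  with next_rec have enum: "recursive_in X (enumerate A)" by simp
  show thesis
  proof (rule that)
    show "recursive_in X (\<lambda>n. first (enumerate A n))"
      by (intro recursive_intros recursive_in_compose [OF enum])
    have "bij_betw (enumerate A) UNIV A"
      using infA by (simp add: bij_enumerate)
    moreover have "bij_betw first A M"
      using inj img by (simp add: bij_betw_def)
    ultimately show "bij_betw (\<lambda>n. first (enumerate A n)) UNIV M"
      using bij_betw_trans [of "enumerate A" UNIV A first M] by (simp add: o_def)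
  qed
qed

section \<open>Arithmetic on codes of rationals\<close>

lemma recursive_in_parity:
  assumes "recursive_in X f"
  shows "recursive_in X (\<lambda>n. f n mod 2)"
proof -
  have "rec_nat 0 (\<lambda>k r. 1 - r) n = n mod 2" for n :: nat
    by (induction n) (simp_all, presburger)
  moreover have "recursive_in X (\<lambda>n. rec_nat 0 (\<lambda>k r. 1 - r) (f n))"
    by (intro recursive_intros assms)
  ultimately show ?thesis by simp
qed

lemma recursive_in_half:
  assumes "recursive_in X f"
  shows "recursive_in X (\<lambda>n. f n div 2)"
proof -
  have "(LEAST k. n < 2 * k + 2) = n div 2" for n :: nat
    by (rule Least_equality) auto
  moreover have "recursive_in X (\<lambda>n. LEAST k. n < 2 * k + 2)"
  proof (rule recursive_in_Least)
    show "\<exists>k. n < 2 * k + 2" for n :: nat by (rule exI [of _ n]) simp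
  qed (intro recursive_intros)
  ultimately have "recursive_in X (\<lambda>n. n div 2)" by simp
  then show ?thesis using assms by (rule recursive_in_compose)
qed

text \<open>
  The numerator of a rational is split into a difference of two natural numbers; sums, products and
  comparisons of rationals then become polynomial expressions in natural numbers.
\<close>

definition pos_part :: "nat \<Rightarrow> nat" where
  "pos_part c = (1 - first c mod 2) * (first c div 2)"

definition neg_part :: "nat \<Rightarrow> nat" where
  "neg_part c = (first c mod 2) * Suc (first c div 2)"

definition rat_code :: "nat \<Rightarrow> nat \<Rightarrow> nat \<Rightarrow> nat" where
  "rat_code a b d = pair (if b \<le> a then 2 * (a - b) else 2 * (b - a) - 1) d"

lemma recursive_in_parts [recursive_intros]:
  assumes "recursive_in X f"
  shows "recursive_in X (\<lambda>n. pos_part (f n))" "recursive_in X (\<lambda>n. neg_part (f n))"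
  unfolding pos_part_def neg_part_def
  by (intro recursive_intros recursive_in_parity recursive_in_half assms)+

lemma recursive_in_rat_code [recursive_intros]:
  assumes "recursive_in X f" "recursive_in X g" "recursive_in X h"
  shows "recursive_in X (\<lambda>n. rat_code (f n) (g n) (h n))"
  unfolding rat_code_def by (intro recursive_intros assms)

lemma rat_of_code_parts:
  "rat_of_code c = (of_nat (pos_part c) - of_nat (neg_part c)) / of_nat (Suc (second c))"
proof -
  have "int_decode m = int ((1 - m mod 2) * (m div 2)) - int ((m mod 2) * Suc (m div 2))" for m
    by (cases "even m") (auto simp: int_decode_def sum_decode_def even_iff_mod_2_eq_zero odd_iff_mod_2_eq_one)
  then show ?thesis
    unfolding rat_of_code_def pos_part_def neg_part_def by (simp add: case_prod_beta)
qed

lemma rat_of_code_rat_code: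
  "rat_of_code (rat_code a b d) = (of_nat a - of_nat b) / of_nat (Suc d)"
proof -
  have "int_decode (if b \<le> a then 2 * (a - b) else 2 * (b - a) - 1) = int a - int b"
  proof (cases "b \<le> a")
    case True
    then show ?thesis by (simp add: int_decode_def sum_decode_def)
  next
    case False
    then obtain m where "b = a + Suc m" by (metis add_Suc_right less_imp_Suc_add not_le)
    then show ?thesis by (simp add: int_decode_def sum_decode_def)
  qed
  then show ?thesis by (simp add: rat_of_code_def rat_code_def del: of_nat_Suc)
qed

definition rat_code_add :: "nat \<Rightarrow> nat \<Rightarrow> nat" where
  "rat_code_add x y = rat_code (pos_part x * Suc (second y) + pos_part y * Suc (second x))
     (neg_part x * Suc (second y) + neg_part y * Suc (second x)) (Suc (second x) * Suc (second y) - 1)"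

definition rat_code_mult :: "nat \<Rightarrow> nat \<Rightarrow> nat" where
  "rat_code_mult x y = rat_code (pos_part x * pos_part y + neg_part x * neg_part y)
     (pos_part x * neg_part y + neg_part x * pos_part y) (Suc (second x) * Suc (second y) - 1)"

definition rat_code_uminus :: "nat \<Rightarrow> nat" where
  "rat_code_uminus x = rat_code (neg_part x) (pos_part x) (second x)"

lemma rat_of_code_add: "rat_of_code (rat_code_add x y) = rat_of_code x + rat_of_code y"
proof -
  have "Suc (Suc (second x) * Suc (second y) - 1) = Suc (second x) * Suc (second y)" by simp
  then show ?thesis
    unfolding rat_code_add_def rat_of_code_rat_code rat_of_code_parts [of x] rat_of_code_parts [of y]
    by (simp only: of_nat_mult of_nat_add)
      (simp add: divide_simps del: of_nat_Suc, simp add: algebra_simps del: of_nat_Suc)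
qed

lemma rat_of_code_mult: "rat_of_code (rat_code_mult x y) = rat_of_code x * rat_of_code y"
proof -
  have "Suc (Suc (second x) * Suc (second y) - 1) = Suc (second x) * Suc (second y)" by simp
  then show ?thesis
    unfolding rat_code_mult_def rat_of_code_rat_code rat_of_code_parts [of x] rat_of_code_parts [of y]
    by (simp only: of_nat_mult of_nat_add)
      (simp add: divide_simps del: of_nat_Suc, simp add: algebra_simps del: of_nat_Suc)
qed

lemma rat_of_code_uminus: "rat_of_code (rat_code_uminus x) = - rat_of_code x"
  unfolding rat_code_uminus_def rat_of_code_rat_code rat_of_code_parts [of x]
  by (simp add: divide_simps del: of_nat_Suc)

lemma rat_of_code_surj: "\<exists>c. rat_of_code c = q"
proof -
  obtain a b where q: "q = of_int a / of_int b" "b > 0"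
    by (metis Fract_of_int_quotient quotient_of_unique)
  have "rat_of_code (rat_code (nat a) (nat (- a)) (nat b - 1)) = q"
    unfolding rat_of_code_rat_code q(1) using q(2)
    by (cases "a \<ge> 0") auto
  then show ?thesis by blast
qed

lemma recursive_in_rat_code_ops:
  shows "recursive_in X f \<Longrightarrow> recursive_in X g \<Longrightarrow> recursive_in X (\<lambda>n. rat_code_add (f n) (g n))"
    "recursive_in X f \<Longrightarrow> recursive_in X g \<Longrightarrow> recursive_in X (\<lambda>n. rat_code_mult (f n) (g n))"
    "recursive_in X f \<Longrightarrow> recursive_in X (\<lambda>n. rat_code_uminus (f n))"
  unfolding rat_code_add_def rat_code_mult_def rat_code_uminus_def
  by (intro recursive_intros; assumption)+

definition rat_recursive_in :: "nat set \<Rightarrow> (nat \<Rightarrow> rat) \<Rightarrow> bool" where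
  "rat_recursive_in X r \<longleftrightarrow> (\<exists>f. recursive_in X f \<and> r = (\<lambda>n. rat_of_code (f n)))"

lemma rat_recursive_in_of_code [recursive_intros]:
  "recursive_in X f \<Longrightarrow> rat_recursive_in X (\<lambda>n. rat_of_code (f n))"
  unfolding rat_recursive_in_def by blast

lemma rat_recursive_in_const [recursive_intros]: "rat_recursive_in X (\<lambda>n. c)"
proof -
  obtain d where "rat_of_code d = c" using rat_of_code_surj by blast
  then show ?thesis
    using rat_recursive_in_of_code [OF recursive_in_const [of X d]] by simp
qed

lemma rat_recursive_in_add [recursive_intros]:
  assumes "rat_recursive_in X r" "rat_recursive_in X s"
  shows "rat_recursive_in X (\<lambda>n. r n + s n)"
proof -
  from assms obtain f g where f: "recursive_in X f" "r = (\<lambda>n. rat_of_code (f n))"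
    and g: "recursive_in X g" "s = (\<lambda>n. rat_of_code (g n))"
    unfolding rat_recursive_in_def by blast
  show ?thesis
    unfolding f(2) g(2) rat_of_code_add [symmetric]
    by (intro recursive_intros recursive_in_rat_code_ops f g)
qed

lemma rat_recursive_in_mult [recursive_intros]:
  assumes "rat_recursive_in X r" "rat_recursive_in X s"
  shows "rat_recursive_in X (\<lambda>n. r n * s n)"
proof -
  from assms obtain f g where f: "recursive_in X f" "r = (\<lambda>n. rat_of_code (f n))"
    and g: "recursive_in X g" "s = (\<lambda>n. rat_of_code (g n))"
    unfolding rat_recursive_in_def by blast
  show ?thesis
    unfolding f(2) g(2) rat_of_code_mult [symmetric]
    by (intro recursive_intros recursive_in_rat_code_ops f g)
qed

lemma rat_recursive_in_uminus [recursive_intros]: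
  assumes "rat_recursive_in X r"
  shows "rat_recursive_in X (\<lambda>n. - r n)"
proof -
  from assms obtain f where f: "recursive_in X f" "r = (\<lambda>n. rat_of_code (f n))"
    unfolding rat_recursive_in_def by blast
  show ?thesis
    unfolding f(2) rat_of_code_uminus [symmetric]
    by (intro recursive_intros recursive_in_rat_code_ops f)
qed

lemma rat_recursive_in_diff [recursive_intros]:
  assumes "rat_recursive_in X r" "rat_recursive_in X s"
  shows "rat_recursive_in X (\<lambda>n. r n - s n)"
proof -
  have "rat_recursive_in X (\<lambda>n. r n + - s n)"
    by (intro recursive_intros assms)
  then show ?thesis by simp
qed

lemma rat_recursive_in_inverse_power2 [recursive_intros]:
  assumes "recursive_in X f"
  shows "rat_recursive_in X (\<lambda>n. 1 / 2 ^ f n)"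
proof -
  have "rat_recursive_in X (\<lambda>n. rat_of_code (rat_code 1 0 (2 ^ f n - 1)))"
    by (intro recursive_intros assms)
  moreover have "rat_of_code (rat_code 1 0 (2 ^ k - 1)) = 1 / 2 ^ k" for k
    by (simp add: rat_of_code_rat_code of_nat_diff del: of_nat_Suc) 
  ultimately show ?thesis by simp
qed

lemma decidable_in_rat_less [recursive_intros]:
  assumes "rat_recursive_in X r" "rat_recursive_in X s"
  shows "decidable_in X (\<lambda>n. r n < s n)"
proof -
  from assms obtain f g where f: "recursive_in X f" "r = (\<lambda>n. rat_of_code (f n))"
    and g: "recursive_in X g" "s = (\<lambda>n. rat_of_code (g n))"
    unfolding rat_recursive_in_def by blast
  have cmp: "rat_of_code x < rat_of_code y \<longleftrightarrow>
      pos_part x * Suc (second y) + neg_part y * Suc (second x)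
        < pos_part y * Suc (second x) + neg_part x * Suc (second y)" for x y
  proof -
    have "rat_of_code x < rat_of_code y \<longleftrightarrow>
        (of_nat (pos_part x) - of_nat (neg_part x)) * of_nat (Suc (second y))
          < (of_nat (pos_part y) - of_nat (neg_part y)) * (of_nat (Suc (second x)) :: rat)"
      unfolding rat_of_code_parts by (simp add: divide_simps del: of_nat_Suc)
    also have "\<dots> \<longleftrightarrow> (of_nat (pos_part x * Suc (second y) + neg_part y * Suc (second x)) :: rat)
        < of_nat (pos_part y * Suc (second x) + neg_part x * Suc (second y))"
      by (simp only: of_nat_mult of_nat_add) (simp add: algebra_simps del: of_nat_Suc)
    finally show ?thesis by (simp only: of_nat_less_iff)
  qed
  show ?thesis
    unfolding f(2) g(2) cmp by (intro recursive_intros f g)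
qed

lemma decidable_in_rat_le [recursive_intros]:
  assumes "rat_recursive_in X r" "rat_recursive_in X s"
  shows "decidable_in X (\<lambda>n. r n \<le> s n)"
proof -
  have "decidable_in X (\<lambda>n. \<not> s n < r n)"
    by (intro recursive_intros assms)
  then show ?thesis by (simp add: not_less)
qed

lemma decidable_in_rat_eq [recursive_intros]:
  assumes "rat_recursive_in X r" "rat_recursive_in X s"
  shows "decidable_in X (\<lambda>n. r n = s n)"
proof -
  have "decidable_in X (\<lambda>n. r n \<le> s n \<and> s n \<le> r n)"
    by (intro recursive_intros assms)
  then show ?thesis by (simp add: eq_iff)
qed

abbreviation gauss :: "nat \<Rightarrow> complex" where "gauss \<equiv> gauss_rat_of_code"
abbreviation vec :: "(nat \<Rightarrow> 'a::complex_banach) \<Rightarrow> nat \<Rightarrow> 'a" where "vec \<equiv> vector_of_code"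

lemma Re_gauss_rat_of_code [simp]: "Re (gauss c) = of_rat (rat_of_code (first c))"
  and Im_gauss_rat_of_code [simp]: "Im (gauss c) = of_rat (rat_of_code (second c))"
  by (simp_all add: gauss_rat_of_code_def case_prod_beta)

lemma prod_decode_0 [simp]: "prod_decode 0 = (0, 0)"
  by (simp add: prod_decode_def prod_decode_aux.simps)

lemma gauss_rat_of_code_0 [simp]: "gauss 0 = 0"
  by (simp add: complex_eq_iff rat_of_code_def int_decode_def sum_decode_def)

lemma ex_gauss_code: "\<exists>c. gauss c = Complex (of_rat q) (of_rat r)"
proof -
  obtain a b where "rat_of_code a = q" "rat_of_code b = r" using rat_of_code_surj by meson
  then show ?thesis by (intro exI [of _ "pair a b"]) (simp add: complex_eq_iff)
qed

lemma ex_gauss_code_units: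
  "\<exists>c. gauss c = 1" "\<exists>c. gauss c = - 1"
  "\<exists>c. gauss c = \<i>" "\<exists>c. gauss c = - \<i>"
  using ex_gauss_code [of 1 0] ex_gauss_code [of "- 1" 0] ex_gauss_code [of 0 1] ex_gauss_code [of 0 "- 1"]
  by (simp_all add: complex_eq_iff of_rat_minus)

lemma gauss_rat_of_code_dense:
  assumes "e > 0"
  obtains c where "cmod (gauss c - z) < e"
proof -
  have "\<exists>a. \<bar>of_rat (rat_of_code a) - x\<bar> < e / 2" for x :: real
  proof -
    obtain q where "x < of_rat q" "of_rat q < x + e / 2"
      using of_rat_dense [of x "x + e / 2"] assms by auto
    moreover obtain a where "rat_of_code a = q" using rat_of_code_surj by blast
    ultimately show ?thesis by (intro exI [of _ a]) auto
  qed
  then obtain a b where "\<bar>of_rat (rat_of_code a) - Re z\<bar> < e / 2" "\<bar>of_rat (rat_of_code b) - Im z\<bar> < e / 2"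
    by meson
  then have "cmod (gauss (pair a b) - z) < e"
    using cmod_le [of "gauss (pair a b) - z"] by simp
  then show thesis by (rule that)
qed

text \<open>
  The size of a coefficient is bounded by a computable function of its code; this fixes in
  advance how precisely a basis vector must be known before it is multiplied by the coefficient.
\<close>

lemma cmod_gauss_rat_of_code_le: "cmod (gauss c) \<le> 2 ^ Suc c"
proof -
  have rat: "\<bar>real_of_rat (rat_of_code a)\<bar> \<le> real (Suc a)" for a
  proof -
    have "first a \<le> a" by (metis le_prod_encode_1 prod_decode_inverse prod.collapse)
    have dec: "\<bar>int_decode m\<bar> \<le> int (Suc m)" for m
      by (cases "even m") (auto simp: int_decode_def sum_decode_def)
    have "\<bar>rat_of_code a\<bar> \<le> of_int \<bar>int_decode (first a)\<bar>"
      by (simp add: rat_of_code_def case_prod_beta abs_divide divide_le_eq mult_le_cancel_left1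
          flip: of_int_abs of_nat_Suc)
    also have "\<dots> \<le> of_nat (Suc a)"
    proof -
      have "\<bar>int_decode (first a)\<bar> \<le> int (Suc a)" using dec [of "first a"] \<open>first a \<le> a\<close> by linarith
      then have "(of_int \<bar>int_decode (first a)\<bar> :: rat) \<le> of_int (int (Suc a))" by (simp only: of_int_le_iff)
      then show ?thesis by simp
    qed
    finally have "real_of_rat \<bar>rat_of_code a\<bar> \<le> real_of_rat (of_nat (Suc a))"
      by (simp only: of_rat_less_eq)
    then show ?thesis by (simp only: of_rat_of_nat_eq abs_of_rat)
  qed
  have "first c \<le> c" "second c \<le> c"
    by (metis le_prod_encode_1 le_prod_encode_2 prod_decode_inverse prod.collapse)+
  then have "cmod (gauss c) \<le> real (Suc c) + real (Suc c)"
    using cmod_le [of "gauss c"] rat [of "first c"] rat [of "second c"] by simp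
  also have "\<dots> = 2 * real (Suc c)" by simp
  also have "\<dots> \<le> 2 * 2 ^ c"
  proof -
    have "Suc c \<le> 2 ^ c" using less_exp [of c] by linarith
    then have "real (Suc c) \<le> real (2 ^ c)" by (simp only: of_nat_le_iff)
    then show ?thesis by simp
  qed
  finally show ?thesis by simp
qed

section \<open>Codes of vectors\<close>

definition code_drop :: "nat \<Rightarrow> nat \<Rightarrow> nat" where
  "code_drop v i = list_encode (drop i (list_decode v))"

definition code_length :: "nat \<Rightarrow> nat" where
  "code_length v = length (list_decode v)"

definition coeff :: "nat \<Rightarrow> nat \<Rightarrow> nat" where
  "coeff v i = (if i < code_length v then list_decode v ! i else 0)"

lemma recursive_in_code_drop:
  assumes "recursive_in X f" "recursive_in X g"
  shows "recursive_in X (\<lambda>n. code_drop (f n) (g n))"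
proof -
  \<comment> \<open>This includes the empty list, because \<open>0 - 1 = 0\<close> is also the code of the pair \<open>(0, 0)\<close>.\<close>
  have tl: "second (list_encode xs - 1) = list_encode (tl xs)" for xs
    by (cases xs) auto
  have "rec_nat v (\<lambda>k r. second (r - 1)) i = code_drop v i" for v i
    by (induction i) (simp_all only: old.nat.simps(6,7) code_drop_def drop_0 list_decode_inverse tl drop_Suc tl_drop)
  moreover have "recursive_in X (\<lambda>n. rec_nat (f n) (\<lambda>k r. second (r - 1)) (g n))"
    by (intro recursive_intros assms)
  ultimately show ?thesis by simp
qed

lemma recursive_in_code_length [recursive_intros]:
  assumes "recursive_in X f"
  shows "recursive_in X (\<lambda>n. code_length (f n))"
proof -
  have iff: "code_drop v k = 0 \<longleftrightarrow> code_length v \<le> k" for v k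
    by (metis code_drop_def code_length_def drop_eq_Nil2 list_encode.simps(1) list_encode_inverse)
  have "(LEAST k. code_drop v k = 0) = code_length v" for v
    by (rule Least_equality) (auto simp: iff)
  moreover have "recursive_in X (\<lambda>v. LEAST k. code_drop v k = 0)"
    by (rule recursive_in_Least) (intro recursive_intros recursive_in_code_drop, use iff in blast)
  ultimately have "recursive_in X (\<lambda>v. code_length v)" by simp
  then show ?thesis using assms by (rule recursive_in_compose)
qed

lemma recursive_in_coeff [recursive_intros]:
  assumes "recursive_in X f" "recursive_in X g"
  shows "recursive_in X (\<lambda>n. coeff (f n) (g n))"
proof -
  have "coeff v i = first (code_drop v i - 1)" for v i
  proof (cases "i < code_length v")
    case True
    then show ?thesis
      by (simp add: coeff_def code_drop_def code_length_def flip: Cons_nth_drop_Suc)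
  qed (simp add: coeff_def code_drop_def code_length_def)
  then show ?thesis
    by (auto intro!: recursive_intros recursive_in_code_drop assms)
qed

lemma recursive_in_list_encode_map:
  assumes g: "recursive_in X (\<lambda>m. g (first m) (second m))" and l: "recursive_in X l"
  shows "recursive_in X (\<lambda>n. list_encode (map (g n) [0..<l n]))"
proof -
  \<comment> \<open>The list is built from its end.\<close>
  have "j \<le> L \<Longrightarrow> rec_nat 0 (\<lambda>k r. Suc (pair (g n (L - Suc k)) r)) j
      = list_encode (map (g n) [L - j..<L])" for n j L
  proof (induction j)
    case (Suc j)
    then have "[L - Suc j..<L] = (L - Suc j) # [L - j..<L]"
      by (simp add: upt_conv_Cons Suc_diff_Suc)
    with Suc show ?case by simp
  qed simp
  from this [of "l _" "l _"]
  have "rec_nat 0 (\<lambda>k r. Suc (pair (g n (l n - Suc k)) r)) (l n) = list_encode (map (g n) [0..<l n])" for n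
    by simp
  moreover have "recursive_in X (\<lambda>n. rec_nat 0 (\<lambda>k r. Suc (pair (g n (l n - Suc k)) r)) (l n))"
    by (intro recursive_intros recursive_in_compose2 [OF g] l recursive_in_compose [OF l])
  ultimately show ?thesis by simp
qed

lemma code_length_list_encode_map [simp]: "code_length (list_encode (map g [0..<l])) = l"
  by (simp add: code_length_def)

lemma coeff_list_encode_map: "coeff (list_encode (map g [0..<l])) i = (if i < l then g i else 0)"
  by (simp add: coeff_def code_length_def)

interpretation scaleC: vector_space "scaleC :: complex \<Rightarrow> 'a \<Rightarrow> 'a::complex_banach"
  by (rule vector_space_scaleC)

lemma vector_of_code_eq_sum:
  assumes "code_length v \<le> L"
  shows "vec F v = (\<Sum>i<L. gauss (coeff v i) *\<^sub>C F i)"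
proof -
  have "vec F v = (\<Sum>i<code_length v. gauss (coeff v i) *\<^sub>C F i)"
    unfolding vector_of_code_def code_length_def [symmetric]
    by (rule sum.cong) (auto simp: coeff_def)
  also have "\<dots> = (\<Sum>i<L. gauss (coeff v i) *\<^sub>C F i)"
    by (rule sum.mono_neutral_left) (use assms in \<open>auto simp: coeff_def\<close>)
  finally show ?thesis .
qed

text \<open>
  Named after the operation \<open>x + c y\<close> of BLAS.
\<close>

definition gauss_code_axpy :: "nat \<Rightarrow> nat \<Rightarrow> nat \<Rightarrow> nat" where
  "gauss_code_axpy x c y =
     pair (rat_code_add (first x) (rat_code_add (rat_code_mult (first c) (first y))
             (rat_code_uminus (rat_code_mult (second c) (second y)))))
          (rat_code_add (second x) (rat_code_add (rat_code_mult (first c) (second y))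
             (rat_code_mult (second c) (first y))))"

lemma gauss_rat_of_code_axpy:
  "gauss (gauss_code_axpy x c y) =
     gauss x + gauss c * gauss y"
  by (simp add: complex_eq_iff gauss_code_axpy_def rat_of_code_add rat_of_code_mult
      rat_of_code_uminus of_rat_add of_rat_mult of_rat_minus of_rat_diff)

definition vector_code_axpy :: "nat \<Rightarrow> nat \<Rightarrow> nat \<Rightarrow> nat" where
  "vector_code_axpy u c v =
     list_encode (map (\<lambda>i. gauss_code_axpy (coeff u i) c (coeff v i))
       [0..<if code_length u \<le> code_length v then code_length v else code_length u])"

lemma recursive_in_vector_code_axpy [recursive_intros]:
  assumes "recursive_in X f" "recursive_in X g" "recursive_in X h"
  shows "recursive_in X (\<lambda>n. vector_code_axpy (f n) (g n) (h n))"
  unfolding vector_code_axpy_def gauss_code_axpy_def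
  by (intro recursive_in_list_encode_map recursive_intros recursive_in_rat_code_ops
      recursive_in_compose [OF assms(1)] recursive_in_compose [OF assms(2)]
      recursive_in_compose [OF assms(3)])

lemma code_length_axpy: "code_length (vector_code_axpy u c v) = max (code_length u) (code_length v)"
  by (simp add: vector_code_axpy_def max_def)

lemma vector_of_code_axpy:
  "vec F (vector_code_axpy u c v) =
     vec F u + gauss c *\<^sub>C vec F v"
proof -
  define L where "L = max (code_length u) (code_length v)"
  have "vec F (vector_code_axpy u c v) =
      (\<Sum>i<L. gauss (coeff (vector_code_axpy u c v) i) *\<^sub>C F i)"
    by (rule vector_of_code_eq_sum) (simp add: code_length_axpy L_def)
  also have "\<dots> = (\<Sum>i<L. (gauss (coeff u i) + gauss c * gauss (coeff v i)) *\<^sub>C F i)"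
    by (rule sum.cong)
      (auto simp: vector_code_axpy_def coeff_list_encode_map gauss_rat_of_code_axpy L_def)
  also have "\<dots> = (\<Sum>i<L. gauss (coeff u i) *\<^sub>C F i)
      + gauss c *\<^sub>C (\<Sum>i<L. gauss (coeff v i) *\<^sub>C F i)"
    by (simp add: scaleC_add_left sum.distrib scaleC.scale_sum_right)
  also have "\<dots> = vec F u + gauss c *\<^sub>C vec F v"
    by (simp add: vector_of_code_eq_sum [of _ L] L_def)
  finally show ?thesis .
qed

lemma vector_code_iff: "vector_code N v \<longleftrightarrow> enat (code_length v) \<le> N"
  by (simp add: vector_code_def code_length_def)

lemma vector_code_axpy_closed:
  "vector_code N u \<Longrightarrow> vector_code N v \<Longrightarrow> vector_code N (vector_code_axpy u c v)"
  by (simp add: vector_code_iff code_length_axpy max_def)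

lemma vector_code_0 [simp]: "vector_code N 0"
  by (simp add: vector_code_def flip: zero_enat_def)

lemma vector_of_code_0 [simp]: "vec F 0 = 0"
  by (simp add: vector_of_code_def)

lemma decidable_in_enat_le [recursive_intros]:
  assumes "recursive_in X f"
  shows "decidable_in X (\<lambda>n. enat (f n) \<le> N)"
  by (cases N) (auto intro!: recursive_intros assms)

lemma decidable_in_vector_code [recursive_intros]:
  assumes "recursive_in X f"
  shows "decidable_in X (\<lambda>n. vector_code N (f n))"
  unfolding vector_code_iff by (intro recursive_intros assms)

lemma rational_vectors_dense:
  fixes F :: "nat \<Rightarrow> 'a::complex_banach"
  assumes "generating_set N F" "e > 0"
  obtains v where "vector_code N v" "norm (vec F v - x) < e"
proof -
  define R where "R = {y. \<forall>e>0. \<exists>v. vector_code N v \<and> norm (vec F v - y) < e}"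
  have R: "\<exists>v. vector_code N v \<and> norm (vec F v - y) < e" if "y \<in> R" "e > 0" for y e
    using that unfolding R_def by blast
  have closed: "closure R \<subseteq> R"
  proof
    fix y assume y: "y \<in> closure R"
    show "y \<in> R" unfolding R_def
    proof (intro CollectI allI impI)
      fix e :: real assume "e > 0"
      then obtain z where z: "z \<in> R" "norm (z - y) < e / 2"
        using y unfolding closure_approachable dist_norm by (metis half_gt_zero)
      then obtain v where v: "vector_code N v" "norm (vec F v - z) < e / 2"
        using R [of z "e / 2"] \<open>e > 0\<close> by auto
      then have "norm (vec F v - y) < e"
        using z(2) norm_triangle_ineq [of "vec F v - z" "z - y"] by simp
      with v(1) show "\<exists>v. vector_code N v \<and> norm (vec F v - y) < e" by blast
    qed
  qed
  have "y \<in> R" if "y \<in> scaleC.span (members N F)" for y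
    using that
  proof (induction rule: scaleC.span_induct_alt)
    case base
    have "norm (vec F 0 - 0) < e" if "e > 0" for e
      using that by simp
    then show ?case unfolding R_def using vector_code_0 by blast
  next
    case (step c x y)
    then obtain i where i: "enat i < N" "x = F i" unfolding members_def by blast
    show ?case unfolding R_def
    proof (intro CollectI allI impI)
      fix e :: real assume e: "e > 0"
      obtain v where v: "vector_code N v" "norm (vec F v - y) < e / 2"
        using R [of y "e / 2"] step e by auto
      have "e / 2 / (norm x + 1) > 0" using e by (intro divide_pos_pos add_nonneg_pos) auto
      then obtain d where d: "cmod (gauss d - c) < e / 2 / (norm x + 1)"
        by (rule gauss_rat_of_code_dense)
      obtain c1 where c1: "gauss c1 = 1" using ex_gauss_code_units by blast
      define u where "u = list_encode (map (\<lambda>j. if j = i then c1 else 0) [0..<Suc i])"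
      have u: "code_length u = Suc i" "vec F u = F i"
      proof -
        show l: "code_length u = Suc i" by (simp add: u_def del: upt_Suc)
        have "vec F u = (\<Sum>j<Suc i. gauss (coeff u j) *\<^sub>C F j)"
          using l by (intro vector_of_code_eq_sum) simp
        also have "\<dots> = (\<Sum>j<Suc i. if j = i then F i else 0)"
          by (rule sum.cong) (auto simp: u_def coeff_list_encode_map c1 scaleC_one simp del: upt_Suc)
        finally show "vec F u = F i" by simp
      qed
      then have "vector_code N u" using i(1) by (simp add: vector_code_iff Suc_ile_eq)
      then have "vector_code N (vector_code_axpy v d u)" using v(1) vector_code_axpy_closed by blast
      moreover have "norm (vec F (vector_code_axpy v d u) - (c *\<^sub>C x + y)) < e"
      proof -
        have eq: "vec F (vector_code_axpy v d u) - (c *\<^sub>C x + y) =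
            (vec F v - y) + (gauss d - c) *\<^sub>C x"
          by (simp add: vector_of_code_axpy u i scaleC.scale_left_diff_distrib)
        have "norm ((gauss d - c) *\<^sub>C x) \<le> e / 2"
        proof -
          have "norm ((gauss d - c) *\<^sub>C x) \<le> e / 2 / (norm x + 1) * (norm x + 1)"
            unfolding norm_scaleC using d e by (intro mult_mono divide_nonneg_nonneg add_nonneg_nonneg) auto
          moreover have "a / b * b = a" if "b \<noteq> 0" for a b :: real using that by simp
          moreover have "norm x + 1 \<noteq> 0" using norm_ge_zero [of x] by linarith
          ultimately show ?thesis by metis
        qed
        moreover have "norm ((vec F v - y) + (gauss d - c) *\<^sub>C x)
            \<le> norm (vec F v - y) + norm ((gauss d - c) *\<^sub>C x)"
          by (rule norm_triangle_ineq)
        ultimately show ?thesis unfolding eq using v(2) by linarith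
      qed
      ultimately show "\<exists>v. vector_code N v \<and> norm (vec F v - (c *\<^sub>C x + y)) < e" by blast
    qed
  qed
  then have "closure (scaleC.span (members N F)) \<subseteq> closure R" by (intro closure_mono) blast
  then have "x \<in> R" using assms(1) closed unfolding generating_set_def by auto
  with \<open>e > 0\<close> show thesis using that unfolding R_def by blast
qed

text \<open>
  The given program computes norms on codes of vectors only and may diverge on other numbers, so
  it is run on a code that is first replaced by 0 if it names no vector.
\<close>

lemma semidecidable_norm:
  fixes F :: "nat \<Rightarrow> 'a::complex_banach"
  assumes "effective_generating_set N F" "recursive_in {} f" "rat_recursive_in {} r"
  shows "semidecidable_in {} (\<lambda>n. vector_code N (f n) \<and> norm (vec F (f n)) < of_rat (r n))"
    and "semidecidable_in {} (\<lambda>n. vector_code N (f n) \<and> of_rat (r n) < norm (vec F (f n)))"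
proof -
  from assms(1) obtain P where P: "\<And>v k. vector_code N v \<Longrightarrow>
           (\<exists>q. run {} P (pair v k) = Some q \<and>
                \<bar>norm (vec F v) - of_rat (rat_of_code q)\<bar> < 1 / 2 ^ k)"
    unfolding effective_generating_set_def by blast
  have "recursive_in {} (\<lambda>m. pair (if vector_code N (first m) then first m else 0) (second m))"
    by (intro recursive_intros)
  then obtain Q where Q: "\<And>m. run {} Q m = Some (pair (if vector_code N (first m) then first m else 0) (second m))"
    unfolding recursive_in_def by blast
  define g where "g = (\<lambda>m. the (run {} (PComp P Q) m))"
  have some: "run {} (PComp P Q) m = Some (g m)" for m
    using P [of "if vector_code N (first m) then first m else 0" "second m"]
    by (auto simp: g_def Q)
  then have g: "recursive_in {} g" unfolding recursive_in_def by blast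
  have approx: "\<bar>norm (vec F v) - of_rat (rat_of_code (g (pair v k)))\<bar> < 1 / 2 ^ k"
    if "vector_code N v" for v k
    using P [OF that, of k] some [of "pair v k"] that by (auto simp: Q)
  have power: "real_of_rat (1 / 2 ^ k) = 1 / 2 ^ k" for k
    by (simp add: of_rat_divide of_rat_power)
  have small: "\<exists>k. 2 / 2 ^ k < e" if "e > 0" for e :: real
    using real_arch_pow_inv [of "e / 2" "1 / 2"] that by (auto simp: power_one_over field_simps)
  from assms(3) obtain c where c: "recursive_in {} c" "r = (\<lambda>n. rat_of_code (c n))"
    unfolding rat_recursive_in_def by blast
  note rec = recursive_intros recursive_in_compose [OF g] recursive_in_compose [OF assms(2)]
    recursive_in_compose [OF c(1)] decidable_imp_semidecidable semidecidable_in_ex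
  \<comment> \<open>Upper bounds (\<open>t = 1\<close>) and lower bounds (\<open>t = -1\<close>) are treated together.\<close>
  have semi: "semidecidable_in {} (\<lambda>n. vector_code N (f n) \<and> of_rat t * norm (vec F (f n)) < of_rat (t * r n))"
    if t: "t = 1 \<or> t = - 1" for t
  proof -
    have approx_t: "\<bar>of_rat t * norm (vec F v) - of_rat (t * rat_of_code (g (pair v k)))\<bar> < 1 / 2 ^ k"
      if "vector_code N v" for v k
      using approx [OF that, of k] t by (auto simp: of_rat_minus abs_if split: if_splits)
    have "vector_code N (f n) \<and> of_rat t * norm (vec F (f n)) < of_rat (t * r n) \<longleftrightarrow>
        (\<exists>k. vector_code N (f n) \<and> t * rat_of_code (g (pair (f n) k)) + 1 / 2 ^ k < t * r n)" for n
    proof (intro iffI; elim conjE exE)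
      assume v: "vector_code N (f n)" and "of_rat t * norm (vec F (f n)) < of_rat (t * r n)"
      then obtain k where "2 / 2 ^ k < of_rat (t * r n) - of_rat t * norm (vec F (f n))"
        using small by (meson diff_gt_0_iff_gt)
      then have "of_rat (t * rat_of_code (g (pair (f n) k)) + 1 / 2 ^ k) < (of_rat (t * r n) :: real)"
        using approx_t [OF v, of k] unfolding of_rat_add power by simp
      then show "\<exists>k. vector_code N (f n) \<and> t * rat_of_code (g (pair (f n) k)) + 1 / 2 ^ k < t * r n"
        using v unfolding of_rat_less by blast
    next
      fix k assume v: "vector_code N (f n)" and "t * rat_of_code (g (pair (f n) k)) + 1 / 2 ^ k < t * r n"
      then have "of_rat (t * rat_of_code (g (pair (f n) k)) + 1 / 2 ^ k) < (of_rat (t * r n) :: real)"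
        unfolding of_rat_less by blast
      then show "vector_code N (f n) \<and> of_rat t * norm (vec F (f n)) < of_rat (t * r n)"
        using v approx_t [OF v, of k] unfolding of_rat_add power by simp
    qed
    moreover have "semidecidable_in {}
        (\<lambda>n. \<exists>k. vector_code N (f n) \<and> t * rat_of_code (g (pair (f n) k)) + 1 / 2 ^ k < t * r n)"
      unfolding c(2) by (intro rec)
    ultimately show ?thesis by simp
  qed
  show "semidecidable_in {} (\<lambda>n. vector_code N (f n) \<and> norm (vec F (f n)) < of_rat (r n))"
    using semi [of 1] by simp
  show "semidecidable_in {} (\<lambda>n. vector_code N (f n) \<and> of_rat (r n) < norm (vec F (f n)))"
    using semi [of "- 1"] by (simp add: of_rat_minus)
qed

section \<open>Isometries from matching bases\<close>

lemma bounded_linear_scaleC: "bounded_linear (\<lambda>x::'a::complex_banach. a *\<^sub>C x)"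
proof (rule bounded_linear_intro)
  show "a *\<^sub>C (r *\<^sub>R x) = r *\<^sub>R (a *\<^sub>C x)" for r and x :: 'a
    by (simp add: scaleR_scaleC scaleC_scaleC mult.commute)
  show "norm (a *\<^sub>C x) \<le> norm x * cmod a" for x :: 'a
    by (simp add: norm_scaleC mult.commute)
qed (rule scaleC_add_right)

text \<open>
  The image of the standard unit vectors of \<open>\<ell>\<^sup>p\<close> under a surjective isometry, characterized
  without mentioning the isometry.
\<close>

definition lp_basis :: "real \<Rightarrow> (nat \<Rightarrow> 'a::complex_banach) \<Rightarrow> bool" where
  "lp_basis p e \<longleftrightarrow>
     (\<forall>c n. norm (\<Sum>i<n. c i *\<^sub>C e i) = (\<Sum>i<n. cmod (c i) powr p) powr (1 / p)) \<and>
     closure (scaleC.span (range e)) = UNIV"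

definition recursive_basis ::
    "nat set \<Rightarrow> real \<Rightarrow> enat \<Rightarrow> (nat \<Rightarrow> 'a::complex_banach) \<Rightarrow> (nat \<Rightarrow> 'a) \<Rightarrow> (nat \<Rightarrow> nat \<Rightarrow> nat) \<Rightarrow> bool" where
  "recursive_basis X p N F e a \<longleftrightarrow>
     lp_basis p e \<and> recursive_in X (\<lambda>m. a (first m) (second m)) \<and>
     (\<forall>n k. vector_code N (a n k)) \<and> (\<forall>n k. norm (vec F (a n k) - e n) < 1 / 2 ^ k)"

lemma span_range_eq_combinations:
  fixes e :: "nat \<Rightarrow> 'a::complex_banach"
  shows "scaleC.span (range e) = {\<Sum>i<n. c i *\<^sub>C e i |c n. True}"
proof
  show "{\<Sum>i<n. c i *\<^sub>C e i |c n. True} \<subseteq> scaleC.span (range e)"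
    by clarify (intro scaleC.span_sum scaleC.span_scale scaleC.span_base rangeI)
  show "scaleC.span (range e) \<subseteq> {\<Sum>i<n. c i *\<^sub>C e i |c n. True}"
  proof
    fix x assume "x \<in> scaleC.span (range e)"
    then show "x \<in> {\<Sum>i<n. c i *\<^sub>C e i |c n. True}"
    proof (induction rule: scaleC.span_induct_alt)
      case base
      have "\<exists>c n. 0 = (\<Sum>i<n. c i *\<^sub>C e i)"
        by (intro exI [of _ "\<lambda>_. 0"] exI [of _ 0]) simp
      then show ?case by blast
    next
      case (step a x y)
      then obtain j c n where j: "x = e j" and y: "y = (\<Sum>i<n. c i *\<^sub>C e i)" by blast
      define L where "L = max n (Suc j)"
      have "y = (\<Sum>i<L. (if i < n then c i else 0) *\<^sub>C e i)"
        unfolding y by (rule sum.mono_neutral_cong_left) (auto simp: L_def)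
      moreover have "a *\<^sub>C x = (\<Sum>i<L. (if i = j then a else 0) *\<^sub>C e i)"
      proof -
        have "(\<Sum>i<L. (if i = j then a else 0) *\<^sub>C e i) = (\<Sum>i<L. if i = j then a *\<^sub>C e i else 0)"
          by (rule sum.cong) auto
        then show ?thesis by (simp add: j L_def less_max_iff_disj)
      qed
      ultimately have "a *\<^sub>C x + y = (\<Sum>i<L. ((if i = j then a else 0) + (if i < n then c i else 0)) *\<^sub>C e i)"
        by (simp add: scaleC_add_left sum.distrib)
      then show ?case by (intro CollectI exI conjI) auto
    qed
  qed
qed

text \<open>
  Two such sequences give equal norms to combinations with the same coefficients. So the map between
  the combinations is well defined and isometric, and it extends by completeness.
\<close>

lemma lp_basis_isometry:
  fixes e :: "nat \<Rightarrow> 'a::complex_banach" and e' :: "nat \<Rightarrow> 'b::complex_banach"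
  assumes e: "lp_basis p e" and e': "lp_basis p e'"
  obtains T where "linear_isometry T" "surj T" "\<And>n. T (e n) = e' n"
proof -
  define S where "S = (\<lambda>c n. \<Sum>i<n. c i *\<^sub>C e i)"
  define S' where "S' = (\<lambda>c n. \<Sum>i<n. c i *\<^sub>C e' i)"
  define cut where "cut = (\<lambda>(c :: nat \<Rightarrow> complex) n i. if i < n then c i else 0)"
  have cut: "S c n = S (cut c n) L" "S' c n = S' (cut c n) L" if "n \<le> L" for c n L
    unfolding S_def S'_def by (rule sum.mono_neutral_cong_left; use that in \<open>auto simp: cut_def\<close>)+
  have norm_eq: "norm (S c n) = norm (S' c n)" for c n
    using e e' unfolding lp_basis_def S_def S'_def by simp
  have diff: "S c n - S d n = S (\<lambda>i. c i - d i) n" "S' c n - S' d n = S' (\<lambda>i. c i - d i) n" for c d n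
    by (simp_all add: S_def S'_def sum_subtractf scaleC.scale_left_diff_distrib)
  have iso: "norm (S c n - S d m) = norm (S' c n - S' d m)" for c d n m
    using cut [of n "max n m" c] cut [of m "max n m" d] by (simp add: diff norm_eq)
  define D where "D = {S c n |c n. True}"
  have D: "closure D = UNIV"
    using e unfolding lp_basis_def span_range_eq_combinations D_def S_def by blast
  have D': "closure {S' c n |c n. True} = UNIV"
    using e' unfolding lp_basis_def span_range_eq_combinations S'_def by blast
  define T0 where "T0 = (\<lambda>x. SOME y. \<exists>c n. x = S c n \<and> y = S' c n)"
  have T0: "T0 (S c n) = S' c n" for c n
  proof -
    have "\<exists>d m. S c n = S d m \<and> T0 (S c n) = S' d m"
      unfolding T0_def by (rule someI_ex) blast
    then obtain d m where "S c n = S d m" "T0 (S c n) = S' d m" by blast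
    then show ?thesis using iso [of d m c n] by simp
  qed
  have "uniformly_continuous_on D T0"
    unfolding uniformly_continuous_on_def
  proof (intro allI impI)
    fix r :: real assume "r > 0"
    moreover have "dist (T0 y) (T0 x) = dist y x" if "x \<in> D" "y \<in> D" for x y
      using that iso unfolding D_def by (auto simp: T0 dist_norm)
    ultimately show "\<exists>d>0. \<forall>x\<in>D. \<forall>x'\<in>D. dist x' x < d \<longrightarrow> dist (T0 x') (T0 x) < r" by auto
  qed
  then obtain T where T: "uniformly_continuous_on (closure D) T" "\<And>x. x \<in> D \<Longrightarrow> T0 x = T x"
    by (metis uniformly_continuous_on_extension_on_closure)
  have cont: "isCont T x" for x
    using uniformly_continuous_imp_continuous [OF T(1)] D
    by (simp add: continuous_on_eq_continuous_at)
  have TS: "T (S c n) = S' c n" for c n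
  proof -
    have "S c n \<in> D" unfolding D_def by blast
    then show ?thesis using T(2) T0 by metis
  qed
  have seq: "\<exists>c n. (\<lambda>k. S (c k) (n k)) \<longlonglongrightarrow> x" for x
  proof -
    have "x \<in> closure D" using D by simp
    then obtain s where s: "\<forall>k. s k \<in> D" "s \<longlonglongrightarrow> x" unfolding closure_sequential by blast
    then have "\<forall>k. \<exists>c n. s k = S c n" unfolding D_def by blast
    then obtain c n where "s = (\<lambda>k. S (c k) (n k))" by metis
    with s(2) show ?thesis by blast
  qed
  have lim: "(\<lambda>k. S' (c k) (n k)) \<longlonglongrightarrow> T x" if "(\<lambda>k. S (c k) (n k)) \<longlonglongrightarrow> x" for c n x
    using isCont_tendsto_compose [OF cont that] by (simp add: TS)
  have T_add: "T (x + y) = T x + T y" for x y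
  proof -
    obtain c n where x: "(\<lambda>k. S (c k) (n k)) \<longlonglongrightarrow> x" using seq by blast
    obtain d m where y: "(\<lambda>k. S (d k) (m k)) \<longlonglongrightarrow> y" using seq by blast
    define L where "L = (\<lambda>k. max (n k) (m k))"
    define f where "f = (\<lambda>k i. cut (c k) (n k) i + cut (d k) (m k) i)"
    have "S (c k) (n k) + S (d k) (m k) = S (f k) (L k)"
      and "S' (c k) (n k) + S' (d k) (m k) = S' (f k) (L k)" for k
      using cut [of "n k" "L k" "c k"] cut [of "m k" "L k" "d k"]
      by (simp_all add: f_def L_def S_def S'_def scaleC_add_left sum.distrib)
    then show ?thesis
      using lim [of f L "x + y"] tendsto_add [OF x y] tendsto_add [OF lim [OF x] lim [OF y]]
      by (auto intro: LIMSEQ_unique)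
  qed
  have T_scale: "T (a *\<^sub>C x) = a *\<^sub>C T x" for a x
  proof -
    obtain c n where x: "(\<lambda>k. S (c k) (n k)) \<longlonglongrightarrow> x" using seq by blast
    have "a *\<^sub>C S (c k) (n k) = S (\<lambda>i. a * c k i) (n k)"
      and "a *\<^sub>C S' (c k) (n k) = S' (\<lambda>i. a * c k i) (n k)" for k
      by (simp_all add: S_def S'_def scaleC.scale_sum_right scaleC_scaleC)
    then show ?thesis
      using lim [of "\<lambda>k i. a * c k i" n "a *\<^sub>C x"] bounded_linear.tendsto [OF bounded_linear_scaleC x, of a]
        bounded_linear.tendsto [OF bounded_linear_scaleC lim [OF x], of a]
      by (auto intro: LIMSEQ_unique)
  qed
  have T_norm: "norm (T x - T y) = norm (x - y)" for x y
  proof -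
    obtain c n where x: "(\<lambda>k. S (c k) (n k)) \<longlonglongrightarrow> x" using seq by blast
    obtain d m where y: "(\<lambda>k. S (d k) (m k)) \<longlonglongrightarrow> y" using seq by blast
    show ?thesis
      using tendsto_norm [OF tendsto_diff [OF x y]] tendsto_norm [OF tendsto_diff [OF lim [OF x] lim [OF y]]]
      by (auto simp: iso intro: LIMSEQ_unique)
  qed
  show thesis
  proof (rule that)
    show "linear_isometry T"
      unfolding linear_isometry_def
      using T_norm by (auto intro!: Vector_Spaces.linear.intro vector_space_scaleC
          simp: T_add T_scale module_hom_axioms_def module_hom_def module_iff_vector_space
            Vector_Spaces.linear_def)
    show "surj T"
      unfolding surj_def
    proof
      fix y
      have "y \<in> closure {S' c n |c n. True}" using D' by simp
      then obtain s where s: "\<forall>k. s k \<in> {S' c n |c n. True}" "s \<longlonglongrightarrow> y"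
        unfolding closure_sequential by blast
      then have "\<exists>c n. s k = S' c n" for k by auto
      then have "\<forall>k. \<exists>x. T x = s k" by (metis TS)
      then obtain u where u: "\<And>k. T (u k) = s k" by metis
      have "Cauchy s" using s(2) by (rule LIMSEQ_imp_Cauchy)
      then have "Cauchy u"
        unfolding Cauchy_def dist_norm u [symmetric] T_norm .
      then obtain x where "u \<longlonglongrightarrow> x" using Cauchy_convergent convergent_def by blast
      then have "(\<lambda>k. T (u k)) \<longlonglongrightarrow> T x" by (rule isCont_tendsto_compose [OF cont])
      then have "s \<longlonglongrightarrow> T x" by (simp add: u)
      then show "\<exists>x. y = T x" using s(2) LIMSEQ_unique by blast
    qed
    show "T (e n) = e' n" for n
    proof -
      have "S (\<lambda>i. of_bool (i = n)) (Suc n) = e n" "S' (\<lambda>i. of_bool (i = n)) (Suc n) = e' n"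
        unfolding S_def S'_def by (simp_all add: scaleC_one)
      then show ?thesis using TS by metis
    qed
  qed
qed

text \<open>
  Replaces the basis vector \<open>e\<^sub>j\<close> in a rational combination by an approximation whose precision
  grows with \<open>j\<close> and with the size of the \<open>j\<close>-th coefficient, so that the errors sum up to less
  than half of \<open>2\<^sup>-\<^sup>k\<close>.
\<close>

definition approx_combination :: "(nat \<Rightarrow> nat \<Rightarrow> nat) \<Rightarrow> nat \<Rightarrow> nat \<Rightarrow> nat" where
  "approx_combination a L k =
     rec_nat 0 (\<lambda>j r. vector_code_axpy r (coeff L j) (a j (k + j + coeff L j + 3))) (code_length L)"

lemma recursive_in_approx_combination:
  assumes "recursive_in X (\<lambda>m. a (first m) (second m))" "recursive_in X f" "recursive_in X g"
  shows "recursive_in X (\<lambda>n. approx_combination a (f n) (g n))"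
  unfolding approx_combination_def
  by (intro recursive_intros recursive_in_compose2 [OF assms(1)] recursive_in_compose [OF assms(2)]
      recursive_in_compose [OF assms(3)] assms)

lemma approx_combination:
  fixes F :: "nat \<Rightarrow> 'a::complex_banach"
  assumes a: "\<And>n k. vector_code N (a n k)" "\<And>n k. norm (vec F (a n k) - e n) < 1 / 2 ^ k"
  shows "vector_code N (approx_combination a L k)"
    and "norm (vec F (approx_combination a L k) - vec e L) < 1 / 2 ^ Suc k"
proof -
  define r where "r = rec_nat 0 (\<lambda>j r. vector_code_axpy r (coeff L j) (a j (k + j + coeff L j + 3)))"
  have "vector_code N (r j)" for j
    by (induction j) (simp_all add: r_def vector_code_axpy_closed a)
  then show "vector_code N (approx_combination a L k)"
    by (simp add: approx_combination_def r_def)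
  have bound: "norm (vec F (r j) - (\<Sum>i<j. gauss (coeff L i) *\<^sub>C e i))
      \<le> (1 - 1 / 2 ^ j) / 2 ^ (k + 1)" for j
  proof (induction j)
    case 0
    show ?case by (simp add: r_def)
  next
    case (Suc j)
    define c where "c = coeff L j"
    define x where "x = vec F (a j (k + j + c + 3)) - e j"
    have "vec F (r (Suc j)) - (\<Sum>i<Suc j. gauss (coeff L i) *\<^sub>C e i)
        = (vec F (r j) - (\<Sum>i<j. gauss (coeff L i) *\<^sub>C e i))
          + gauss c *\<^sub>C x"
      by (simp add: r_def vector_of_code_axpy c_def x_def scaleC.scale_right_diff_distrib)
    moreover have "norm (gauss c *\<^sub>C x) \<le> 2 ^ Suc c * (1 / 2 ^ (k + j + c + 3))"
      unfolding norm_scaleC using a(2) [of j "k + j + c + 3"] cmod_gauss_rat_of_code_le [of c]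
      by (intro mult_mono) (auto simp: x_def)
    moreover have "2 ^ Suc c * (1 / 2 ^ (k + j + c + 3)) = (1 / 2 ^ (k + j + 2) :: real)"
      by (simp add: field_simps power_add)
    ultimately have "norm (vec F (r (Suc j)) - (\<Sum>i<Suc j. gauss (coeff L i) *\<^sub>C e i))
        \<le> (1 - 1 / 2 ^ j) / 2 ^ (k + 1) + 1 / 2 ^ (k + j + 2)"
      using Suc norm_triangle_ineq by (smt (verit))
    also have "\<dots> = (1 - 1 / 2 ^ Suc j) / 2 ^ (k + 1)"
      by (simp add: field_simps power_add)
    finally show ?case .
  qed
  have "vec e L = (\<Sum>i<code_length L. gauss (coeff L i) *\<^sub>C e i)"
    by (rule vector_of_code_eq_sum) simp
  then have "norm (vec F (approx_combination a L k) - vec e L)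
      \<le> (1 - 1 / 2 ^ code_length L) / 2 ^ (k + 1)"
    using bound [of "code_length L"] by (simp add: approx_combination_def r_def)
  also have "\<dots> < 1 / 2 ^ Suc k" by (simp add: divide_strict_right_mono)
  finally show "norm (vec F (approx_combination a L k) - vec e L) < 1 / 2 ^ Suc k" .
qed

lemma linear_isometry_vector_of_code:
  assumes "linear_isometry T" "\<And>n. T (e n) = e' n"
  shows "T (vec e L) = vec e' L"
proof -
  interpret T: Vector_Spaces.linear scaleC scaleC T
    using assms(1) by (simp add: linear_isometry_def)
  show ?thesis by (simp add: vector_of_code_def T.sum T.scale assms(2))
qed

text \<open>
  To approximate \<open>T\<close> at a rational vector, search for a rational combination of the first basis near
  that vector and take the combination of the second basis with the same coefficients. As \<open>T\<close> is an
  isometry, a ball is mapped into the ball of twice the radius around a good enough approximation of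
  the image of its center.
\<close>

lemma recursive_bases_imp_computable_isometry:
  fixes F0 :: "nat \<Rightarrow> 'a::complex_banach" and F1 :: "nat \<Rightarrow> 'b::complex_banach"
  assumes F0: "effective_generating_set N0 F0"
    and basis0: "recursive_basis X p N0 F0 e0 a0" and basis1: "recursive_basis X p N1 F1 e1 a1"
  shows "\<exists>T :: 'a \<Rightarrow> 'b. linear_isometry T \<and> surj T \<and> oracle_computes X N0 F0 N1 F1 T"
proof -
  have e0: "lp_basis p e0" and a0: "recursive_in X (\<lambda>m. a0 (first m) (second m))"
      "\<And>n k. vector_code N0 (a0 n k)" "\<And>n k. norm (vec F0 (a0 n k) - e0 n) < 1 / 2 ^ k"
    using basis0 by (simp_all add: recursive_basis_def)
  have e1: "lp_basis p e1" and a1: "recursive_in X (\<lambda>m. a1 (first m) (second m))"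
      "\<And>n k. vector_code N1 (a1 n k)" "\<And>n k. norm (vec F1 (a1 n k) - e1 n) < 1 / 2 ^ k"
    using basis1 by (simp_all add: recursive_basis_def)
  obtain T where T: "linear_isometry T" "surj T" "\<And>n. T (e0 n) = e1 n"
    using lp_basis_isometry [OF e0 e1] by blast
  have iso: "norm (T x - T y) = norm (x - y)" for x y
    using T(1) by (simp add: linear_isometry_def)
  obtain c where c: "gauss c = - 1"
    using ex_gauss_code_units by blast
  define d where "d = (\<lambda>v L k. vector_code_axpy v c (approx_combination a0 L k))"
  have d: "vector_code N0 (d v L k)"
      "vec F0 (d v L k) = vec F0 v - vec F0 (approx_combination a0 L k)"
    if "vector_code N0 v" for v L k
    using that approx_combination(1) [where e = e0, OF a0(2,3)]
    by (simp_all add: d_def vector_code_axpy_closed vector_of_code_axpy c)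
  define R where "R = (\<lambda>m L. norm (vec F0 (d (first m) L (second m))) < of_rat (1 / 2 ^ second m))"
  have semi: "semidecidable_in {} (\<lambda>m. vector_code N0 (first m) \<and> norm (vec F0 (first m)) < of_rat (1 / 2 ^ second m))"
    by (intro semidecidable_norm F0 recursive_intros)
  have "semidecidable_in X (\<lambda>m. vector_code N0 (d (first (first m)) (second m) (second (first m))) \<and>
      norm (vec F0 (d (first (first m)) (second m) (second (first m)))) < of_rat (1 / 2 ^ second (first m)))"
    using semidecidable_in_compose [OF semidecidable_in_relativize [OF semi, of X],
        where f = "\<lambda>m. pair (d (first (first m)) (second m) (second (first m))) (second (first m))"]
    unfolding d_def by (simp add: recursive_intros recursive_in_approx_combination [OF a0(1)])
  then have semiR: "semidecidable_in X (\<lambda>m. vector_code N0 (d (first (first m)) (second m) (second (first m))) \<and> R (first m) (second m))"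
    by (simp add: R_def)
  obtain g where g: "recursive_in X g"
    "\<And>m. vector_code N0 (first m) \<Longrightarrow> vector_code N0 (d (first m) (g m) (second m)) \<and> R m (g m)"
  proof (rule semidecidable_uniformization [OF semiR, of "\<lambda>m. vector_code N0 (first m)"])
    show "decidable_in X (\<lambda>m. vector_code N0 (first m))" by (intro recursive_intros)
    fix m assume m: "vector_code N0 (first m)"
    define v where "v = vec F0 (first m)"
    obtain L where L: "norm (vec e0 L - v) < 1 / 2 ^ Suc (second m)"
    proof (rule rational_vectors_dense [of \<infinity> e0 "1 / 2 ^ Suc (second m)" v])
      show "generating_set \<infinity> e0"
        using e0 by (simp add: generating_set_def lp_basis_def members_def)
    qed auto
    have "norm (vec F0 (approx_combination a0 L (second m)) - vec e0 L) < 1 / 2 ^ Suc (second m)"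
      by (rule approx_combination [OF a0(2,3)])
    then have "norm (v - vec F0 (approx_combination a0 L (second m))) < 1 / 2 ^ second m"
      using L norm_triangle_ineq [of "v - vec e0 L"
          "vec e0 L - vec F0 (approx_combination a0 L (second m))"]
      by (simp add: norm_minus_commute)
    then show "\<exists>L. vector_code N0 (d (first m) L (second m)) \<and> R m L"
      using m by (intro exI [of _ L]) (simp add: R_def d v_def of_rat_divide of_rat_power)
  qed blast
  define w where "w = (\<lambda>v k. approx_combination a1 (g (pair v k)) k)"
  have w: "vector_code N1 (w v k)" for v k
    unfolding w_def by (rule approx_combination [OF a1(2,3)])
  have Tw: "norm (T (vec F0 v) - vec F1 (w v k)) < 2 / 2 ^ k"
    if "vector_code N0 v" for v k
  proof -
    define L where "L = g (pair v k)"
    define s where "s = approx_combination a0 L k"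
    have "norm (vec F0 v - vec F0 s) < 1 / 2 ^ k"
      using g(2) [of "pair v k"] that by (simp add: R_def d L_def s_def of_rat_divide of_rat_power)
    moreover have "norm (vec F0 s - vec e0 L) < 1 / 2 ^ Suc k"
      unfolding s_def by (rule approx_combination [OF a0(2,3)])
    ultimately have "norm (vec F0 v - vec e0 L) < 1 / 2 ^ k + 1 / 2 ^ Suc k"
      using norm_triangle_ineq [of "vec F0 v - vec F0 s" "vec F0 s - vec e0 L"]
      by simp
    then have "norm (T (vec F0 v) - vec e1 L) < 1 / 2 ^ k + 1 / 2 ^ Suc k"
      using iso [of "vec F0 v" "vec e0 L"]
      by (simp only: linear_isometry_vector_of_code [where e = e0 and e' = e1, OF T(1,3)])
    moreover have "norm (vec F1 (w v k) - vec e1 L) < 1 / 2 ^ Suc k"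
      unfolding w_def L_def by (rule approx_combination [OF a1(2,3)])
    ultimately have "norm (T (vec F0 v) - vec F1 (w v k)) < 1 / 2 ^ k + 1 / 2 ^ Suc k + 1 / 2 ^ Suc k"
      using norm_triangle_ineq [of "T (vec F0 v) - vec e1 L" "vec e1 L - vec F1 (w v k)"]
      by (simp add: norm_minus_commute)
    then show ?thesis by simp
  qed
  \<comment> \<open>A positive rational with denominator \<open>d + 1\<close> is at least \<open>2\<^sup>-\<^sup>d\<close>.\<close>
  define prec where "prec = (\<lambda>b. Suc (second (second b)))"
  have prec: "2 / 2 ^ prec b \<le> real_of_rat (rat_of_code (second b))"
    if "rat_of_code (second b) > 0" for b
  proof -
    define m where "m = int_decode (first (second b))"
    define n where "n = second (second b)"
    have r: "rat_of_code (second b) = of_int m / of_nat (Suc n)"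
      by (simp add: rat_of_code_def case_prod_beta m_def n_def)
    then have "m \<ge> 1" using that by (simp add: zero_less_divide_iff del: of_nat_Suc)
    have "Suc n \<le> 2 ^ n" using less_exp [of n] by linarith
    then have "real (Suc n) \<le> 2 ^ n" by (metis of_nat_le_iff of_nat_numeral of_nat_power)
    then have "1 / 2 ^ n \<le> 1 / real (Suc n)" by (intro divide_left_mono) auto
    also have "\<dots> \<le> of_int m / real (Suc n)" using \<open>m \<ge> 1\<close> by (intro divide_right_mono) auto
    finally show ?thesis by (simp add: r of_rat_divide of_rat_add prec_def n_def)
  qed
  define out where "out = (\<lambda>b. pair (w (first b) (prec b)) (rat_code_add (second b) (second b)))"
  have "recursive_in X out"
    unfolding out_def w_def prec_def
    by (intro recursive_intros recursive_in_approx_combination [OF a1(1)] recursive_in_compose [OF g(1)]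
        recursive_in_rat_code_ops)
  then obtain P where P: "\<And>b. run X P b = Some (out b)"
    unfolding recursive_in_def by blast
  have near: "norm (T x - vec F1 (first (out b))) < 2 * of_rat (rat_of_code (second b))"
    if "ball_code N0 b" "x \<in> ball_of_code F0 b" for b x
  proof -
    have b: "vector_code N0 (first b)" "rat_of_code (second b) > 0"
      using that(1) by (simp_all add: ball_code_def)
    have "norm (T x - T (vec F0 (first b))) < of_rat (rat_of_code (second b))"
      using that(2) by (simp add: iso ball_of_code_def dist_norm norm_minus_commute)
    moreover have "norm (T (vec F0 (first b)) - vec F1 (first (out b))) < of_rat (rat_of_code (second b))"
      using Tw [OF b(1), of "prec b"] prec [OF b(2)] by (simp add: out_def)
    ultimately show ?thesis
      using norm_triangle_ineq [of "T x - T (vec F0 (first b))"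
          "T (vec F0 (first b)) - vec F1 (first (out b))"] by simp
  qed
  have ball_out: "ball_of_code F1 (out b) =
      ball (vec F1 (first (out b))) (2 * of_rat (rat_of_code (second b)))" for b
    by (simp add: ball_of_code_def out_def rat_of_code_add of_rat_mult)
  have "computes_map X P N0 F0 N1 F1 T"
    unfolding computes_map_def
  proof (intro conjI allI impI ballI)
    show "ball_code N1 b'" if "ball_code N0 b \<and> run X P b = Some b'" for b b'
      using that by (auto simp: P ball_code_def out_def w rat_of_code_add)
    show "T f \<in> ball_of_code F1 b'" if "ball_code N0 b \<and> run X P b = Some b'" "f \<in> ball_of_code F0 b" for b b' f
    proof -
      have "b' = out b" using that(1) by (simp add: P)
      then show ?thesis
        using near [of b f] that by (simp add: ball_out dist_norm norm_minus_commute)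
    qed
    fix f :: 'a and U V assume UV: "f \<in> interior U \<and> T f \<in> interior V"
    then obtain u v where u: "u > 0" "ball f u \<subseteq> U" and v: "v > 0" "ball (T f) v \<subseteq> V"
      unfolding mem_interior by blast
    obtain q where q: "0 < q" "real_of_rat q < min (u / 2) (v / 4)"
    proof -
      have "0 < min (u / 2) (v / 4)" using u(1) v(1) by simp
      then obtain q where "0 < real_of_rat q" "real_of_rat q < min (u / 2) (v / 4)"
        using of_rat_dense by blast
      then show thesis using that by simp
    qed
    obtain r where r: "rat_of_code r = q" using rat_of_code_surj by blast
    obtain z where z: "vector_code N0 z" "norm (vec F0 z - f) < of_rat q"
      using rational_vectors_dense [of N0 F0 "of_rat q" f] F0 q(1)
      by (auto simp: effective_generating_set_def)
    define b where "b = pair z r"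
    have b: "ball_code N0 b" "f \<in> ball_of_code F0 b"
      using z q(1) by (simp_all add: b_def r ball_code_def ball_of_code_def dist_norm)
    have "ball_of_code F0 b \<subseteq> ball f u"
    proof
      fix x assume "x \<in> ball_of_code F0 b"
      then have "dist (vec F0 z) x < of_rat q" by (simp add: ball_of_code_def b_def r)
      moreover have "dist f (vec F0 z) < of_rat q" using z(2) by (simp add: dist_norm norm_minus_commute)
      ultimately show "x \<in> ball f u"
        using dist_triangle [of f x "vec F0 z"] q(2) by simp
    qed
    moreover have "ball_of_code F1 (out b) \<subseteq> ball (T f) v"
    proof
      fix y assume "y \<in> ball_of_code F1 (out b)"
      then have "dist (vec F1 (first (out b))) y < 2 * of_rat q" by (simp add: ball_out b_def r)
      moreover have "dist (T f) (vec F1 (first (out b))) < 2 * of_rat q"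
        using near [OF b] by (simp add: b_def r dist_norm)
      ultimately show "y \<in> ball (T f) v"
        using dist_triangle [of "T f" y "vec F1 (first (out b))"] q(2) by simp
    qed
    ultimately show "\<exists>b b'. ball_code N0 b \<and> f \<in> ball_of_code F0 b \<and> ball_of_code F0 b \<subseteq> U \<and>
        run X P b = Some b' \<and> ball_of_code F1 b' \<subseteq> V"
      using b u(2) v(2) P by blast
  qed
  then show ?thesis using T(1,2) unfolding oracle_computes_def by blast
qed

section \<open>Coordinates in a copy of \<open>\<ell>\<^sup>p\<close>\<close>

text \<open>
  An isometry onto \<open>\<ell>\<^sup>p\<close> serves to speak about coordinates in proofs; no algorithm has access to it.
\<close>

locale lp_copy =
  fixes p :: real and \<Phi> :: "'a::complex_banach \<Rightarrow> nat \<Rightarrow> complex"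
  assumes p_ge_1: "p \<ge> 1"
    and range_coord: "range \<Phi> = lp p"
    and coord_add: "\<Phi> (x + y) = (\<lambda>n. \<Phi> x n + \<Phi> y n)"
    and coord_scaleC: "\<Phi> (c *\<^sub>C x) = (\<lambda>n. c * \<Phi> x n)"
    and lp_norm_coord: "lp_norm p (\<lambda>n. \<Phi> x n - \<Phi> y n) = norm (x - y)"
begin

lemma p_pos: "p > 0" using p_ge_1 by simp

lemma coord_0 [simp]: "\<Phi> 0 = (\<lambda>n. 0)"
  using coord_scaleC [of 0 0] by simp

lemma coord_diff: "\<Phi> (x - y) = (\<lambda>n. \<Phi> x n - \<Phi> y n)"
  using coord_add [of "x - y" y] by (auto simp: fun_eq_iff)

lemma coord_sum: "\<Phi> (\<Sum>i\<in>A. f i) n = (\<Sum>i\<in>A. \<Phi> (f i) n)"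
  by (induction A rule: infinite_finite_induct) (simp_all add: coord_add)

lemma summable_coord: "summable (\<lambda>n. cmod (\<Phi> x n) powr p)"
  using range_coord unfolding lp_def by auto

lemma norm_eq_suminf: "norm x = (\<Sum>n. cmod (\<Phi> x n) powr p) powr (1 / p)"
  using lp_norm_coord [of x 0] by (simp add: lp_norm_def)

lemma norm_powr: "norm x powr p = (\<Sum>n. cmod (\<Phi> x n) powr p)"
  using suminf_nonneg [OF summable_coord [of x]] p_pos
  by (simp add: norm_eq_suminf [of x] powr_powr)

lemma coord_surj:
  assumes "summable (\<lambda>n. cmod (f n) powr p)"
  obtains x where "\<Phi> x = f"
  using assms range_coord unfolding lp_def by (metis (mono_tags, lifting) imageE mem_Collect_eq)

lemma coord_inject: "\<Phi> x = \<Phi> y \<Longrightarrow> x = y"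
  using lp_norm_coord [of x y] by (simp add: lp_norm_def)

lemma norm_mono:
  assumes "\<And>n. cmod (\<Phi> x n) \<le> cmod (\<Phi> y n)"
  shows "norm x \<le> norm y"
proof -
  have "(\<Sum>n. cmod (\<Phi> x n) powr p) \<le> (\<Sum>n. cmod (\<Phi> y n) powr p)"
    using p_pos assms by (intro suminf_le summable_coord powr_mono2) auto
  then show ?thesis
    unfolding norm_eq_suminf using p_pos
    by (intro powr_mono2 suminf_nonneg summable_coord) auto
qed

lemma norm_cong: "(\<And>n. cmod (\<Phi> x n) = cmod (\<Phi> y n)) \<Longrightarrow> norm x = norm y"
  by (simp add: norm_eq_suminf)

lemma norm_finite_support:
  assumes "finite A" "\<And>n. n \<notin> A \<Longrightarrow> \<Phi> x n = 0"
  shows "norm x = (\<Sum>n\<in>A. cmod (\<Phi> x n) powr p) powr (1 / p)"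
  unfolding norm_eq_suminf using assms by (subst suminf_finite [of A]) auto

lemma cmod_coord_le: "cmod (\<Phi> x n) \<le> norm x"
proof -
  have "(\<Sum>k\<in>{n}. cmod (\<Phi> x k) powr p) \<le> norm x powr p"
    unfolding norm_powr by (intro sum_le_suminf summable_coord) auto
  then have "cmod (\<Phi> x n) powr p \<le> norm x powr p" by simp
  then show ?thesis
    using powr_less_mono2 [OF p_pos norm_ge_zero, of x "cmod (\<Phi> x n)"] by linarith
qed

lemma disjoint_norm_powr:
  assumes "\<And>n. \<Phi> x n = 0 \<or> \<Phi> y n = 0"
  shows "norm (x + y) powr p = norm x powr p + norm y powr p"
proof -
  have "cmod (\<Phi> (x + y) n) powr p = cmod (\<Phi> x n) powr p + cmod (\<Phi> y n) powr p" for n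
    using assms [of n] by (auto simp: coord_add)
  then show ?thesis
    unfolding norm_powr by (simp add: suminf_add [OF summable_coord summable_coord])
qed

definition restr :: "nat set \<Rightarrow> 'a \<Rightarrow> 'a" where
  "restr A x = (SOME y. \<Phi> y = (\<lambda>n. if n \<in> A then \<Phi> x n else 0))"

lemma coord_restr: "\<Phi> (restr A x) = (\<lambda>n. if n \<in> A then \<Phi> x n else 0)"
proof -
  have "summable (\<lambda>n. cmod (if n \<in> A then \<Phi> x n else 0) powr p)"
    by (rule summable_comparison_test' [OF summable_coord [of x], of 0]) auto
  then have "\<exists>y. \<Phi> y = (\<lambda>n. if n \<in> A then \<Phi> x n else 0)"
    by (metis coord_surj)
  then show ?thesis unfolding restr_def by (rule someI_ex)
qed

lemma norm_restr_compl_tendsto: "(\<lambda>n. norm (x - restr {..<n} x)) \<longlonglongrightarrow> 0"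
proof -
  define S where "S = (\<lambda>n. \<Sum>k<n. cmod (\<Phi> x k) powr p)"
  have restr_S: "norm (restr {..<n} x) powr p = S n" for n
  proof -
    have "norm (restr {..<n} x) powr p = (\<Sum>k. cmod (\<Phi> (restr {..<n} x) k) powr p)"
      by (rule norm_powr)
    also have "\<dots> = (\<Sum>k<n. cmod (\<Phi> (restr {..<n} x) k) powr p)"
      by (rule suminf_finite) (auto simp: coord_restr)
    finally show ?thesis by (simp add: coord_restr S_def)
  qed
  have "norm (x - restr {..<n} x) powr p = norm x powr p - S n" for n
    using disjoint_norm_powr [of "restr {..<n} x" "x - restr {..<n} x"]
    by (simp add: restr_S coord_restr coord_diff)
  moreover have "S \<longlonglongrightarrow> norm x powr p"
    unfolding S_def norm_powr by (rule summable_LIMSEQ [OF summable_coord])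
  then have "(\<lambda>n. norm x powr p - S n) \<longlonglongrightarrow> 0"
    using tendsto_diff [OF tendsto_const [of "norm x powr p"]] by fastforce
  ultimately have "(\<lambda>n. norm (x - restr {..<n} x) powr p) \<longlonglongrightarrow> 0" by simp
  then have "(\<lambda>n. (norm (x - restr {..<n} x) powr p) powr (1 / p)) \<longlonglongrightarrow> 0 powr (1 / p)"
    using p_pos by (intro tendsto_powr2 tendsto_const) auto
  then show ?thesis using p_pos by (simp add: powr_powr)
qed

definition atom_at :: "nat \<Rightarrow> 'a \<Rightarrow> bool" where
  "atom_at j e \<longleftrightarrow> (\<exists>l. cmod l = 1 \<and> \<Phi> e = (\<lambda>n. if n = j then l else 0))"

lemma atom_at_ex:
  assumes "cmod l = 1"
  obtains e where "\<Phi> e = (\<lambda>n. if n = j then l else 0)"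
proof (rule coord_surj)
  show "summable (\<lambda>n. cmod (if n = j then l else 0) powr p)"
    by (rule summable_finite [of "{j}"]) auto
qed

lemma norm_atom_multiple:
  assumes "\<Phi> x = (\<lambda>n. if n = j then c else 0)"
  shows "norm x = cmod c"
  using norm_finite_support [of "{j}" x] assms p_pos by (simp add: powr_powr)

lemma atom_at_norm: "atom_at j e \<Longrightarrow> norm e = 1"
  unfolding atom_at_def using norm_atom_multiple by metis

lemma atoms_lp_basis:
  assumes e: "\<And>i. atom_at (j i) (e i)" and j: "bij j"
  shows "lp_basis p e"
proof -
  obtain l where l: "\<And>i. cmod (l i) = 1" "\<And>i. \<Phi> (e i) = (\<lambda>n. if n = j i then l i else 0)"
    using e unfolding atom_at_def by metis
  have inj: "j i = j k \<longleftrightarrow> i = k" for i k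
    using j by (simp add: bij_def inj_eq)
  have norm: "norm (\<Sum>i<n. c i *\<^sub>C e i) = (\<Sum>i<n. cmod (c i) powr p) powr (1 / p)" for c n
  proof -
    have co: "\<Phi> (\<Sum>i<n. c i *\<^sub>C e i) m = (\<Sum>i<n. if m = j i then c i * l i else 0)" for m
      unfolding coord_sum by (rule sum.cong) (auto simp: coord_scaleC l)
    have at: "\<Phi> (\<Sum>i<n. c i *\<^sub>C e i) (j k) = c k * l k" if "k < n" for k
      unfolding co using that by (simp add: inj)
    have "norm (\<Sum>i<n. c i *\<^sub>C e i)
        = (\<Sum>m\<in>j ` {..<n}. cmod (\<Phi> (\<Sum>i<n. c i *\<^sub>C e i) m) powr p) powr (1 / p)"
    proof (rule norm_finite_support)
      show "\<Phi> (\<Sum>i<n. c i *\<^sub>C e i) m = 0" if "m \<notin> j ` {..<n}" for m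
        unfolding co using that by (intro sum.neutral) auto
    qed simp
    also have "(\<Sum>m\<in>j ` {..<n}. cmod (\<Phi> (\<Sum>i<n. c i *\<^sub>C e i) m) powr p)
        = (\<Sum>k<n. cmod (\<Phi> (\<Sum>i<n. c i *\<^sub>C e i) (j k)) powr p)"
      using inj by (subst sum.reindex) (auto simp: inj_on_def)
    also have "\<dots> = (\<Sum>k<n. cmod (c k) powr p)"
      by (rule sum.cong) (auto simp: at norm_mult l)
    finally show ?thesis .
  qed
  have "x \<in> closure (scaleC.span (range e))" for x
  proof -
    have "restr {..<n} x \<in> scaleC.span (range e)" for n
    proof -
      have "restr {..<n} x = (\<Sum>m<n. (\<Phi> x m / l (inv j m)) *\<^sub>C e (inv j m))"
      proof (rule coord_inject, rule ext)
        fix k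
        have "\<Phi> (\<Sum>m<n. (\<Phi> x m / l (inv j m)) *\<^sub>C e (inv j m)) k = (\<Sum>m<n. if k = m then \<Phi> x m else 0)"
          unfolding coord_sum
        proof (rule sum.cong)
          fix m
          have "l (inv j m) \<noteq> 0" using l(1) [of "inv j m"] by auto
          moreover have "j (inv j m) = m" using j by (simp add: bij_def surj_f_inv_f)
          ultimately show "\<Phi> ((\<Phi> x m / l (inv j m)) *\<^sub>C e (inv j m)) k = (if k = m then \<Phi> x m else 0)"
            by (simp add: coord_scaleC l)
        qed simp
        then show "\<Phi> (restr {..<n} x) k = \<Phi> (\<Sum>m<n. (\<Phi> x m / l (inv j m)) *\<^sub>C e (inv j m)) k"
          by (simp add: coord_restr)
      qed
      then show ?thesis
        by (simp only:) (intro scaleC.span_sum scaleC.span_scale scaleC.span_base rangeI)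
    qed
    moreover have "(\<lambda>n. restr {..<n} x) \<longlonglongrightarrow> x"
      using norm_restr_compl_tendsto [of x]
      by (subst tendsto_dist_iff) (simp add: dist_norm norm_minus_commute)
    ultimately show ?thesis
      unfolding closure_sequential by (intro exI [of _ "\<lambda>n. restr {..<n} x"]) blast
  qed
  then show ?thesis using norm unfolding lp_basis_def by blast
qed

end

lemma linearly_isometric_to_lp_iff:
  assumes "p \<ge> 1"
  shows "linearly_isometric_to_lp TYPE('a::complex_banach) p \<longleftrightarrow> (\<exists>\<Phi> :: 'a \<Rightarrow> nat \<Rightarrow> complex. lp_copy p \<Phi>)"
  using assms unfolding linearly_isometric_to_lp_def lp_copy_def by blast

section \<open>Recognizing atoms by norms alone\<close>

text \<open>
  For \<open>r > 1\<close> the increment \<open>(1 + t)\<^sup>r - t\<^sup>r\<close> is strictly increasing in \<open>t\<close>, for \<open>r < 1\<close> strictly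
  decreasing, so it takes its value at \<open>t = 1\<close> only once.
\<close>

lemma powr_increment_neq:
  fixes r U :: real
  assumes "r > 0" "r \<noteq> 1" "0 \<le> U" "U < 1"
  shows "(1 + U) powr r - U powr r \<noteq> 2 powr r - 1"
proof -
  define g where "g = (\<lambda>t::real. (1 + t) powr r - t powr r)"
  have cont: "continuous_on {U..1} g"
    unfolding g_def using assms by (intro continuous_intros continuous_on_powr') auto
  have deriv: "(g has_real_derivative r * ((1 + t) powr (r - 1) - t powr (r - 1))) (at t)" if "t > 0" for t
    unfolding g_def using that by (auto intro!: derivative_eq_intros simp: algebra_simps)
  have "g U \<noteq> g 1"
  proof (cases "r > 1")
    case True
    have "g U < g 1"
    proof (rule DERIV_pos_imp_increasing_open [OF assms(4) _ cont])
      fix t assume "U < t" "t < 1"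
      then have "t > 0" using assms by simp
      then have "r * ((1 + t) powr (r - 1) - t powr (r - 1)) > 0"
        using True by (intro mult_pos_pos) (auto intro: powr_less_mono2)
      then show "\<exists>y. (g has_real_derivative y) (at t) \<and> 0 < y"
        using deriv [OF \<open>t > 0\<close>] by blast
    qed
    then show ?thesis by simp
  next
    case False
    have "g U > g 1"
    proof (rule DERIV_neg_imp_decreasing_open [OF assms(4) _ cont])
      fix t assume "U < t" "t < 1"
      then have "t > 0" using assms by simp
      then have "(1 + t) powr (r - 1) < t powr (r - 1)"
        using False assms(2) by (intro powr_less_mono2_neg) auto
      then have "r * ((1 + t) powr (r - 1) - t powr (r - 1)) < 0"
        using assms(1) by (intro mult_pos_neg) auto
      then show "\<exists>y. (g has_real_derivative y) (at t) \<and> y < 0"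
        using deriv [OF \<open>t > 0\<close>] by blast
    qed
    then show ?thesis by simp
  qed
  then show ?thesis by (simp add: g_def)
qed

text \<open>
  Let \<open>e\<close> be a unit vector of \<open>\<ell>\<^sup>p\<close> and \<open>g = \<alpha> e + h\<close>, where \<open>h\<close> is disjoint from \<open>e\<close> and has norm
  \<open>y\<close>. The equations say that \<open>g + \<mu> (e - g)\<close> has norm 1 for \<open>\<mu> = -1, \<i>, -\<i>\<close>, as it must if \<open>g\<close> and
  \<open>e - g\<close> are disjoint; the conclusion is that one of \<open>g\<close> and \<open>e - g\<close> vanishes.

  The second and third equation force \<open>\<alpha>\<close> to be real, and with \<open>r = p / 2\<close>,
  \<open>U = (2\<alpha> - 1)\<^sup>2\<close>, \<open>Y = 4y\<^sup>2\<close> what remains is \<open>U\<^sup>r + Y\<^sup>r = 1\<close> and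
  \<open>(1 + U)\<^sup>r + Y\<^sup>r = 2\<^sup>r\<close>. As \<open>(1 + U)\<^sup>r - U\<^sup>r\<close> is strictly monotone exactly because
  \<open>r \<noteq> 1\<close>, this leaves \<open>U = 1\<close> and \<open>Y = 0\<close>.
\<close>

lemma trivial_splitting:
  fixes \<alpha> :: complex and y p :: real
  assumes p: "p > 0" "p \<noteq> 2" and y: "y \<ge> 0"
    and h1: "cmod (2 * \<alpha> - 1) powr p + (2 * y) powr p = 1"
    and h2: "cmod (\<alpha> + \<i> * (1 - \<alpha>)) powr p + (sqrt 2 * y) powr p = 1"
    and h3: "cmod (\<alpha> - \<i> * (1 - \<alpha>)) powr p + (sqrt 2 * y) powr p = 1"
  shows "y = 0 \<and> (\<alpha> = 0 \<or> \<alpha> = 1)"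
proof -
  define r where "r = p / 2"
  have r: "r > 0" "r \<noteq> 1" using p by (auto simp: r_def)
  have square: "s powr p = (s\<^sup>2) powr r" if "s \<ge> 0" for s :: real
  proof -
    have "(s\<^sup>2) powr r = (s powr 2) powr r" using that by simp
    then show ?thesis by (simp add: powr_powr r_def)
  qed
  define a b where "a = Re \<alpha>" and "b = Im \<alpha>"
  have "cmod (\<alpha> + \<i> * (1 - \<alpha>)) = cmod (\<alpha> - \<i> * (1 - \<alpha>))"
  proof -
    have "cmod (\<alpha> + \<i> * (1 - \<alpha>)) powr p = cmod (\<alpha> - \<i> * (1 - \<alpha>)) powr p" using h2 h3 by simp
    then have "(cmod (\<alpha> + \<i> * (1 - \<alpha>)) powr p) powr (1 / p) = (cmod (\<alpha> - \<i> * (1 - \<alpha>)) powr p) powr (1 / p)"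
      by simp
    then show ?thesis using p by (simp add: powr_powr)
  qed
  then have "(cmod (\<alpha> + \<i> * (1 - \<alpha>)))\<^sup>2 = (cmod (\<alpha> - \<i> * (1 - \<alpha>)))\<^sup>2" by simp
  then have b: "b = 0"
    unfolding cmod_power2 by (simp add: a_def b_def power2_eq_square algebra_simps)
  define U Y where "U = (2 * a - 1)\<^sup>2" and "Y = 4 * y\<^sup>2"
  have c1: "(cmod (2 * \<alpha> - 1))\<^sup>2 = U"
    unfolding cmod_power2 using b by (simp add: U_def a_def b_def)
  have c2: "(cmod (\<alpha> + \<i> * (1 - \<alpha>)))\<^sup>2 = (1 + U) / 2"
    unfolding cmod_power2 using b by (simp add: U_def a_def b_def power2_eq_square algebra_simps)
  have e1: "U powr r + Y powr r = 1"
    using h1 y by (simp add: square c1 Y_def power_mult_distrib)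
  have "((1 + U) / 2) powr r + (Y / 2) powr r = 1"
    using h2 y by (simp add: square c2 Y_def power_mult_distrib)
  then have "2 powr r * (((1 + U) / 2) powr r + (Y / 2) powr r) = 2 powr r" by simp
  then have e2: "(1 + U) powr r + Y powr r = 2 powr r"
    by (simp add: distrib_left powr_divide)
  have "U \<ge> 0" by (simp add: U_def)
  moreover have "\<not> U < 1"
    using powr_increment_neq [OF r \<open>U \<ge> 0\<close>] e1 e2 by linarith
  moreover have "\<not> 1 < U"
  proof
    assume "1 < U"
    then have "1 powr r < U powr r" using r by (intro powr_less_mono2) auto
    moreover have "Y powr r \<ge> 0" by simp
    ultimately show False using e1 by simp
  qed
  ultimately have U: "U = 1" by linarith
  then have "Y powr r = 0" using e1 by simp
  then have "y = 0" by (simp add: Y_def)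
  moreover have "a = 0 \<or> a = 1"
  proof -
    have "4 * (a * (a - 1)) = 0" using U by (simp add: U_def power2_eq_square algebra_simps)
    then show ?thesis by simp
  qed
  ultimately show ?thesis using b by (auto simp: complex_eq_iff a_def b_def)
qed

text \<open>The norm of a vector whose two disjointly supported parts have norms \<open>s\<close> and \<open>t\<close>.\<close>

definition lp_sum :: "real \<Rightarrow> real \<Rightarrow> real \<Rightarrow> real" where
  "lp_sum p s t = (s powr p + t powr p) powr (1 / p)"

lemma continuous_on_lp_sum [continuous_intros]:
  assumes "continuous_on A f" "continuous_on A g" "p > 0"
    and "\<And>x. x \<in> A \<Longrightarrow> f x \<ge> 0" "\<And>x. x \<in> A \<Longrightarrow> g x \<ge> 0"
  shows "continuous_on A (\<lambda>x. lp_sum p (f x) (g x))"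
  unfolding lp_sum_def using assms by (intro continuous_intros continuous_on_powr') auto

lemma le_lp_sum:
  assumes "s \<ge> 0" "t \<ge> 0" "p > 0"
  shows "s \<le> lp_sum p s t" "t \<le> lp_sum p s t"
proof -
  have "(s powr p) powr (1 / p) \<le> lp_sum p s t" "(t powr p) powr (1 / p) \<le> lp_sum p s t"
    unfolding lp_sum_def using assms by (auto intro!: powr_mono2)
  then show "s \<le> lp_sum p s t" "t \<le> lp_sum p s t" using assms by (simp_all add: powr_powr)
qed

lemma lp_sum_eq_1: "p > 0 \<Longrightarrow> lp_sum p s t = 1 \<Longrightarrow> s powr p + t powr p = 1"
  unfolding lp_sum_def by (metis add_nonneg_nonneg divide_eq_0_iff less_irrefl one_neq_zero powr_ge_zero
      powr_one_eq_one powr_powr_swap powr_powr nonzero_eq_divide_eq powr_one mult.commute)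

text \<open>
  Approximate solutions are close to exact ones because the admissible \<open>(\<alpha>, y)\<close> form a compact
  set. The resulting \<open>\<delta>\<close> is not computed from \<open>\<theta>\<close>; it will be searched for.
\<close>

lemma almost_trivial_splitting:
  fixes p \<theta> :: real
  assumes p: "p > 0" "p \<noteq> 2" and \<theta>: "\<theta> > 0"
  obtains \<delta> where "\<delta> > 0"
    "\<And>\<alpha> y. y \<ge> 0 \<Longrightarrow> \<bar>lp_sum p (cmod (2 * \<alpha> - 1)) (2 * y) - 1\<bar> < \<delta> \<Longrightarrow>
       \<bar>lp_sum p (cmod (\<alpha> + \<i> * (1 - \<alpha>))) (sqrt 2 * y) - 1\<bar> < \<delta> \<Longrightarrow>
       \<bar>lp_sum p (cmod (\<alpha> - \<i> * (1 - \<alpha>))) (sqrt 2 * y) - 1\<bar> < \<delta> \<Longrightarrow>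
       lp_sum p (cmod \<alpha>) y < \<theta> \<or> lp_sum p (cmod (1 - \<alpha>)) y < \<theta>"
proof -
  define box :: "(complex \<times> real) set" where "box = cball (1 / 2) 1 \<times> {0..1}"
  define f1 where "f1 = (\<lambda>x :: complex \<times> real. lp_sum p (cmod (2 * fst x - 1)) (2 * snd x))"
  define f2 where "f2 = (\<lambda>x :: complex \<times> real. lp_sum p (cmod (fst x + \<i> * (1 - fst x))) (sqrt 2 * snd x))"
  define f3 where "f3 = (\<lambda>x :: complex \<times> real. lp_sum p (cmod (fst x - \<i> * (1 - fst x))) (sqrt 2 * snd x))"
  define n1 where "n1 = (\<lambda>x :: complex \<times> real. lp_sum p (cmod (fst x)) (snd x))"
  define n2 where "n2 = (\<lambda>x :: complex \<times> real. lp_sum p (cmod (1 - fst x)) (snd x))"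
  define G where "G = (\<lambda>x. \<bar>f1 x - 1\<bar> + \<bar>f2 x - 1\<bar> + \<bar>f3 x - 1\<bar>)"
  define K where "K = {x \<in> box. \<theta> \<le> n1 x} \<inter> {x \<in> box. \<theta> \<le> n2 x}"
  have "compact box" by (auto simp: box_def intro: compact_Times)
  have cont: "continuous_on box f1" "continuous_on box f2" "continuous_on box f3"
      "continuous_on box n1" "continuous_on box n2"
    unfolding f1_def f2_def f3_def n1_def n2_def using p(1)
    by (intro continuous_intros; simp add: box_def mem_Times_iff)+
  have compact: "compact {x \<in> box. \<theta> \<le> n x}" if "continuous_on box n" for n
  proof -
    have "closed {x \<in> box. \<theta> \<le> n x}"
      using that \<open>compact box\<close> by (intro continuous_on_closed_Collect_le compact_imp_closed continuous_intros)
    then have "compact (box \<inter> {x \<in> box. \<theta> \<le> n x})"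
      using \<open>compact box\<close> by (rule compact_Int_closed [rotated])
    moreover have "box \<inter> {x \<in> box. \<theta> \<le> n x} = {x \<in> box. \<theta> \<le> n x}" by blast
    ultimately show ?thesis by simp
  qed
  have "compact K" unfolding K_def by (intro compact_Int compact cont)
  have contG: "continuous_on K G"
  proof -
    have "continuous_on box G" unfolding G_def by (intro continuous_intros cont)
    then show ?thesis by (rule continuous_on_subset) (auto simp: K_def)
  qed
  have G_pos: "G x > 0" if "x \<in> K" for x
  proof (rule ccontr)
    assume "\<not> G x > 0"
    then have f: "f1 x = 1" "f2 x = 1" "f3 x = 1"
      unfolding G_def by linarith+
    have "snd x = 0 \<and> (fst x = 0 \<or> fst x = 1)"
      using f that unfolding f1_def f2_def f3_def
      by (intro trivial_splitting [OF p] lp_sum_eq_1 [OF p(1)]) (auto simp: K_def box_def)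
    then have "n1 x = 0 \<or> n2 x = 0" using p by (auto simp: n1_def n2_def lp_sum_def)
    then show False using that \<theta> by (auto simp: K_def)
  qed
  obtain m where m: "m > 0" "\<And>x. x \<in> K \<Longrightarrow> m \<le> G x"
  proof (cases "K = {}")
    case False
    then obtain x where "x \<in> K" "\<forall>y\<in>K. G x \<le> G y"
      using continuous_attains_inf [OF \<open>compact K\<close> _ contG] by blast
    then show thesis using that [of "G x"] G_pos by blast
  qed (use that [of 1] in simp)
  show thesis
  proof (rule that [of "min 1 (m / 3)"])
    show "min 1 (m / 3) > 0" using m(1) by simp
    fix \<alpha> :: complex and y :: real
    assume y: "y \<ge> 0" and
      f: "\<bar>lp_sum p (cmod (2 * \<alpha> - 1)) (2 * y) - 1\<bar> < min 1 (m / 3)"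
       "\<bar>lp_sum p (cmod (\<alpha> + \<i> * (1 - \<alpha>))) (sqrt 2 * y) - 1\<bar> < min 1 (m / 3)"
       "\<bar>lp_sum p (cmod (\<alpha> - \<i> * (1 - \<alpha>))) (sqrt 2 * y) - 1\<bar> < min 1 (m / 3)"
    show "lp_sum p (cmod \<alpha>) y < \<theta> \<or> lp_sum p (cmod (1 - \<alpha>)) y < \<theta>"
    proof (rule ccontr)
      assume n: "\<not> ?thesis"
      have le: "cmod (2 * \<alpha> - 1) \<le> 2" "2 * y \<le> 2"
        using le_lp_sum [of "cmod (2 * \<alpha> - 1)" "2 * y" p] f(1) y p(1) by auto
      have "2 * cmod (1 / 2 - \<alpha>) = cmod (2 * \<alpha> - 1)"
      proof -
        have "2 * \<alpha> - 1 = - 2 * (1 / 2 - \<alpha>)" by simp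
        then show ?thesis by (metis norm_mult norm_minus_cancel norm_numeral)
      qed
      then have "(\<alpha>, y) \<in> K"
        using le y n by (simp add: K_def box_def n1_def n2_def dist_norm)
      then have "m \<le> G (\<alpha>, y)" by (rule m(2))
      then show False using f by (simp add: G_def f1_def f2_def f3_def)
    qed
  qed
qed

text \<open>If \<open>f - g\<close> and \<open>g\<close> are disjoint, turning \<open>f - g\<close> by a phase \<open>\<mu>\<close> preserves the norm.\<close>

definition turn :: "complex \<Rightarrow> 'a::complex_banach \<Rightarrow> 'a \<Rightarrow> 'a" where
  "turn \<mu> f g = g + \<mu> *\<^sub>C (f - g)"

text \<open>
  For \<open>f\<close> of norm about 1: an approximate form of a condition that is necessary for \<open>g\<close> and \<open>f - g\<close> to be
  disjoint and, if \<open>f\<close> is an atom and \<open>p \<noteq> 2\<close>, also sufficient.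
\<close>

definition almost_splits :: "real \<Rightarrow> 'a::complex_banach \<Rightarrow> 'a \<Rightarrow> bool" where
  "almost_splits \<delta> f g \<longleftrightarrow> (\<forall>\<mu>\<in>{- 1, \<i>, - \<i>}. \<bar>norm (turn \<mu> f g) - 1\<bar> < \<delta>)"

lemma turn_diff_left: "turn \<mu> f g - turn \<mu> f' g = \<mu> *\<^sub>C (f - f')"
  by (simp add: turn_def scaleC.scale_right_diff_distrib)

lemma turn_diff_right: "turn \<mu> f g - turn \<mu> f g' = (1 - \<mu>) *\<^sub>C (g - g')"
  by (simp add: turn_def scaleC.scale_right_diff_distrib scaleC.scale_left_diff_distrib scaleC_one algebra_simps)

context lp_copy
begin

lemma norm_combination_with_atom:
  assumes e: "atom_at j e"
  shows "\<exists>\<alpha> y. y \<ge> 0 \<and> (\<forall>a b. norm (a *\<^sub>C e + b *\<^sub>C g) = lp_sum p (cmod (a + b * \<alpha>)) (cmod b * y))"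
proof -
  obtain l where l: "cmod l = 1" "\<Phi> e = (\<lambda>n. if n = j then l else 0)"
    using e unfolding atom_at_def by blast
  have "l \<noteq> 0" using l(1) by auto
  define \<alpha> where "\<alpha> = \<Phi> g j / l"
  define h where "h = restr (- {j}) g"
  have "norm (a *\<^sub>C e + b *\<^sub>C g) = lp_sum p (cmod (a + b * \<alpha>)) (cmod b * norm h)" for a b
  proof -
    have eq: "a *\<^sub>C e + b *\<^sub>C g = (a + b * \<alpha>) *\<^sub>C e + b *\<^sub>C h"
      using \<open>l \<noteq> 0\<close> by (intro coord_inject) (auto simp: coord_add coord_scaleC l \<alpha>_def h_def coord_restr algebra_simps)
    have "norm (a *\<^sub>C e + b *\<^sub>C g) powr p = norm ((a + b * \<alpha>) *\<^sub>C e) powr p + norm (b *\<^sub>C h) powr p"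
      unfolding eq by (rule disjoint_norm_powr) (simp add: coord_scaleC l h_def coord_restr)
    then have "(norm (a *\<^sub>C e + b *\<^sub>C g) powr p) powr (1 / p) = lp_sum p (cmod (a + b * \<alpha>)) (cmod b * norm h)"
      by (simp add: norm_scaleC atom_at_norm [OF e] lp_sum_def)
    then show ?thesis using p_pos by (simp add: powr_powr)
  qed
  then show ?thesis by (intro exI [of _ \<alpha>] exI [of _ "norm h"]) simp
qed

text \<open>
  Up to a tolerance, an atom \<open>e\<close> is the disjoint sum of \<open>g\<close> and \<open>e - g\<close> only trivially. Here
  \<open>p \<noteq> 2\<close> is essential: in a Hilbert space no unit vector is distinguished by norms.
\<close>

lemma atom_indecomposable:
  assumes "p \<noteq> 2" "\<theta> > 0"
  obtains \<delta> where "\<delta> > 0"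
    "\<And>j e g. atom_at j e \<Longrightarrow> almost_splits \<delta> e g \<Longrightarrow> norm g < \<theta> \<or> norm (e - g) < \<theta>"
proof -
  obtain \<delta> where \<delta>: "\<delta> > 0"
    "\<And>\<alpha> y. y \<ge> 0 \<Longrightarrow> \<bar>lp_sum p (cmod (2 * \<alpha> - 1)) (2 * y) - 1\<bar> < \<delta> \<Longrightarrow>
       \<bar>lp_sum p (cmod (\<alpha> + \<i> * (1 - \<alpha>))) (sqrt 2 * y) - 1\<bar> < \<delta> \<Longrightarrow>
       \<bar>lp_sum p (cmod (\<alpha> - \<i> * (1 - \<alpha>))) (sqrt 2 * y) - 1\<bar> < \<delta> \<Longrightarrow>
       lp_sum p (cmod \<alpha>) y < \<theta> \<or> lp_sum p (cmod (1 - \<alpha>)) y < \<theta>"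
    using almost_trivial_splitting [OF p_pos assms] by blast
  have "norm g < \<theta> \<or> norm (e - g) < \<theta>" if e: "atom_at j e" and split: "almost_splits \<delta> e g" for j e g
  proof -
    obtain \<alpha> y where y: "y \<ge> 0"
      and n: "\<And>a b. norm (a *\<^sub>C e + b *\<^sub>C g) = lp_sum p (cmod (a + b * \<alpha>)) (cmod b * y)"
      using norm_combination_with_atom [OF e, of g] by auto
    have turn: "turn \<mu> e g = \<mu> *\<^sub>C e + (1 - \<mu>) *\<^sub>C g" for \<mu>
      by (simp add: turn_def scaleC.scale_right_diff_distrib scaleC.scale_left_diff_distrib scaleC_one)
    have eqs: "- 1 + (1 - - 1) * \<alpha> = 2 * \<alpha> - 1" "\<i> + (1 - \<i>) * \<alpha> = \<alpha> + \<i> * (1 - \<alpha>)"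
        "- \<i> + (1 - - \<i>) * \<alpha> = \<alpha> - \<i> * (1 - \<alpha>)"
      by (simp_all add: complex_eq_iff)
    have sp: "\<bar>lp_sum p (cmod (\<mu> + (1 - \<mu>) * \<alpha>)) (cmod (1 - \<mu>) * y) - 1\<bar> < \<delta>"
      if "\<mu> \<in> {- 1, \<i>, - \<i>}" for \<mu>
      using split that unfolding almost_splits_def turn n by blast
    have mod: "cmod (1 - - 1) = 2" "cmod (1 - \<i>) = sqrt 2" "cmod (1 - - \<i>) = sqrt 2"
      by (simp_all add: cmod_def)
    have "lp_sum p (cmod \<alpha>) y < \<theta> \<or> lp_sum p (cmod (1 - \<alpha>)) y < \<theta>"
      by (rule \<delta>(2) [OF y sp [of "- 1", unfolded eqs mod] sp [of "\<i>", unfolded eqs mod]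
            sp [of "- \<i>", unfolded eqs mod]]) blast+
    moreover have "norm g = lp_sum p (cmod \<alpha>) y" "norm (e - g) = lp_sum p (cmod (1 - \<alpha>)) y"
      using n [of 0 1] n [of 1 "- 1"] by (simp_all add: scaleC_one)
    ultimately show ?thesis by simp
  qed
  with \<delta>(1) that show thesis by blast
qed

lemma splits_along_restr:
  assumes "cmod \<mu> = 1"
  shows "norm (turn \<mu> x (restr A x)) = norm x"
  by (rule norm_cong) (use assms in \<open>auto simp: turn_def coord_add coord_scaleC coord_diff coord_restr norm_mult\<close>)

text \<open>
  If no set of coordinates divides \<open>x\<close> into two parts of norm greater than \<open>\<theta>\<close>, then, up to \<open>2 * \<theta>\<close>,
  \<open>x\<close> is concentrated in the last coordinate of the first initial segment whose part exceeds \<open>\<theta>\<close>.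
\<close>

lemma indivisible_near_atom:
  assumes ind: "\<And>A. norm (restr A x) \<le> \<theta> \<or> norm (x - restr A x) \<le> \<theta>"
    and x: "\<bar>norm x - 1\<bar> \<le> \<theta>" and \<theta>: "0 < \<theta>" "\<theta> < 1 / 10"
  obtains j e where "atom_at j e" "norm (x - e) \<le> 5 * \<theta>"
proof -
  have "\<exists>n. norm (restr {..<n} x) > \<theta>"
  proof -
    have "1 - 2 * \<theta> > 0" using \<theta> by simp
    then have "\<exists>n. norm (x - restr {..<n} x) < 1 - 2 * \<theta>"
      using eventually_happens' [OF _ order_tendstoD(2) [OF norm_restr_compl_tendsto [of x]]] by simp
    then obtain n where "norm (x - restr {..<n} x) < 1 - 2 * \<theta>" by blast
    then have "norm (restr {..<n} x) > \<theta>"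
      using norm_triangle_ineq [of "x - restr {..<n} x" "restr {..<n} x"] x by simp
    then show ?thesis by blast
  qed
  then obtain n where n: "norm (restr {..<n} x) > \<theta>" "\<And>m. m < n \<Longrightarrow> \<not> norm (restr {..<m} x) > \<theta>"
    using exists_least_iff [of "\<lambda>n. norm (restr {..<n} x) > \<theta>"] by blast
  have "restr {..<0} x = 0" by (rule coord_inject) (simp add: coord_restr)
  then have "n \<noteq> 0" using n(1) \<theta>(1) by (metis less_asym norm_zero)
  then obtain m where m: "n = Suc m" using not0_implies_Suc by blast
  define y where "y = restr {m} x"
  have eq: "x - y = restr {..<m} x + (x - restr {..<n} x)"
    by (rule coord_inject) (auto simp: y_def m coord_add coord_diff coord_restr)
  have "norm (restr {..<m} x) \<le> \<theta>" using n(2) [of m] m by simp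
  moreover have "norm (x - restr {..<n} x) \<le> \<theta>" using ind [of "{..<n}"] n(1) by simp
  ultimately have xy: "norm (x - y) \<le> 2 * \<theta>"
    unfolding eq using norm_triangle_ineq [of "restr {..<m} x" "x - restr {..<n} x"] by linarith
  define c where "c = \<Phi> x m"
  have y: "\<Phi> y = (\<lambda>n. if n = m then c else 0)"
    by (auto simp: y_def coord_restr c_def)
  then have "norm y = cmod c" by (rule norm_atom_multiple)
  moreover have "\<bar>norm x - norm y\<bar> \<le> 2 * \<theta>" using xy norm_triangle_ineq3 [of x y] by simp
  ultimately have c: "\<bar>cmod c - 1\<bar> \<le> 3 * \<theta>" using x by simp
  then have "c \<noteq> 0" using \<theta> by auto
  define e where "e = (1 / cmod c) *\<^sub>C y"
  have e: "\<Phi> e = (\<lambda>n. if n = m then c / cmod c else 0)"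
    by (auto simp: e_def coord_scaleC y)
  have "atom_at m e"
    unfolding atom_at_def using \<open>c \<noteq> 0\<close> by (intro exI [of _ "c / cmod c"]) (simp add: e norm_divide)
  moreover have "norm (y - e) \<le> 3 * \<theta>"
  proof -
    have "norm (y - e) = cmod (c - c / cmod c)"
      by (rule norm_atom_multiple [of _ m]) (auto simp: coord_diff y e)
    also have "c - c / cmod c = (c / cmod c) * complex_of_real (cmod c - 1)"
      using \<open>c \<noteq> 0\<close> by (simp add: field_simps)
    also have "cmod \<dots> = \<bar>cmod c - 1\<bar>"
      using \<open>c \<noteq> 0\<close> by (simp only: norm_mult norm_divide norm_of_real) simp
    finally show ?thesis using c by simp
  qed
  then have "norm (x - e) \<le> 5 * \<theta>"
    using xy norm_triangle_ineq [of "x - y" "y - e"] by simp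
  ultimately show thesis by (rule that)
qed

lemma atom_at_unique_index:
  assumes "atom_at j e" "atom_at j' e'" "norm (e - e') < 1"
  shows "j = j'"
proof (rule ccontr)
  assume "j \<noteq> j'"
  then have "cmod (\<Phi> (e - e') j) = 1"
    using assms(1,2) by (auto simp: atom_at_def coord_diff)
  then show False using cmod_coord_le [of "e - e'" j] assms(3) by simp
qed

text \<open>
  Atoms at distance less than 1 belong to the same coordinate, so a limit of atoms has a definite
  index.
\<close>

lemma limit_of_atoms:
  assumes "\<And>\<epsilon>. \<epsilon> > 0 \<Longrightarrow> \<exists>j e. atom_at j e \<and> norm (e - x) < \<epsilon>"
  obtains j where "atom_at j x"
proof -
  obtain j e where e: "atom_at j e" "norm (e - x) < 1 / 2"
    using assms [of "1 / 2"] by auto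
  have near: "\<exists>e. atom_at j e \<and> norm (e - x) < \<epsilon>" if "\<epsilon> > 0" for \<epsilon>
  proof -
    have "min \<epsilon> (1 / 2) > 0" using that by simp
    then obtain j' e' where e': "atom_at j' e'" "norm (e' - x) < min \<epsilon> (1 / 2)"
      using assms by blast
    then have "norm (e' - e) < 1"
      using e(2) norm_triangle_ineq [of "e' - x" "x - e"] by (simp add: norm_minus_commute)
    then have "j' = j" using atom_at_unique_index e'(1) e(1) by blast
    with e' show ?thesis by auto
  qed
  have "\<Phi> x n = 0" if "n \<noteq> j" for n
  proof -
    have "cmod (\<Phi> x n) \<le> \<epsilon>" if \<epsilon>: "\<epsilon> > 0" for \<epsilon>
    proof -
      obtain e where e: "atom_at j e" "norm (e - x) < \<epsilon>" using near [OF \<epsilon>] by blast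
      then have "cmod (\<Phi> (e - x) n) \<le> \<epsilon>" using cmod_coord_le [of "e - x" n] by simp
      then show ?thesis using e(1) \<open>n \<noteq> j\<close> by (auto simp: atom_at_def coord_diff)
    qed
    then show ?thesis using field_le_epsilon [of "cmod (\<Phi> x n)" 0] by simp
  qed
  moreover have "cmod (\<Phi> x j) = 1"
  proof -
    have "\<bar>cmod (\<Phi> x j) - 1\<bar> \<le> \<epsilon>" if \<epsilon>: "\<epsilon> > 0" for \<epsilon>
    proof -
      obtain e where e: "atom_at j e" "norm (e - x) < \<epsilon>" using near [OF \<epsilon>] by blast
      then have "cmod (\<Phi> e j - \<Phi> x j) \<le> \<epsilon>" using cmod_coord_le [of "e - x" j] by (simp add: coord_diff)
      moreover have "cmod (\<Phi> e j) = 1" using e(1) by (auto simp: atom_at_def)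
      ultimately show ?thesis using norm_triangle_ineq3 [of "\<Phi> e j" "\<Phi> x j"] by simp
    qed
    then show ?thesis using field_le_epsilon [of "\<bar>cmod (\<Phi> x j) - 1\<bar>" 0] by simp
  qed
  ultimately have "atom_at j x" unfolding atom_at_def by (intro exI [of _ "\<Phi> x j"]) auto
  then show thesis by (rule that)
qed

end

section \<open>Finding the atoms with the halting set\<close>

text \<open>
  For fixed tolerances this is a universal statement about rational vectors \<open>g\<close> whose negation can be
  verified by computing norms, hence decidable by the halting set. A quasi-atom lies near an atom
  whatever \<open>\<delta>\<close> is, and conversely near every atom there are quasi-atoms for some \<open>\<delta>\<close>, which need
  not be known in advance as it can be searched for. The slack \<open>\<delta> / 2\<close> in the norm of \<open>f\<close> leaves room
  for replacing a part of \<open>f\<close> by a rational vector.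
\<close>

definition quasi_atom :: "enat \<Rightarrow> (nat \<Rightarrow> 'a::complex_banach) \<Rightarrow> real \<Rightarrow> real \<Rightarrow> nat \<Rightarrow> bool" where
  "quasi_atom N F \<theta> \<delta> f \<longleftrightarrow>
     vector_code N f \<and> 0 < \<delta> \<and> \<delta> \<le> \<theta> \<and> \<bar>norm (vec F f) - 1\<bar> \<le> \<delta> / 2 \<and>
     (\<forall>g. vector_code N g \<longrightarrow> almost_splits \<delta> (vec F f) (vec F g) \<longrightarrow>
        norm (vec F g) \<le> \<theta> \<or> norm (vec F f - vec F g) \<le> \<theta>)"

lemma decidable_quasi_atom:
  fixes F :: "nat \<Rightarrow> 'a::complex_banach"
  assumes F: "effective_generating_set N F"
    and rec: "recursive_in halting_set f" "rat_recursive_in halting_set \<theta>" "rat_recursive_in halting_set \<delta>"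
  shows "decidable_in halting_set (\<lambda>n. quasi_atom N F (of_rat (\<theta> n)) (of_rat (\<delta> n)) (f n))"
proof -
  obtain neg where neg: "gauss neg = - 1" using ex_gauss_code_units by blast
  obtain ci where ci: "gauss ci = \<i>" using ex_gauss_code_units by blast
  obtain cj where cj: "gauss cj = - \<i>" using ex_gauss_code_units by blast
  define v where "v = vec F"
  define u where "u = (\<lambda>m::nat. first m)"
  define th where "th = (\<lambda>m. rat_of_code (first (second m)))"
  define de where "de = (\<lambda>m. rat_of_code (second (second m)))"
  define diff where "diff = (\<lambda>m g. vector_code_axpy (u m) neg g)"
  define t where "t = (\<lambda>c m g. vector_code_axpy g c (diff m g))"
  have v_diff: "v (diff m g) = v (u m) - v g" for m g
    by (simp add: v_def diff_def vector_of_code_axpy neg)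
  have v_t: "v (t c m g) = turn (gauss c) (v (u m)) (v g)" for c m g
    using v_diff [of m g] by (simp add: v_def t_def vector_of_code_axpy turn_def)
  note closed = vector_code_axpy_closed
  have rec_u [recursive_intros]: "recursive_in X (\<lambda>n. u (h n))" if "recursive_in X h" for X h
    unfolding u_def by (intro recursive_intros that)
  have rec_th [recursive_intros]: "rat_recursive_in X (\<lambda>n. th (h n))" if "recursive_in X h" for X h
    unfolding th_def by (intro recursive_intros that)
  have rec_de [recursive_intros]: "rat_recursive_in X (\<lambda>n. de (h n))" if "recursive_in X h" for X h
    unfolding de_def by (intro recursive_intros that)
  have rec_diff [recursive_intros]: "recursive_in X (\<lambda>n. diff (h n) (h' n))"
    if "recursive_in X h" "recursive_in X h'" for X h h'
    unfolding diff_def by (intro recursive_intros that)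
  have rec_t [recursive_intros]: "recursive_in X (\<lambda>n. t c (h n) (h' n))"
    if "recursive_in X h" "recursive_in X h'" for X h h' c
    unfolding t_def by (intro recursive_intros that)
  define between where "between = (\<lambda>c m g.
      (vector_code N (t c m g) \<and> norm (v (t c m g)) < of_rat (1 + de m)) \<and>
      (vector_code N (t c m g) \<and> of_rat (1 - de m) < norm (v (t c m g))))"
  \<comment> \<open>A witness that \<open>u m\<close> is divisible, expressed by strict inequalities between norms and rationals.\<close>
  define W where "W = (\<lambda>m g. vector_code N (u m) \<and> vector_code N g \<and>
      (between neg m g \<and> between ci m g \<and> between cj m g) \<and>
      (vector_code N g \<and> of_rat (th m) < norm (v g)) \<and>
      (vector_code N (diff m g) \<and> of_rat (th m) < norm (v (diff m g))))"
  have "semidecidable_in {} (\<lambda>m. \<exists>g. W m g)"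
    unfolding W_def between_def v_def
    by (intro semidecidable_intros semidecidable_norm F recursive_intros decidable_imp_semidecidable)
  then have dec1: "decidable_in halting_set (\<lambda>m. \<exists>g. W m g)"
    by (rule semidecidable_imp_decidable_in_halting_set)
  have dec2: "decidable_in halting_set (\<lambda>m. vector_code N (u m) \<and> of_rat (1 + de m * rat_of_code h) < norm (v (u m)))"
      "decidable_in halting_set (\<lambda>m. vector_code N (u m) \<and> norm (v (u m)) < of_rat (1 - de m * rat_of_code h))" for h
    unfolding v_def
    by (intro semidecidable_imp_decidable_in_halting_set semidecidable_norm F recursive_intros)+
  obtain h where h: "rat_of_code h = 1 / 2" using rat_of_code_surj by blast
  define Q where "Q = (\<lambda>m. vector_code N (u m) \<and> 0 < de m \<and> de m \<le> th m \<and>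
      \<not> (vector_code N (u m) \<and> of_rat (1 + de m * rat_of_code h) < norm (v (u m))) \<and>
      \<not> (vector_code N (u m) \<and> norm (v (u m)) < of_rat (1 - de m * rat_of_code h)) \<and>
      \<not> (\<exists>g. W m g))"
  have decQ: "decidable_in halting_set Q"
    unfolding Q_def by (intro recursive_intros dec1 dec2)
  have between: "between c m g \<longleftrightarrow> \<bar>norm (turn (gauss c) (v (u m)) (v g)) - 1\<bar> < of_rat (de m)"
    if "vector_code N (u m)" "vector_code N g" for c m g
  proof -
    have "vector_code N (t c m g)" using that by (simp add: t_def diff_def closed)
    then show ?thesis
      unfolding between_def by (auto simp: v_t of_rat_add of_rat_diff)
  qed
  have W: "W m g \<longleftrightarrow> almost_splits (of_rat (de m)) (v (u m)) (v g) \<and>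
      of_rat (th m) < norm (v g) \<and> of_rat (th m) < norm (v (u m) - v g)"
    if "vector_code N (u m)" "vector_code N g" for m g
  proof -
    have "vector_code N (diff m g)" using that by (simp add: diff_def closed)
    then show ?thesis
      unfolding W_def almost_splits_def between [OF that] neg ci cj v_diff using that by blast
  qed
  have Q: "Q m \<longleftrightarrow> quasi_atom N F (of_rat (th m)) (of_rat (de m)) (u m)" for m
  proof (cases "vector_code N (u m)")
    case True
    have "vector_code N g" if "W m g" for g using that unfolding W_def by (elim conjE)
    then have "(\<exists>g. W m g) \<longleftrightarrow> \<not> (\<forall>g. vector_code N g \<longrightarrow>
        almost_splits (of_rat (de m)) (v (u m)) (v g) \<longrightarrow>
        norm (v g) \<le> of_rat (th m) \<or> norm (v (u m) - v g) \<le> of_rat (th m))"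
      unfolding not_less [symmetric] using W [OF True] by blast
    moreover have "\<bar>norm (v (u m)) - 1\<bar> \<le> of_rat (de m) / 2 \<longleftrightarrow>
        \<not> of_rat (1 + de m * rat_of_code h) < norm (v (u m)) \<and>
        \<not> norm (v (u m)) < of_rat (1 - de m * rat_of_code h)"
    proof -
      have "real_of_rat (de m * rat_of_code h) = of_rat (de m) / 2"
        by (simp add: h of_rat_mult of_rat_divide)
      then show ?thesis by (simp only: of_rat_add of_rat_diff of_rat_1) linarith
    qed
    moreover have "0 < de m \<longleftrightarrow> (0 :: real) < of_rat (de m)" "de m \<le> th m \<longleftrightarrow> (of_rat (de m) :: real) \<le> of_rat (th m)"
      by (simp_all add: of_rat_less_eq)
    ultimately show ?thesis
      unfolding Q_def quasi_atom_def v_def [symmetric] using True by blast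
  qed (simp add: Q_def quasi_atom_def)
  from rec obtain c d where c: "recursive_in halting_set c" "\<theta> = (\<lambda>n. rat_of_code (c n))"
    and d: "recursive_in halting_set d" "\<delta> = (\<lambda>n. rat_of_code (d n))"
    unfolding rat_recursive_in_def by blast
  have "decidable_in halting_set (\<lambda>n. Q (pair (f n) (pair (c n) (d n))))"
    by (intro decidable_in_compose [OF decQ] recursive_intros rec c d)
  then show ?thesis by (simp add: Q u_def th_def de_def c(2) d(2))
qed

context lp_copy
begin

text \<open>
  If a set of coordinates divided \<open>f\<close> into two large parts, then a rational vector close to one of
  the parts would violate the defining condition.
\<close>

lemma quasi_atom_near_atom:
  assumes F: "generating_set N F" and q: "quasi_atom N F \<theta> \<delta> f" and \<theta>: "\<theta> < 1 / 10"
  obtains j e where "atom_at j e" "norm (vec F f - e) \<le> 5 * \<theta>"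
proof -
  define x where "x = vec F f"
  have f: "0 < \<delta>" "\<delta> \<le> \<theta>" "\<bar>norm x - 1\<bar> \<le> \<delta> / 2"
    and ind: "\<And>g. vector_code N g \<Longrightarrow> almost_splits \<delta> x (vec F g) \<Longrightarrow>
        norm (vec F g) \<le> \<theta> \<or> norm (x - vec F g) \<le> \<theta>"
    using q by (auto simp: quasi_atom_def x_def)
  have "norm (restr A x) \<le> \<theta> \<or> norm (x - restr A x) \<le> \<theta>" for A
  proof (rule ccontr)
    assume "\<not> ?thesis"
    then have big: "norm (restr A x) > \<theta>" "norm (x - restr A x) > \<theta>" by auto
    define \<eta> where "\<eta> = Min {\<delta> / 4, norm (restr A x) - \<theta>, norm (x - restr A x) - \<theta>}"
    have "\<eta> > 0" using big f(1) by (simp add: \<eta>_def)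
    then obtain g where g: "vector_code N g" "norm (vec F g - restr A x) < \<eta>"
      using rational_vectors_dense [OF F] by blast
    define y where "y = vec F g"
    have y: "norm (y - restr A x) < \<delta> / 4" "norm (y - restr A x) < norm (restr A x) - \<theta>"
        "norm (y - restr A x) < norm (x - restr A x) - \<theta>"
      using g(2) by (simp_all add: \<eta>_def y_def)
    have "\<bar>norm (turn \<mu> x y) - 1\<bar> < \<delta>" if "\<mu> \<in> {- 1, \<i>, - \<i>}" for \<mu>
    proof -
      have \<mu>: "cmod \<mu> = 1" using that by auto
      have "norm (turn \<mu> x y - turn \<mu> x (restr A x)) = cmod (1 - \<mu>) * norm (y - restr A x)"
        by (simp add: turn_diff_right norm_scaleC)
      also have "\<dots> \<le> 2 * norm (y - restr A x)"
        using norm_triangle_ineq4 [of 1 \<mu>] \<mu> by (intro mult_right_mono) auto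
      finally have "norm (turn \<mu> x y - turn \<mu> x (restr A x)) < \<delta> / 2" using y(1) by simp
      then show ?thesis
        using norm_triangle_ineq3 [of "turn \<mu> x y" "turn \<mu> x (restr A x)"] f(3)
          splits_along_restr [OF \<mu>, of x A] by linarith
    qed
    then have "almost_splits \<delta> x y" by (simp add: almost_splits_def)
    then have "norm y \<le> \<theta> \<or> norm (x - y) \<le> \<theta>" using ind g(1) by (simp add: y_def)
    moreover have "norm (restr A x) \<le> norm y + norm (y - restr A x)"
      using norm_triangle_ineq [of y "restr A x - y"] by (simp add: norm_minus_commute)
    moreover have "norm (x - restr A x) \<le> norm (x - y) + norm (y - restr A x)"
      using norm_triangle_ineq [of "x - y" "y - restr A x"] by simp
    ultimately show False using y by linarith
  qed
  moreover have "\<bar>norm x - 1\<bar> \<le> \<theta>" "0 < \<theta>" using f by linarith+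
  ultimately obtain j e where "atom_at j e" "norm (x - e) \<le> 5 * \<theta>"
    using indivisible_near_atom [of x \<theta>] \<theta> by blast
  then show thesis using that by (simp add: x_def)
qed

text \<open>
  The tolerance that holds for splittings of the atom itself, with \<open>\<theta> / 2\<close>, is halved in order to
  apply to splittings of a nearby rational vector, with \<open>\<theta>\<close>.
\<close>

lemma quasi_atom_exists:
  assumes "p \<noteq> 2" and F: "generating_set N F" and e: "atom_at j e" and pos: "\<theta> > 0" "\<eta> > 0"
  obtains f d where "quasi_atom N F \<theta> (of_rat (rat_of_code d)) f" "norm (vec F f - e) < \<eta>"
proof -
  obtain \<delta>0 where \<delta>0: "\<delta>0 > 0"
    "\<And>j e g. atom_at j e \<Longrightarrow> almost_splits \<delta>0 e g \<Longrightarrow> norm g < \<theta> / 2 \<or> norm (e - g) < \<theta> / 2"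
  proof -
    have "\<theta> / 2 > 0" using pos by simp
    then show thesis using atom_indecomposable [OF assms(1)] that by metis
  qed
  have "0 < min (\<delta>0 / 2) \<theta>" using \<delta>0(1) pos by simp
  then obtain q where q: "0 < real_of_rat q" "real_of_rat q < min (\<delta>0 / 2) \<theta>"
    using of_rat_dense by blast
  obtain d where d: "rat_of_code d = q" using rat_of_code_surj by blast
  define \<delta> where "\<delta> = real_of_rat q"
  have \<delta>: "0 < \<delta>" "\<delta> \<le> \<theta>" "2 * \<delta> \<le> \<delta>0" using q by (auto simp: \<delta>_def)
  have "min \<eta> (\<delta> / 2) > 0" using \<delta> pos by simp
  then obtain f where f: "vector_code N f" "norm (vec F f - e) < min \<eta> (\<delta> / 2)"
    using rational_vectors_dense [OF F] by blast
  define x where "x = vec F f"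
  have x: "norm (e - x) < \<delta> / 2" using f(2) by (simp add: x_def norm_minus_commute)
  have "\<bar>norm x - 1\<bar> \<le> \<delta> / 2"
    using norm_triangle_ineq3 [of e x] x atom_at_norm [OF e] by linarith
  moreover have "norm g \<le> \<theta> \<or> norm (x - g) \<le> \<theta>" if split: "almost_splits \<delta> x g" for g
  proof -
    have "almost_splits \<delta>0 e g"
      unfolding almost_splits_def
    proof
      fix \<mu> assume \<mu>: "\<mu> \<in> {- 1, \<i>, - \<i>}"
      then have "norm (turn \<mu> e g - turn \<mu> x g) < \<delta> / 2"
        using x by (auto simp: turn_diff_left norm_scaleC)
      moreover have "\<bar>norm (turn \<mu> x g) - 1\<bar> < \<delta>"
        using split \<mu> unfolding almost_splits_def by blast
      ultimately show "\<bar>norm (turn \<mu> e g) - 1\<bar> < \<delta>0"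
        using norm_triangle_ineq3 [of "turn \<mu> e g" "turn \<mu> x g"] \<delta> by linarith
    qed
    then have "norm g < \<theta> / 2 \<or> norm (e - g) < \<theta> / 2" using \<delta>0(2) e by blast
    moreover have "norm (x - g) \<le> norm (e - x) + norm (e - g)"
      using norm_triangle_ineq [of "x - e" "e - g"] by (simp add: norm_minus_commute)
    ultimately show ?thesis using x \<delta> pos by linarith
  qed
  ultimately have "quasi_atom N F \<theta> (of_rat (rat_of_code d)) f"
    using \<delta> f(1) unfolding quasi_atom_def d \<delta>_def [symmetric] x_def by blast
  then show thesis using that f(2) by simp
qed

end

lemma unimodular_near_power_of_i:
  assumes "cmod w = 1"
  obtains \<mu> where "\<mu> \<in> {1, - 1, \<i>, - \<i>}" "cmod (w - \<mu>) \<le> 4 / 5"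
proof -
  \<comment> \<open>One of \<open>\<bar>a\<bar>\<close>, \<open>\<bar>b\<bar>\<close> is at least \<open>1 / \<surd>2 > 7 / 10\<close>.\<close>
  define a b where "a = Re w" and "b = Im w"
  have ab: "a\<^sup>2 + b\<^sup>2 = 1"
    using assms cmod_power2 [of w] by (simp add: a_def b_def)
  have "\<exists>\<mu>\<in>{1, - 1, \<i>, - \<i>}. Re w * Re \<mu> + Im w * Im \<mu> \<ge> 7 / 10"
  proof (rule ccontr)
    assume "\<not> ?thesis"
    then have "\<bar>a\<bar> < 7 / 10" "\<bar>b\<bar> < 7 / 10" by (auto simp: a_def b_def not_le)
    then have "\<bar>a\<bar>\<^sup>2 < (7 / 10)\<^sup>2" "\<bar>b\<bar>\<^sup>2 < (7 / 10)\<^sup>2"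
      using power_strict_mono [OF _ abs_ge_zero pos2, of a "7 / 10"]
        power_strict_mono [OF _ abs_ge_zero pos2, of b "7 / 10"] by blast+
    then show False using ab by (simp add: power2_eq_square)
  qed
  then obtain \<mu> where \<mu>: "\<mu> \<in> {1, - 1, \<i>, - \<i>}" "Re w * Re \<mu> + Im w * Im \<mu> \<ge> 7 / 10" by blast
  have "(Re \<mu>)\<^sup>2 + (Im \<mu>)\<^sup>2 = 1" using \<mu>(1) by auto
  then have "(cmod (w - \<mu>))\<^sup>2 = 2 - 2 * (Re w * Re \<mu> + Im w * Im \<mu>)"
    using ab unfolding cmod_power2 by (simp add: a_def b_def power2_eq_square algebra_simps)
  also have "\<dots> \<le> (4 / 5)\<^sup>2" using \<mu>(2) by (simp add: power2_eq_square)
  finally have "cmod (w - \<mu>) \<le> 4 / 5" by (rule power2_le_imp_le) simp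
  with \<mu>(1) show thesis by (rule that)
qed

context lp_copy
begin

text \<open>
  A quasi-atom is refined step by step, each time to one of half the tolerance nearby; the limit is
  an atom. Which quasi-atoms lead to multiples of the same unit vector can be seen from the
  first approximations: up to a fourth root of unity, multiples of the same unit vector are at
  distance at most \<open>4/5\<close>, while different ones are at distance at least 1.
\<close>

lemma recursive_basis_neq_2:
  fixes F :: "nat \<Rightarrow> 'a"
  assumes "p \<noteq> 2" and F: "effective_generating_set N F"
  shows "\<exists>e a. recursive_basis halting_set p N F e a"
proof -
  have gen: "generating_set N F" using F by (simp add: effective_generating_set_def)
  \<comment> \<open>A quasi-atom is handled as a pair \<open>z\<close> of codes of its vector and of its \<open>\<delta>\<close>.\<close>
  define v where "v = (\<lambda>z. vec F (first z))"
  define tol where "tol = (\<lambda>k::nat. 1 / 400 * (1 / 2 ^ k) :: rat)"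
  define \<theta> where "\<theta> = (\<lambda>k::nat. 1 / (400 * 2 ^ k) :: real)"
  have tol: "of_rat (tol k) = \<theta> k" "of_rat (6 * tol k) = 6 * \<theta> k" for k
    by (simp_all add: tol_def \<theta>_def of_rat_mult of_rat_divide of_rat_power)
  have \<theta>: "0 < \<theta> k" "\<theta> k < 1 / 10" for k
  proof -
    have "\<theta> k \<le> 1 / 400" by (simp add: \<theta>_def field_simps)
    then show "\<theta> k < 1 / 10" by simp
  qed (simp add: \<theta>_def)
  have \<theta>_Suc: "\<theta> (Suc k) = \<theta> k / 2" for k by (simp add: \<theta>_def)
  define qa where "qa = (\<lambda>k z. quasi_atom N F (\<theta> k) (of_rat (rat_of_code (second z))) (first z))"
  have tol_rec [recursive_intros]: "rat_recursive_in X (\<lambda>n. tol (g n))" if "recursive_in X g" for X g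
    unfolding tol_def by (intro recursive_intros that)
  have dec_qa: "decidable_in halting_set (\<lambda>n. qa (f n) (g n))"
    if "recursive_in halting_set f" "recursive_in halting_set g" for f g
    unfolding qa_def tol(1) [symmetric] by (intro decidable_quasi_atom F recursive_intros that)
  have qa_vc: "vector_code N (first z)" if "qa k z" for k z
    using that by (simp add: qa_def quasi_atom_def)
  have qa_atom: "\<exists>j e. atom_at j e \<and> norm (v z - e) \<le> 5 * \<theta> k" if "qa k z" for k z
    using quasi_atom_near_atom [OF gen that [unfolded qa_def] \<theta>(2)] unfolding v_def by blast
  have qa_ex: "\<exists>z. qa k z \<and> norm (v z - e) < \<eta>" if e: "atom_at j e" and \<eta>: "\<eta> > 0" for j e k \<eta>
  proof -
    obtain f d where "quasi_atom N F (\<theta> k) (of_rat (rat_of_code d)) f" "norm (vec F f - e) < \<eta>"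
      using quasi_atom_exists [OF assms(1) gen e \<theta>(1) \<eta>] by blast
    then show ?thesis by (intro exI [of _ "pair f d"]) (simp add: qa_def v_def)
  qed
  obtain neg where neg: "gauss neg = - 1" using ex_gauss_code_units by blast

  \<comment> \<open>A quasi-atom of tolerance \<open>\<theta> k\<close> is within \<open>5 * \<theta> k\<close> of an atom, and there are vectors of the next
    tolerance within \<open>\<theta> k\<close> of that atom: so refinements within \<open>6 * \<theta> k\<close> exist, and by the geometric
    series they stay within \<open>12 * \<theta> k\<close>.\<close>
  define near where "near = (\<lambda>z z' k. vector_code N (vector_code_axpy (first z) neg (first z')) \<and>
      norm (vec F (vector_code_axpy (first z) neg (first z'))) < of_rat (6 * tol k))"
  have near: "near z z' k \<longleftrightarrow> norm (v z - v z') < 6 * \<theta> k"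
    if "vector_code N (first z)" "vector_code N (first z')" for z z' k
    using that by (simp add: near_def vector_code_axpy_closed vector_of_code_axpy neg v_def tol)
  obtain step where step: "recursive_in halting_set step"
    "\<And>m. qa (second m) (first m) \<Longrightarrow> qa (Suc (second m)) (step m) \<and> near (first m) (step m) (second m)"
  proof (rule semidecidable_uniformization)
    show "semidecidable_in halting_set (\<lambda>m. qa (Suc (second (first m))) (second m) \<and>
        near (first (first m)) (second m) (second (first m)))"
      unfolding near_def
      by (intro semidecidable_in_conj [OF decidable_imp_semidecidable semidecidable_in_relativize]
          dec_qa recursive_intros semidecidable_norm F)
    show "decidable_in halting_set (\<lambda>m. qa (second m) (first m))"
      by (intro dec_qa recursive_intros)
    fix m assume m: "qa (second m) (first m)"
    then obtain j e where e: "atom_at j e" "norm (v (first m) - e) \<le> 5 * \<theta> (second m)"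
      using qa_atom by blast
    then obtain z where z: "qa (Suc (second m)) z" "norm (v z - e) < \<theta> (second m)"
      using qa_ex \<theta>(1) by blast
    have "norm (v (first m) - v z) < 6 * \<theta> (second m)"
      using e(2) z(2) norm_triangle_ineq [of "v (first m) - e" "e - v z"] by (simp add: norm_minus_commute)
    then show "\<exists>z. qa (Suc (second m)) z \<and> near (first m) z (second m)"
      using z(1) near qa_vc m by blast
  qed blast
  define s where "s = (\<lambda>z k. rec_nat z (\<lambda>k r. step (pair r k)) k)"
  have s_rec: "recursive_in halting_set (\<lambda>n. s (f n) (g n))"
    if "recursive_in halting_set f" "recursive_in halting_set g" for f g
    unfolding s_def by (intro recursive_intros recursive_in_compose [OF step(1)] that)
  have qa_s: "qa k (s z k)" if "qa 0 z" for z k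
    using that by (induction k) (use step(2) [of "pair _ _"] in \<open>auto simp: s_def\<close>)
  have s_step: "norm (v (s z k) - v (s z (Suc k))) < 6 * \<theta> k" if "qa 0 z" for z k
  proof -
    have "near (s z k) (s z (Suc k)) k"
      using step(2) [of "pair (s z k) k"] qa_s [OF that, of k] by (simp add: s_def)
    then show ?thesis using near qa_vc qa_s [OF that] by blast
  qed
  have s_dist: "norm (v (s z k) - v (s z (k + i))) \<le> 12 * \<theta> k - 12 * \<theta> (k + i)" if "qa 0 z" for z k i
  proof (induction i)
    case (Suc i)
    have "norm (v (s z k) - v (s z (k + Suc i)))
        \<le> norm (v (s z k) - v (s z (k + i))) + norm (v (s z (k + i)) - v (s z (Suc (k + i))))"
      using norm_triangle_ineq [of "v (s z k) - v (s z (k + i))" "v (s z (k + i)) - v (s z (Suc (k + i)))"] by simp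
    then show ?case using Suc s_step [OF that, of "k + i"] \<theta>_Suc [of "k + i"] by simp
  qed simp
  have \<theta>_small: "\<exists>k. \<theta> k < \<epsilon>" if \<epsilon>: "\<epsilon> > 0" for \<epsilon>
  proof -
    obtain k where "(1 / 2) ^ k < \<epsilon>" using real_arch_pow_inv [of \<epsilon> "1 / 2"] \<epsilon> by auto
    moreover have "\<theta> k \<le> (1 / 2) ^ k" by (simp add: \<theta>_def power_one_over field_simps)
    ultimately show ?thesis by (intro exI [of _ k]) linarith
  qed
  have "\<exists>x. \<forall>k. norm (v (s z k) - x) \<le> 12 * \<theta> k" if z: "qa 0 z" for z
  proof -
    have "Cauchy (\<lambda>k. v (s z k))"
    proof (rule metric_CauchyI)
      fix \<epsilon> :: real assume "\<epsilon> > 0"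
      then obtain K where K: "\<theta> K < \<epsilon> / 24" using \<theta>_small [of "\<epsilon> / 24"] by auto
      have le: "norm (v (s z K) - v (s z m)) \<le> 12 * \<theta> K" if "m \<ge> K" for m
        using s_dist [OF z, of K "m - K"] that \<theta>(1) [of m] by simp
      have "dist (v (s z m)) (v (s z n)) < \<epsilon>" if "m \<ge> K" "n \<ge> K" for m n
        using le [OF that(1)] le [OF that(2)] K
          dist_triangle2 [of "v (s z m)" "v (s z n)" "v (s z K)"] by (simp add: dist_norm norm_minus_commute)
      then show "\<exists>M. \<forall>m\<ge>M. \<forall>n\<ge>M. dist (v (s z m)) (v (s z n)) < \<epsilon>" by blast
    qed
    then obtain x where x: "(\<lambda>k. v (s z k)) \<longlonglongrightarrow> x" using Cauchy_convergent convergent_def by blast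
    have "norm (v (s z k) - x) \<le> 12 * \<theta> k" for k
    proof (rule Lim_bounded)
      show "(\<lambda>i. norm (v (s z k) - v (s z i))) \<longlonglongrightarrow> norm (v (s z k) - x)"
        by (intro tendsto_intros x)
      show "\<forall>i\<ge>k. norm (v (s z k) - v (s z i)) \<le> 12 * \<theta> k"
        using s_dist [OF z, of k "_ - k"] \<theta>(1) by (smt (verit) le_add_diff_inverse)
    qed
    then show ?thesis by blast
  qed
  then obtain E where E: "\<And>z k. qa 0 z \<Longrightarrow> norm (v (s z k) - E z) \<le> 12 * \<theta> k" by metis
  have "\<exists>j. atom_at j (E z)" if z: "qa 0 z" for z
  proof (rule limit_of_atoms)
    fix \<epsilon> :: real assume "\<epsilon> > 0"
    then obtain k where k: "\<theta> k < \<epsilon> / 17" using \<theta>_small [of "\<epsilon> / 17"] by auto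
    obtain j e where e: "atom_at j e" "norm (v (s z k) - e) \<le> 5 * \<theta> k"
      using qa_atom qa_s [OF z] by blast
    have "norm (e - E z) \<le> norm (v (s z k) - e) + norm (v (s z k) - E z)"
      using norm_triangle_ineq [of "e - v (s z k)" "v (s z k) - E z"] by (simp add: norm_minus_commute)
    then have "norm (e - E z) < \<epsilon>" using e(2) E [OF z, of k] k by linarith
    then show "\<exists>j e. atom_at j e \<and> norm (e - E z) < \<epsilon>" using e(1) by blast
  qed blast
  then obtain ix where ix: "\<And>z. qa 0 z \<Longrightarrow> atom_at (ix z) (E z)" by metis
  have v_E: "norm (v z - E z) \<le> 3 / 100" if "qa 0 z" for z
    using E [OF that, of 0] by (simp add: s_def \<theta>_def)

  obtain one where one: "gauss one = 1" using ex_gauss_code_units by blast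
  obtain ci where ci: "gauss ci = \<i>" using ex_gauss_code_units by blast
  obtain cj where cj: "gauss cj = - \<i>" using ex_gauss_code_units by blast
  \<comment> \<open>The first approximations are within \<open>3 / 100\<close> of the limits, so the threshold \<open>9 / 10\<close> separates
    distances at most \<open>4 / 5\<close> from distances at least 1 between the limits.\<close>
  define touch where "touch = (\<lambda>c z z'. vector_code N (vector_code_axpy (first z) c (first z')) \<and>
      norm (vec F (vector_code_axpy (first z) c (first z'))) < of_rat (9 / 10))"
  define same where "same = (\<lambda>z z'. (touch neg z z' \<or> touch one z z') \<or> (touch cj z z' \<or> touch ci z z'))"
  have same: "same z z' \<longleftrightarrow> (\<exists>\<mu>\<in>{1, - 1, \<i>, - \<i>}. norm (v z - \<mu> *\<^sub>C v z') < 9 / 10)"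
    if "vector_code N (first z)" "vector_code N (first z')" for z z'
    using that by (simp add: same_def touch_def vector_code_axpy_closed vector_of_code_axpy
        neg one ci cj v_def of_rat_divide disj_commute disj_left_commute)
  have same_ix: "same z z' \<longleftrightarrow> ix z = ix z'" if z: "qa 0 z" and z': "qa 0 z'" for z z'
  proof -
    have dist: "\<bar>norm (v z - \<mu> *\<^sub>C v z') - norm (E z - \<mu> *\<^sub>C E z')\<bar> \<le> 6 / 100" if "cmod \<mu> = 1" for \<mu>
    proof -
      have eq: "(v z - \<mu> *\<^sub>C v z') - (E z - \<mu> *\<^sub>C E z') = (v z - E z) - \<mu> *\<^sub>C (v z' - E z')"
        by (simp add: scaleC.scale_right_diff_distrib algebra_simps)
      have "norm ((v z - \<mu> *\<^sub>C v z') - (E z - \<mu> *\<^sub>C E z')) \<le> norm (v z - E z) + norm (v z' - E z')"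
        unfolding eq using norm_triangle_ineq4 [of "v z - E z" "\<mu> *\<^sub>C (v z' - E z')"] that by (simp add: norm_scaleC)
      then show ?thesis
        using norm_triangle_ineq3 [of "v z - \<mu> *\<^sub>C v z'" "E z - \<mu> *\<^sub>C E z'"] v_E [OF z] v_E [OF z'] by linarith
    qed
    obtain l where l: "cmod l = 1" "\<Phi> (E z) = (\<lambda>n. if n = ix z then l else 0)"
      using ix [OF z] unfolding atom_at_def by blast
    obtain l' where l': "cmod l' = 1" "\<Phi> (E z') = (\<lambda>n. if n = ix z' then l' else 0)"
      using ix [OF z'] unfolding atom_at_def by blast
    show ?thesis
      unfolding same [OF qa_vc [OF z] qa_vc [OF z']]
    proof
      assume "\<exists>\<mu>\<in>{1, - 1, \<i>, - \<i>}. norm (v z - \<mu> *\<^sub>C v z') < 9 / 10"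
      then obtain \<mu> where \<mu>: "\<mu> \<in> {1, - 1, \<i>, - \<i>}" "norm (v z - \<mu> *\<^sub>C v z') < 9 / 10" by blast
      then have "cmod \<mu> = 1" by auto
      have "norm (E z - \<mu> *\<^sub>C E z') < 1" using dist [OF \<open>cmod \<mu> = 1\<close>] \<mu>(2) by linarith
      moreover have "atom_at (ix z') (\<mu> *\<^sub>C E z')"
        unfolding atom_at_def using l' \<open>cmod \<mu> = 1\<close>
        by (intro exI [of _ "\<mu> * l'"]) (auto simp: norm_mult coord_scaleC)
      ultimately show "ix z = ix z'" using atom_at_unique_index ix [OF z] by blast
    next
      assume eq: "ix z = ix z'"
      have "cmod (l / l') = 1" using l(1) l'(1) by (simp add: norm_divide)
      then obtain \<mu> where \<mu>: "\<mu> \<in> {1, - 1, \<i>, - \<i>}" "cmod (l / l' - \<mu>) \<le> 4 / 5"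
        by (rule unimodular_near_power_of_i)
      have "l' \<noteq> 0" using l'(1) by auto
      have "norm (E z - \<mu> *\<^sub>C E z') = cmod (l - \<mu> * l')"
        by (rule norm_atom_multiple [of _ "ix z"]) (auto simp: coord_diff coord_scaleC l l' eq)
      also have "l - \<mu> * l' = (l / l' - \<mu>) * l'" using \<open>l' \<noteq> 0\<close> by (simp add: field_simps)
      also have "cmod \<dots> \<le> 4 / 5" using \<mu>(2) l'(1) by (simp add: norm_mult)
      finally have "norm (E z - \<mu> *\<^sub>C E z') \<le> 4 / 5" .
      moreover have "cmod \<mu> = 1" using \<mu>(1) by auto
      ultimately have "norm (v z - \<mu> *\<^sub>C v z') < 9 / 10" using dist [of \<mu>] by linarith
      then show "\<exists>\<mu>\<in>{1, - 1, \<i>, - \<i>}. norm (v z - \<mu> *\<^sub>C v z') < 9 / 10" using \<mu>(1) by blast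
    qed
  qed
  \<comment> \<open>One representative for each coordinate: the least.\<close>
  define M where "M = {z. qa 0 z \<and> (\<forall>z'<z. qa 0 z' \<longrightarrow> \<not> same z z')}"
  have "decidable_in halting_set (\<lambda>z. z \<in> M)"
  proof -
    have touch: "decidable_in halting_set (\<lambda>m. touch c (first m) (second m))" for c
      unfolding touch_def
      by (intro semidecidable_imp_decidable_in_halting_set semidecidable_norm F recursive_intros)
    show ?thesis
      unfolding M_def mem_Collect_eq same_def by (intro recursive_intros dec_qa touch)
  qed
  then have semiM: "semidecidable_in halting_set (\<lambda>z. z \<in> M)" by (rule decidable_imp_semidecidable)
  have bij: "bij_betw ix M UNIV"
    unfolding bij_betw_def
  proof
    show "inj_on ix M"
    proof (rule inj_onI)
      fix z z' assume zz: "z \<in> M" "z' \<in> M" and eq: "ix z = ix z'"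
      then have "same z z'" "same z' z" using same_ix by (auto simp: M_def)
      then show "z = z'" using zz by (auto simp: M_def intro: linorder_cases [of z z'])
    qed
    show "ix ` M = UNIV"
    proof (intro equalityI subset_UNIV subsetI)
      fix j
      obtain e where e: "\<Phi> e = (\<lambda>n. if n = j then 1 else 0)" using atom_at_ex [of 1 j] by auto
      then have atom: "atom_at j e" unfolding atom_at_def by (intro exI [of _ 1]) simp
      have ex: "\<exists>z. qa 0 z \<and> ix z = j"
      proof -
        obtain z where z: "qa 0 z" "norm (v z - e) < 1 / 10" using qa_ex [OF atom, of "1 / 10" 0] by auto
        have "norm (E z - e) < 1"
          using v_E [OF z(1)] z(2) norm_triangle_ineq [of "E z - v z" "v z - e"] by (simp add: norm_minus_commute)
        then have "ix z = j" using atom_at_unique_index ix [OF z(1)] atom by blast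
        with z(1) show ?thesis by blast
      qed
      define z where "z = (LEAST z. qa 0 z \<and> ix z = j)"
      have z: "qa 0 z" "ix z = j" using LeastI_ex [OF ex] by (simp_all add: z_def)
      have "\<not> same z z'" if "z' < z" "qa 0 z'" for z'
        using not_less_Least [OF that(1) [unfolded z_def]] same_ix [OF z(1) that(2)] that(2) z(2) by auto
      then have "z \<in> M" using z(1) by (simp add: M_def)
      then show "j \<in> ix ` M" using z(2) by blast
    qed
  qed
  then have "infinite M" using bij_betw_finite infinite_UNIV_nat by blast
  then obtain f where f: "recursive_in halting_set f" "bij_betw f UNIV M"
    using semidecidable_enumeration [OF semiM] by blast
  have qa_f: "qa 0 (f n)" for n
    using f(2) unfolding M_def bij_betw_def by blast
  have basis: "lp_basis p (\<lambda>n. E (f n))"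
  proof (rule atoms_lp_basis [where j = "\<lambda>n. ix (f n)"])
    show "atom_at (ix (f i)) (E (f i))" for i using ix qa_f by blast
    show "bij (\<lambda>n. ix (f n))" using bij_betw_trans [OF f(2) bij] by (simp add: o_def)
  qed
  have "norm (vec F (first (s (f n) k)) - E (f n)) < 1 / 2 ^ k" for n k
  proof -
    have "12 * \<theta> k < 1 / 2 ^ k" by (simp add: \<theta>_def field_simps)
    then show ?thesis using E [OF qa_f, of n k] by (simp add: v_def)
  qed
  moreover have "vector_code N (first (s (f n) k))" for n k
    using qa_vc qa_s qa_f by blast
  moreover have "recursive_in halting_set (\<lambda>m. first (s (f (first m)) (second m)))"
    by (intro recursive_intros s_rec recursive_in_compose [OF f(1)])
  ultimately show ?thesis
    using basis unfolding recursive_basis_def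
    by (intro exI [of _ "\<lambda>n. E (f n)"] exI [of _ "\<lambda>n k. first (s (f n) k)"]) blast
qed

end

section \<open>Orthonormal bases in the case of \<open>\<ell>\<^sup>2\<close>\<close>

locale l2_copy = lp_copy 2 \<Phi> for \<Phi> :: "'a::complex_banach \<Rightarrow> nat \<Rightarrow> complex"
begin

definition ip :: "'a \<Rightarrow> 'a \<Rightarrow> complex" where
  "ip x y = (\<Sum>n. cnj (\<Phi> x n) * \<Phi> y n)"

lemma summable_cmod_square: "summable (\<lambda>n. (cmod (\<Phi> x n))\<^sup>2)"
  using summable_coord [of x] by simp

lemma norm_square: "(norm x)\<^sup>2 = (\<Sum>n. (cmod (\<Phi> x n))\<^sup>2)"
  using norm_powr [of x] by simp

lemma summable_ip: "summable (\<lambda>n. cnj (\<Phi> x n) * \<Phi> y n)"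
proof (rule summable_comparison_test' [of "\<lambda>n. (cmod (\<Phi> x n))\<^sup>2 + (cmod (\<Phi> y n))\<^sup>2" 0])
  show "summable (\<lambda>n. (cmod (\<Phi> x n))\<^sup>2 + (cmod (\<Phi> y n))\<^sup>2)"
    by (intro summable_add summable_cmod_square)
  show "norm (cnj (\<Phi> x n) * \<Phi> y n) \<le> (cmod (\<Phi> x n))\<^sup>2 + (cmod (\<Phi> y n))\<^sup>2" for n
  proof -
    have "0 \<le> cmod (\<Phi> x n) * cmod (\<Phi> y n)" by simp
    then show ?thesis
      using sum_squares_bound [of "cmod (\<Phi> x n)" "cmod (\<Phi> y n)"]
      unfolding norm_mult complex_mod_cnj by linarith
  qed
qed

lemma ip_add_right: "ip x (y + z) = ip x y + ip x z"
  unfolding ip_def by (simp add: coord_add distrib_left suminf_add [OF summable_ip summable_ip])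

lemma ip_scaleC_right: "ip x (c *\<^sub>C y) = c * ip x y"
  unfolding ip_def
  by (simp add: coord_scaleC mult.left_commute [of _ c] suminf_mult [OF summable_ip])

lemma ip_0_right [simp]: "ip x 0 = 0" and ip_0_left [simp]: "ip 0 x = 0"
  by (simp_all add: ip_def)

lemma ip_diff_right: "ip x (y - z) = ip x y - ip x z"
  using ip_add_right [of x "y - z" z] by simp

lemma ip_sum_right: "ip x (\<Sum>i\<in>A. f i) = (\<Sum>i\<in>A. ip x (f i))"
  by (induction A rule: infinite_finite_induct) (simp_all add: ip_add_right)

lemma ip_commute: "ip y x = cnj (ip x y)"
proof -
  have "(\<lambda>n. cnj (\<Phi> x n) * \<Phi> y n) sums ip x y"
    unfolding ip_def by (rule summable_sums [OF summable_ip])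
  then have "(\<lambda>n. cnj (cnj (\<Phi> x n) * \<Phi> y n)) sums cnj (ip x y)"
    by (rule sums_cnj [THEN iffD2])
  then show ?thesis unfolding ip_def by (simp add: sums_iff mult.commute)
qed

lemma ip_self: "ip x x = of_real ((norm x)\<^sup>2)"
proof -
  have "(\<lambda>n. (cmod (\<Phi> x n))\<^sup>2) sums (norm x)\<^sup>2"
    unfolding norm_square by (rule summable_sums [OF summable_cmod_square])
  then have "(\<lambda>n. complex_of_real ((cmod (\<Phi> x n))\<^sup>2)) sums of_real ((norm x)\<^sup>2)"
    by (rule sums_of_real)
  moreover have "cnj z * z = complex_of_real ((cmod z)\<^sup>2)" for z
    by (metis complex_norm_square mult.commute)
  ultimately show ?thesis unfolding ip_def by (simp add: sums_iff)
qed

lemma norm_add_square: "(norm (x + y))\<^sup>2 = (norm x)\<^sup>2 + (norm y)\<^sup>2 + 2 * Re (ip x y)"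
proof -
  have "ip (x + y) (x + y) = ip (x + y) x + ip (x + y) y" by (rule ip_add_right)
  also have "\<dots> = cnj (ip x x + ip x y) + cnj (ip y x + ip y y)"
    by (simp only: ip_commute [of "x + y"] ip_add_right)
  finally have "Re (ip (x + y) (x + y)) = Re (ip x x) + Re (ip y y) + 2 * Re (ip x y)"
    using ip_commute [of y x] by simp
  then show ?thesis by (simp add: ip_self)
qed

lemma norm_diff_square: "(norm (x - y))\<^sup>2 = (norm x)\<^sup>2 + (norm y)\<^sup>2 - 2 * Re (ip x y)"
  using norm_add_square [of x "- y"] ip_diff_right [of x 0 y] by simp

lemma cmod_ip_le:
  assumes "norm e = 1"
  shows "cmod (ip e x) \<le> norm x"
proof -
  define c where "c = ip e x"
  have "(norm (x - c *\<^sub>C e))\<^sup>2 = (norm x)\<^sup>2 + (cmod c)\<^sup>2 - 2 * Re (c * cnj c)"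
    using ip_commute [of x e] assms
    by (simp add: norm_diff_square ip_scaleC_right norm_scaleC c_def)
  also have "Re (c * cnj c) = (cmod c)\<^sup>2" by (simp add: complex_mult_cnj cmod_power2)
  finally have "(cmod c)\<^sup>2 \<le> (norm x)\<^sup>2" using zero_le_power2 [of "norm (x - c *\<^sub>C e)"] by linarith
  then show ?thesis unfolding c_def by (rule power2_le_imp_le) simp
qed

lemma orthonormal_norm_square:
  assumes "finite A" "\<And>i j. i \<in> A \<Longrightarrow> j \<in> A \<Longrightarrow> ip (e i) (e j) = of_bool (i = j)"
  shows "(norm (\<Sum>i\<in>A. c i *\<^sub>C e i))\<^sup>2 = (\<Sum>i\<in>A. (cmod (c i))\<^sup>2)"
  using assms
proof (induction A)
  case (insert a A)
  have "ip (e a) (\<Sum>i\<in>A. c i *\<^sub>C e i) = 0"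
    using insert.hyps insert.prems by (auto simp: ip_sum_right ip_scaleC_right intro!: sum.neutral)
  then have "ip (\<Sum>i\<in>A. c i *\<^sub>C e i) (e a) = 0" by (simp add: ip_commute [of "sum _ _"])
  moreover have "norm (e a) = 1"
  proof (rule power2_eq_imp_eq)
    show "(norm (e a))\<^sup>2 = 1\<^sup>2"
      using insert.prems [of a a] by (simp add: ip_self flip: of_real_power)
  qed auto
  ultimately show ?case
    using insert norm_add_square [of "\<Sum>i\<in>A. c i *\<^sub>C e i" "c a *\<^sub>C e a"]
    by (simp add: ip_scaleC_right norm_scaleC add.commute)
qed simp

text \<open>
  Gram-Schmidt orthonormalization of a sequence that may be linearly dependent: as \<open>1 / 0 = 0\<close>, a
  vector depending on its predecessors contributes 0.
\<close>

fun gram_schmidt :: "(nat \<Rightarrow> 'a) \<Rightarrow> nat \<Rightarrow> 'a" where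
  "gram_schmidt F n =
     (let r = F n - (\<Sum>i<n. ip (gram_schmidt F i) (F n) *\<^sub>C gram_schmidt F i)
      in complex_of_real (1 / norm r) *\<^sub>C r)"

declare gram_schmidt.simps [simp del]

definition residue :: "(nat \<Rightarrow> 'a) \<Rightarrow> nat \<Rightarrow> 'a" where
  "residue F n = F n - (\<Sum>i<n. ip (gram_schmidt F i) (F n) *\<^sub>C gram_schmidt F i)"

lemma gram_schmidt_eq: "gram_schmidt F n = complex_of_real (1 / norm (residue F n)) *\<^sub>C residue F n"
  unfolding residue_def by (subst gram_schmidt.simps) (simp only: Let_def)

lemma residue_eq: "residue F n = complex_of_real (norm (residue F n)) *\<^sub>C gram_schmidt F n"
  by (cases "residue F n = 0") (simp_all add: gram_schmidt_eq scaleC_scaleC scaleC_one)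

lemma norm_gram_schmidt: "residue F n \<noteq> 0 \<Longrightarrow> norm (gram_schmidt F n) = 1"
  by (simp add: gram_schmidt_eq norm_scaleC norm_divide)

lemma gram_schmidt_orthogonal_less: "i < n \<Longrightarrow> ip (gram_schmidt F i) (gram_schmidt F n) = 0"
proof (induction n arbitrary: i rule: less_induct)
  case (less n)
  have orth: "ip (gram_schmidt F i) (gram_schmidt F k) = 0" if "k < n" "k \<noteq> i" for k
  proof (cases "k < i")
    case True
    then have "ip (gram_schmidt F k) (gram_schmidt F i) = 0" using less.IH [of i k] less.prems by simp
    then show ?thesis using ip_commute [of "gram_schmidt F i" "gram_schmidt F k"] by simp
  next
    case False
    then show ?thesis using less.IH [of k i] that by simp
  qed
  have "ip (gram_schmidt F i) (residue F n) = 0"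
  proof (cases "residue F i = 0")
    case True
    then show ?thesis by (simp add: gram_schmidt_eq)
  next
    case False
    have "(\<Sum>k<n. ip (gram_schmidt F k) (F n) * ip (gram_schmidt F i) (gram_schmidt F k))
        = (\<Sum>k<n. if k = i then ip (gram_schmidt F i) (F n) else 0)"
      by (rule sum.cong) (auto simp: orth ip_self norm_gram_schmidt [OF False])
    then show ?thesis
      using less.prems by (simp add: residue_def ip_diff_right ip_sum_right ip_scaleC_right)
  qed
  then show ?case by (simp add: gram_schmidt_eq [of F n] ip_scaleC_right)
qed

lemma gram_schmidt_orthogonal: "i \<noteq> n \<Longrightarrow> ip (gram_schmidt F i) (gram_schmidt F n) = 0"
  using gram_schmidt_orthogonal_less [of i n F] gram_schmidt_orthogonal_less [of n i F]
    ip_commute [of "gram_schmidt F i" "gram_schmidt F n"]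
  by (cases "i < n") auto

lemma gram_schmidt_expansion:
  "F n = complex_of_real (norm (residue F n)) *\<^sub>C gram_schmidt F n
     + (\<Sum>i<n. ip (gram_schmidt F i) (F n) *\<^sub>C gram_schmidt F i)"
  by (simp add: residue_eq [symmetric]) (simp add: residue_def)

lemma ip_gram_schmidt_earlier:
  assumes "i < n"
  shows "ip (gram_schmidt F n) (F i) = 0"
proof -
  have "ip (gram_schmidt F n) (F i) = of_real (norm (residue F i)) * ip (gram_schmidt F n) (gram_schmidt F i)
      + (\<Sum>k<i. ip (gram_schmidt F k) (F i) * ip (gram_schmidt F n) (gram_schmidt F k))"
    using arg_cong [OF gram_schmidt_expansion [of F i], of "ip (gram_schmidt F n)"]
    by (simp add: ip_add_right ip_sum_right ip_scaleC_right)
  also have "\<dots> = 0"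
    using assms by (auto simp: gram_schmidt_orthogonal intro!: sum.neutral)
  finally show ?thesis .
qed

lemma ip_gram_schmidt_self: "ip (gram_schmidt F n) (F n) = of_real (norm (residue F n))"
proof -
  have "ip (gram_schmidt F n) (F n) = of_real (norm (residue F n)) * ip (gram_schmidt F n) (gram_schmidt F n)
      + (\<Sum>k<n. ip (gram_schmidt F k) (F n) * ip (gram_schmidt F n) (gram_schmidt F k))"
    using arg_cong [OF gram_schmidt_expansion [of F n], of "ip (gram_schmidt F n)"]
    by (simp add: ip_add_right ip_sum_right ip_scaleC_right)
  also have "\<dots> = of_real (norm (residue F n)) * ip (gram_schmidt F n) (gram_schmidt F n)"
    by (auto simp: gram_schmidt_orthogonal intro!: sum.neutral)
  also have "\<dots> = of_real (norm (residue F n))"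
    by (cases "residue F n = 0") (simp_all add: ip_self norm_gram_schmidt)
  finally show ?thesis .
qed

end

lemma span_image_lessThan:
  fixes F :: "nat \<Rightarrow> 'a::complex_banach"
  assumes "x \<in> scaleC.span (F ` {..<n})"
  shows "\<exists>b. x = (\<Sum>i<n. b i *\<^sub>C F i)"
  using assms
proof (induction n arbitrary: x)
  case (Suc n)
  have "F ` {..<Suc n} = insert (F n) (F ` {..<n})" by (simp add: lessThan_Suc)
  then obtain k where "x - k *\<^sub>C F n \<in> scaleC.span (F ` {..<n})"
    using Suc.prems by (auto simp: scaleC.span_breakdown_eq)
  then obtain b where b: "x - k *\<^sub>C F n = (\<Sum>i<n. b i *\<^sub>C F i)" using Suc.IH by blast
  have "(\<Sum>i<Suc n. (b(n := k)) i *\<^sub>C F i) = (\<Sum>i<n. b i *\<^sub>C F i) + k *\<^sub>C F n" by simp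
  then have "x = (\<Sum>i<Suc n. (b(n := k)) i *\<^sub>C F i)" by (simp flip: b)
  then show ?case by blast
qed simp

lemma approximate_with_last_coefficient:
  fixes F :: "nat \<Rightarrow> 'a::complex_banach"
  assumes "\<epsilon> > 0"
  obtains w where "code_length w = Suc n" "coeff w n = \<gamma>"
    "norm (vec F w - (gauss \<gamma> *\<^sub>C F n + (\<Sum>i<n. b i *\<^sub>C F i))) < \<epsilon>"
proof -
  define B where "B = 1 + (\<Sum>i<n. norm (F i))"
  have B: "B > 0" by (simp add: B_def add_pos_nonneg sum_nonneg)
  then have "\<epsilon> / B > 0" using assms by simp
  then have "\<forall>i. \<exists>c. cmod (gauss c - b i) < \<epsilon> / B"
    by (metis gauss_rat_of_code_dense)
  then obtain g where g: "\<And>i. cmod (gauss (g i) - b i) < \<epsilon> / B" by metis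
  define w where "w = list_encode (map (\<lambda>i. if i = n then \<gamma> else g i) [0..<Suc n])"
  have len: "code_length w = Suc n" by (simp add: w_def del: upt_Suc)
  have co: "coeff w i = (if i < Suc n then if i = n then \<gamma> else g i else 0)" for i
    unfolding w_def by (rule coeff_list_encode_map)
  have "vec F w = (\<Sum>i<Suc n. gauss (coeff w i) *\<^sub>C F i)"
    by (rule vector_of_code_eq_sum) (simp add: len)
  also have "\<dots> = gauss \<gamma> *\<^sub>C F n + (\<Sum>i<n. gauss (g i) *\<^sub>C F i)"
    by (simp add: co add.commute)
  finally have eq: "vec F w - (gauss \<gamma> *\<^sub>C F n + (\<Sum>i<n. b i *\<^sub>C F i))
      = (\<Sum>i<n. (gauss (g i) - b i) *\<^sub>C F i)"
    by (simp add: scaleC.scale_left_diff_distrib sum_subtractf)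
  have "norm (\<Sum>i<n. (gauss (g i) - b i) *\<^sub>C F i) \<le> (\<Sum>i<n. \<epsilon> / B * norm (F i))"
  proof (rule sum_norm_le)
    show "norm ((gauss (g i) - b i) *\<^sub>C F i) \<le> \<epsilon> / B * norm (F i)" for i
      unfolding norm_scaleC using less_imp_le [OF g [of i]] by (rule mult_right_mono) simp
  qed
  also have "\<dots> = \<epsilon> / B * (B - 1)" by (simp add: B_def sum_distrib_left)
  also have "\<dots> < \<epsilon>" using B assms by (simp add: field_simps)
  finally have "norm (vec F w - (gauss \<gamma> *\<^sub>C F n + (\<Sum>i<n. b i *\<^sub>C F i))) < \<epsilon>"
    unfolding eq .
  moreover have "coeff w n = \<gamma>" by (simp add: co)
  ultimately show thesis using len that by blast
qed

context l2_copy
begin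

lemma residue_in_span:
  obtains b where "residue F n = F n + (\<Sum>i<n. b i *\<^sub>C F i)"
proof -
  have gs: "gram_schmidt F i \<in> scaleC.span (F ` {..<n})" if "i < n" for i n
    using that
  proof (induction i arbitrary: n rule: less_induct)
    case (less i)
    have "residue F i \<in> scaleC.span (F ` {..<n})"
      unfolding residue_def using less
      by (intro scaleC.span_diff scaleC.span_sum scaleC.span_scale less.IH)
        (auto intro: scaleC.span_base)
    then show ?case by (simp add: gram_schmidt_eq scaleC.span_scale)
  qed
  have "F n - residue F n \<in> scaleC.span (F ` {..<n})"
    unfolding residue_def using gs by (auto intro!: scaleC.span_sum scaleC.span_scale)
  then obtain b where b: "F n - residue F n = (\<Sum>i<n. b i *\<^sub>C F i)"
    using span_image_lessThan by blast
  have "residue F n = F n + (\<Sum>i<n. (- b i) *\<^sub>C F i)"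
    using b by (simp add: sum_negf algebra_simps)
  then show thesis by (rule that)
qed

text \<open>
  The earlier vectors are orthogonal to the \<open>n\<close>-th orthonormal vector, so only the last coefficient, a
  Gaussian rational, enters the inner product.
\<close>

lemma ip_gram_schmidt_code:
  assumes "code_length w = Suc n"
  shows "ip (gram_schmidt F n) (vec F w) =
    gauss (coeff w n) * of_real (norm (residue F n))"
proof -
  have "vec F w = (\<Sum>i<Suc n. gauss (coeff w i) *\<^sub>C F i)"
    by (rule vector_of_code_eq_sum) (simp add: assms)
  then show ?thesis
    by (simp add: ip_add_right ip_sum_right ip_scaleC_right ip_gram_schmidt_earlier ip_gram_schmidt_self)
qed

lemma gram_schmidt_dense:
  assumes gen: "generating_set N F"
    and E: "\<And>n. enat n < N \<Longrightarrow> residue F n \<noteq> 0 \<Longrightarrow> gram_schmidt F n \<in> E"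
  shows "closure (scaleC.span E) = UNIV"
proof -
  have "F i \<in> scaleC.span E" if i: "enat i < N" for i
  proof -
    have e: "gram_schmidt F k \<in> scaleC.span E" if "k \<le> i" for k
    proof (cases "residue F k = 0")
      case True
      then show ?thesis by (simp add: gram_schmidt_eq scaleC.span_zero)
    next
      case False
      moreover have "enat k < N" using i that by (metis enat_ord_simps(1) le_less_trans)
      ultimately show ?thesis using E by (intro scaleC.span_base)
    qed
    show ?thesis
      by (subst gram_schmidt_expansion [of F i]) (intro scaleC.span_add scaleC.span_scale scaleC.span_sum e; simp)
  qed
  then have "scaleC.span (members N F) \<subseteq> scaleC.span E"
    by (intro scaleC.span_minimal scaleC.subspace_span) (auto simp: members_def)
  then show ?thesis
    using gen closure_mono unfolding generating_set_def by blast
qed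

lemma approximate_multiple_of_residue:
  assumes "\<epsilon> > 0"
  obtains w where "code_length w = Suc n" "coeff w n = \<gamma>"
    "norm (vec F w - gauss \<gamma> *\<^sub>C residue F n) < \<epsilon>"
proof -
  obtain b where "residue F n = F n + (\<Sum>i<n. b i *\<^sub>C F i)" by (rule residue_in_span)
  then have "gauss \<gamma> *\<^sub>C F n + (\<Sum>i<n. (gauss \<gamma> * b i) *\<^sub>C F i)
      = gauss \<gamma> *\<^sub>C residue F n"
    by (simp add: scaleC.scale_right_distrib scaleC.scale_sum_right scaleC_scaleC)
  then show thesis
    using approximate_with_last_coefficient [OF assms, where n = n and \<gamma> = \<gamma>
        and F = F and b = "\<lambda>i. gauss \<gamma> * b i"] that by metis
qed

text \<open>
  Let \<open>d\<close> be the distance of \<open>f\<^sub>n\<close> from the span of its predecessors and \<open>e\<close> the \<open>n\<close>-th orthonormal vector.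
  For \<open>v = c f\<^sub>n + u\<close> with \<open>c > 0\<close> and \<open>u\<close> in that span, the inner product of \<open>v\<close> with \<open>e\<close> is \<open>c d\<close>, which
  is also the least norm of all vectors of this form with the same \<open>c\<close>. So
  \<open>\<parallel>v - e\<parallel>\<^sup>2 = \<parallel>v\<parallel>\<^sup>2 + 1 - 2 c d\<close> can be bounded from above by norms, given a lower bound \<open>q\<close> of \<open>c d\<close>.
\<close>

definition least_norm_bound :: "(nat \<Rightarrow> 'a) \<Rightarrow> nat \<Rightarrow> nat \<Rightarrow> real \<Rightarrow> bool" where
  "least_norm_bound F n v q \<longleftrightarrow>
     (\<forall>w. code_length w = Suc n \<longrightarrow> gauss (coeff w n) = gauss (coeff v n) \<longrightarrow>
        q \<le> norm (vec F w))"

definition near_orthonormal :: "(nat \<Rightarrow> 'a) \<Rightarrow> nat \<Rightarrow> nat \<Rightarrow> nat \<Rightarrow> bool" where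
  "near_orthonormal F n k v \<longleftrightarrow>
     code_length v = Suc n \<and> Im (gauss (coeff v n)) = 0 \<and> 0 < Re (gauss (coeff v n)) \<and>
     (\<exists>q a. least_norm_bound F n v (of_rat (rat_of_code q)) \<and>
        norm (vec F v) < of_rat (rat_of_code a) \<and>
        rat_of_code a * rat_of_code a + 1 - 2 * rat_of_code q < 1 / 2 ^ k * (1 / 2 ^ k))"

lemma near_orthonormal_sound:
  assumes "near_orthonormal F n k v"
  shows "residue F n \<noteq> 0" "norm (vec F v - gram_schmidt F n) < 1 / 2 ^ k"
proof -
  obtain q0 a0 where v: "code_length v = Suc n" "Im (gauss (coeff v n)) = 0"
      "0 < Re (gauss (coeff v n))"
    and bound: "least_norm_bound F n v (of_rat (rat_of_code q0))"
    and a0: "norm (vec F v) < of_rat (rat_of_code a0)"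
      "rat_of_code a0 * rat_of_code a0 + 1 - 2 * rat_of_code q0 < 1 / 2 ^ k * (1 / 2 ^ k)"
    using assms unfolding near_orthonormal_def by blast
  define c q a d x where "c = Re (gauss (coeff v n))" and "q = real_of_rat (rat_of_code q0)"
    and "a = real_of_rat (rat_of_code a0)" and "d = norm (residue F n)" and "x = vec F v"
  have c: "c > 0" "gauss (coeff v n) = of_real c"
    using v by (simp_all add: c_def complex_eq_iff)
  have a: "norm x < a" using a0(1) by (simp add: a_def x_def)
  have "real_of_rat (rat_of_code a0 * rat_of_code a0 + 1 - 2 * rat_of_code q0) < of_rat (1 / 2 ^ k * (1 / 2 ^ k))"
    using a0(2) by (simp only: of_rat_less)
  then have aq: "a * a + 1 - 2 * q < (1 / 2 ^ k)\<^sup>2"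
    by (simp add: a_def q_def of_rat_add of_rat_diff of_rat_mult of_rat_divide of_rat_power power2_eq_square)
  \<comment> \<open>Rational vectors with last coefficient \<open>c\<close> approximate \<open>c\<close> times the residue, whose norm is \<open>c * d\<close>.\<close>
  have q: "q \<le> c * d"
  proof (rule ccontr)
    assume "\<not> q \<le> c * d"
    then have "q - c * d > 0" by simp
    obtain w where w: "code_length w = Suc n" "coeff w n = coeff v n"
      "norm (vec F w - gauss (coeff v n) *\<^sub>C residue F n) < q - c * d"
      by (rule approximate_multiple_of_residue [OF \<open>q - c * d > 0\<close>])
    have "norm (vec F w - of_real c *\<^sub>C residue F n) < q - c * d" using w(3) by (simp add: c(2))
    moreover have "norm (complex_of_real c *\<^sub>C residue F n) = c * d"
      using c(1) by (simp add: norm_scaleC d_def)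
    ultimately have "norm (vec F w) < q"
      using norm_triangle_ineq2 [of "vec F w" "of_real c *\<^sub>C residue F n"] by simp
    then show False using bound w(1,2) by (auto simp: least_norm_bound_def q_def)
  qed
  have "a * a \<ge> 0" by simp
  show res: "residue F n \<noteq> 0"
  proof
    assume "residue F n = 0"
    then have "q \<le> 0" using q by (simp add: d_def)
    moreover have "(1 / 2 ^ k :: real)\<^sup>2 \<le> 1" by (simp add: power_le_one)
    ultimately show False using aq \<open>a * a \<ge> 0\<close> by linarith
  qed
  have "Re (ip x (gram_schmidt F n)) = c * d"
    using ip_gram_schmidt_code [OF v(1), of F] ip_commute [of x "gram_schmidt F n"]
    by (simp add: c(2) d_def x_def)
  then have "(norm (x - gram_schmidt F n))\<^sup>2 = (norm x)\<^sup>2 + 1 - 2 * (c * d)"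
    by (simp add: norm_diff_square norm_gram_schmidt [OF res])
  also have "\<dots> \<le> a * a + 1 - 2 * q"
  proof -
    have "0 \<le> a" using a norm_ge_zero [of x] by linarith
    then have "(norm x)\<^sup>2 \<le> a * a" unfolding power2_eq_square using a by (intro mult_mono) auto
    then show ?thesis using q by simp
  qed
  also note aq
  finally show "norm (vec F v - gram_schmidt F n) < 1 / 2 ^ k"
    unfolding x_def by (rule power2_less_imp_less) simp
qed

lemma near_orthonormal_complete:
  assumes "residue F n \<noteq> 0"
  shows "\<exists>v. near_orthonormal F n k v"
proof -
  \<comment> \<open>As \<open>\<eta> \<le> 1\<close>, the bound \<open>s\<^sup>2 + 1 - 2 * t\<close> is less than \<open>7 * \<eta>\<close> for \<open>s < 1 + \<eta>\<close> and \<open>t > 1 - 2 * \<eta>\<close>.\<close>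
  define d \<eta> where "d = norm (residue F n)" and "\<eta> = (1 / 2 ^ k * (1 / 2 ^ k) / 7 :: real)"
  have d: "d > 0" using assms by (simp add: d_def)
  have \<eta>: "0 < \<eta>" "\<eta> \<le> 1"
  proof -
    have "1 / 2 ^ k * (1 / 2 ^ k) \<le> (1 * 1 :: real)" by (intro mult_mono) auto
    then show "\<eta> \<le> 1" by (simp add: \<eta>_def)
  qed (simp add: \<eta>_def)
  have "max 0 ((1 - \<eta>) / d) < 1 / d" using d \<eta> by (simp add: divide_strict_right_mono)
  then obtain r where r: "max 0 ((1 - \<eta>) / d) < real_of_rat r" "real_of_rat r < 1 / d"
    using of_rat_dense by blast
  define c where "c = real_of_rat r"
  have c: "c > 0" "1 - \<eta> < c * d" "c * d < 1"
    using r d by (simp_all add: c_def divide_less_eq less_divide_eq)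
  obtain \<gamma> where \<gamma>: "gauss \<gamma> = of_real c"
    using ex_gauss_code [of r 0] by (auto simp: c_def complex_of_real_def)
  obtain v where v: "code_length v = Suc n" "coeff v n = \<gamma>"
    "norm (vec F v - gauss \<gamma> *\<^sub>C residue F n) < \<eta>"
    by (rule approximate_multiple_of_residue [OF \<eta>(1)])
  have "norm (vec F v - of_real c *\<^sub>C residue F n) < \<eta>" using v(3) by (simp add: \<gamma>)
  moreover have "norm (complex_of_real c *\<^sub>C residue F n) = c * d"
    using c(1) by (simp add: norm_scaleC d_def)
  ultimately have "norm (vec F v) < 1 + \<eta>"
    using norm_triangle_ineq2 [of "vec F v" "of_real c *\<^sub>C residue F n"] c(3) by simp
  then obtain s where s: "norm (vec F v) < real_of_rat s" "real_of_rat s < 1 + \<eta>"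
    using of_rat_dense by blast
  obtain t where t: "c * d - \<eta> < real_of_rat t" "real_of_rat t < c * d"
    using of_rat_dense [of "c * d - \<eta>" "c * d"] \<eta>(1) by auto
  have "real_of_rat s * real_of_rat s < (1 + \<eta>) * (1 + \<eta>)"
    using s \<eta>(1) norm_ge_zero [of "vec F v"] by (intro mult_strict_mono) linarith+
  moreover have "\<eta> * \<eta> \<le> \<eta>" using \<eta> by (simp add: mult_left_le)
  moreover have "(1 + \<eta>) * (1 + \<eta>) = 1 + 2 * \<eta> + \<eta> * \<eta>" by (simp add: algebra_simps)
  ultimately have "real_of_rat s * real_of_rat s + 1 - 2 * real_of_rat t < 7 * \<eta>"
    using t c(2) by linarith
  also have "7 * \<eta> = real_of_rat (1 / 2 ^ k * (1 / 2 ^ k))"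
    by (simp add: \<eta>_def of_rat_mult of_rat_divide of_rat_power)
  finally have "real_of_rat (s * s + 1 - 2 * t) < real_of_rat (1 / 2 ^ k * (1 / 2 ^ k))"
    by (simp add: of_rat_add of_rat_diff of_rat_mult)
  then have st: "s * s + 1 - 2 * t < 1 / 2 ^ k * (1 / 2 ^ k)" by (simp only: of_rat_less)
  have low: "least_norm_bound F n v (of_rat t)"
    unfolding least_norm_bound_def
  proof (intro allI impI)
    fix w assume w: "code_length w = Suc n" "gauss (coeff w n) = gauss (coeff v n)"
    have "c * d = cmod (ip (gram_schmidt F n) (vec F w))"
      using c(1) d by (simp add: ip_gram_schmidt_code [OF w(1)] w(2) v(2) \<gamma> norm_mult d_def)
    also have "\<dots> \<le> norm (vec F w)"
      by (rule cmod_ip_le [OF norm_gram_schmidt [OF assms]])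
    finally show "of_rat t \<le> norm (vec F w)" using t(2) by simp
  qed
  obtain tc sc where "rat_of_code tc = t" "rat_of_code sc = s" using rat_of_code_surj by meson
  then have "near_orthonormal F n k v"
    unfolding near_orthonormal_def v(2) \<gamma> using v(1) c(1) low s(1) st by auto
  then show ?thesis by blast
qed

lemma semidecidable_near_orthonormal:
  assumes F: "effective_generating_set N F"
    and rec: "recursive_in halting_set f" "recursive_in halting_set g" "recursive_in halting_set h"
  shows "semidecidable_in halting_set (\<lambda>m. enat (f m) < N \<and> near_orthonormal F (f m) (g m) (h m))"
proof -
  define W where "W = (\<lambda>m w. vector_code N w \<and> code_length w = Suc (first m) \<and>
      rat_of_code (first (coeff w (first m))) = rat_of_code (first (coeff (first (second m)) (first m))) \<and>
      rat_of_code (second (coeff w (first m))) = rat_of_code (second (coeff (first (second m)) (first m))) \<and>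
      (vector_code N w \<and> norm (vec F w) < of_rat (rat_of_code (second (second m)))))"
  have "semidecidable_in {} (\<lambda>m. \<exists>w. W m w)"
    unfolding W_def
    by (intro semidecidable_in_ex semidecidable_in_conj semidecidable_norm F recursive_intros
        decidable_imp_semidecidable)
  then have decW: "decidable_in halting_set (\<lambda>m. \<exists>w. W m w)"
    by (rule semidecidable_imp_decidable_in_halting_set)
  have W: "least_norm_bound F n v (of_rat (rat_of_code q)) \<longleftrightarrow> \<not> (\<exists>w. W (pair n (pair v q)) w)"
    if "enat n < N" for n v q
    using that by (auto simp: least_norm_bound_def W_def vector_code_iff Suc_ile_eq complex_eq_iff not_less)
  define R where "R = (\<lambda>m. enat (Suc (first m)) \<le> N \<and> code_length (second (second m)) = Suc (first m) \<and>
      rat_of_code (second (coeff (second (second m)) (first m))) = 0 \<and>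
      0 < rat_of_code (first (coeff (second (second m)) (first m))) \<and>
      (\<exists>q a. \<not> (\<exists>w. W (pair (first m) (pair (second (second m)) q)) w) \<and>
        (vector_code N (second (second m)) \<and> norm (vec F (second (second m))) < of_rat (rat_of_code a)) \<and>
        rat_of_code a * rat_of_code a + 1 - 2 * rat_of_code q < 1 / 2 ^ first (second m) * (1 / 2 ^ first (second m))))"
  have semiR: "semidecidable_in halting_set R"
    unfolding R_def
    by (intro semidecidable_in_conj [OF decidable_imp_semidecidable] semidecidable_in_ex
        semidecidable_in_conj [OF semidecidable_in_relativize decidable_imp_semidecidable]
        semidecidable_norm F recursive_intros decidable_in_compose [OF decW])
  have R: "R (pair n (pair k v)) \<longleftrightarrow> enat n < N \<and> near_orthonormal F n k v" for n k v
    by (simp add: R_def near_orthonormal_def W Suc_ile_eq vector_code_iff cong: conj_cong)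
  have "semidecidable_in halting_set (\<lambda>m. R (pair (f m) (pair (g m) (h m))))"
    by (intro semidecidable_in_compose [OF semiR] recursive_intros rec)
  then show ?thesis by (simp add: R)
qed

text \<open>
  If finitely many orthonormal vectors \<open>e\<^sub>n\<close> had a dense span, then, for each coordinate \<open>j\<close>, the squares
  \<open>\<bar>e\<^sub>n(j)\<bar>\<^sup>2\<close> would add up to 1, the squared norm of the \<open>j\<close>-th unit vector. But summing over all \<open>j\<close>
  gives just the number of the vectors \<open>e\<^sub>n\<close>.
\<close>

lemma infinite_independent:
  assumes F: "generating_set N F"
  shows "infinite {n. enat n < N \<and> residue F n \<noteq> 0}"
proof
  define M where "M = {n. enat n < N \<and> residue F n \<noteq> 0}"
  define e where "e = gram_schmidt F"
  assume "finite {n. enat n < N \<and> residue F n \<noteq> 0}"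
  then have fin: "finite M" by (simp add: M_def)
  have orth: "ip (e i) (e j) = of_bool (i = j)" if "i \<in> M" "j \<in> M" for i j
    using that by (auto simp: e_def M_def ip_self norm_gram_schmidt gram_schmidt_orthogonal)
  define P where "P = (\<lambda>x. \<Sum>n\<in>M. (cmod (ip (e n) x))\<^sup>2)"
  have span: "x = (\<Sum>n\<in>M. ip (e n) x *\<^sub>C e n)" if "x \<in> scaleC.span (e ` M)" for x
    using that
  proof (induction rule: scaleC.span_induct_alt)
    case (step c x y)
    then obtain j where j: "j \<in> M" "x = e j" by blast
    have "(\<Sum>n\<in>M. (c * ip (e n) x) *\<^sub>C e n) = (\<Sum>n\<in>M. if n = j then c *\<^sub>C e j else 0)"
      by (rule sum.cong) (auto simp: j orth)
    then have "(\<Sum>n\<in>M. (c * ip (e n) x) *\<^sub>C e n) = c *\<^sub>C x" using fin j by simp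
    then show ?case
      using step(2) by (simp add: ip_add_right ip_scaleC_right scaleC_add_left sum.distrib)
  qed simp
  have norm_span: "(norm x)\<^sup>2 = P x" if "x \<in> scaleC.span (e ` M)" for x
    using orthonormal_norm_square [OF fin orth, of "\<lambda>n. ip (e n) x"] span [OF that] by (simp add: P_def)
  have dense: "closure (scaleC.span (e ` M)) = UNIV"
    by (rule gram_schmidt_dense [OF F]) (simp add: e_def M_def)
  have norm_all: "(norm x)\<^sup>2 = P x" for x
  proof -
    have "x \<in> closure (scaleC.span (e ` M))" by (simp add: dense)
    then obtain s where s: "\<forall>k. s k \<in> scaleC.span (e ` M)" "s \<longlonglongrightarrow> x"
      unfolding closure_sequential by blast
    have "(\<lambda>k. ip (e n) (s k)) \<longlonglongrightarrow> ip (e n) x" if "n \<in> M" for n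
    proof -
      have "norm (e n) = 1" using that by (simp add: e_def M_def norm_gram_schmidt)
      then have le: "norm (ip (e n) (s k) - ip (e n) x) \<le> norm (s k - x)" for k
        using cmod_ip_le [of "e n" "s k - x"] by (simp add: ip_diff_right)
      have lim: "(\<lambda>k. norm (s k - x)) \<longlonglongrightarrow> 0" using s(2) by (simp add: LIM_zero_iff tendsto_norm_zero_iff)
      have "(\<lambda>k. ip (e n) (s k) - ip (e n) x) \<longlonglongrightarrow> 0"
        by (rule Lim_null_comparison [OF _ lim]) (rule always_eventually, rule allI, rule le)
      then show ?thesis by (simp add: LIM_zero_iff)
    qed
    then have "(\<lambda>k. P (s k)) \<longlonglongrightarrow> P x" unfolding P_def by (intro tendsto_intros)
    moreover have "(\<lambda>k. (norm (s k))\<^sup>2) \<longlonglongrightarrow> (norm x)\<^sup>2" by (intro tendsto_intros s(2))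
    ultimately show ?thesis using s(1) norm_span by (auto intro: LIMSEQ_unique)
  qed
  have one: "(\<Sum>n\<in>M. (cmod (\<Phi> (e n) j))\<^sup>2) = 1" for j
  proof -
    obtain b where b: "\<Phi> b = (\<lambda>n. if n = j then 1 else 0)" using atom_at_ex [of 1 j] by auto
    have "ip (e n) b = cnj (\<Phi> (e n) j)" for n
      unfolding ip_def b by (subst suminf_finite [of "{j}"]) auto
    then have "P b = (\<Sum>n\<in>M. (cmod (\<Phi> (e n) j))\<^sup>2)" by (simp add: P_def)
    then show ?thesis using norm_all [of b] norm_atom_multiple [OF b] by simp
  qed
  have "real (Suc (card M)) = (\<Sum>j<Suc (card M). \<Sum>n\<in>M. (cmod (\<Phi> (e n) j))\<^sup>2)"
    by (simp only: one) simp
  also have "\<dots> = (\<Sum>n\<in>M. \<Sum>j<Suc (card M). (cmod (\<Phi> (e n) j))\<^sup>2)" by (rule sum.swap)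
  also have "\<dots> \<le> (\<Sum>n\<in>M. 1)"
  proof (rule sum_mono)
    fix n assume "n \<in> M"
    then have "norm (e n) = 1" by (simp add: e_def M_def norm_gram_schmidt)
    then show "(\<Sum>j<Suc (card M). (cmod (\<Phi> (e n) j))\<^sup>2) \<le> 1"
      using sum_le_suminf [OF summable_cmod_square [of "e n"], of "{..<Suc (card M)}"]
      by (simp flip: norm_square)
  qed
  finally show False by simp
qed

text \<open>
  Whether a member of the generating set depends on its predecessors is not decided in advance: the
  independent ones are found by the search for vectors near their orthonormalization.
\<close>

lemma recursive_basis_2:
  fixes F :: "nat \<Rightarrow> 'a"
  assumes F: "effective_generating_set N F"
  shows "\<exists>e a. recursive_basis halting_set 2 N F e a"
proof -
  have gen: "generating_set N F" using F by (simp add: effective_generating_set_def)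
  define M where "M = {n. enat n < N \<and> residue F n \<noteq> 0}"
  have M: "n \<in> M \<longleftrightarrow> (\<exists>v. enat n < N \<and> near_orthonormal F n 0 v)" for n
    using near_orthonormal_sound(1) near_orthonormal_complete by (auto simp: M_def)
  have "semidecidable_in halting_set (\<lambda>n. n \<in> M)"
    unfolding M
    by (intro semidecidable_in_ex semidecidable_near_orthonormal F recursive_intros)
  then obtain f where f: "recursive_in halting_set f" "bij_betw f UNIV M"
    using semidecidable_enumeration infinite_independent [OF gen] unfolding M_def by blast
  have fM: "enat (f i) < N" "residue F (f i) \<noteq> 0" for i
    using f(2) by (auto simp: bij_betw_def M_def)
  define e where "e = (\<lambda>i. gram_schmidt F (f i))"
  obtain g where g: "recursive_in halting_set g"
    "\<And>m. True \<Longrightarrow> enat (f (first m)) < N \<and> near_orthonormal F (f (first m)) (second m) (g m)"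
  proof (rule semidecidable_uniformization)
    show "semidecidable_in halting_set (\<lambda>m. enat (f (first (first m))) < N \<and>
        near_orthonormal F (f (first (first m))) (second (first m)) (second m))"
      by (intro semidecidable_near_orthonormal F recursive_intros recursive_in_compose [OF f(1)])
    show "decidable_in halting_set (\<lambda>m. True)" by (rule decidable_in_const)
    show "\<exists>v. enat (f (first m)) < N \<and> near_orthonormal F (f (first m)) (second m) v" for m
      using fM near_orthonormal_complete by blast
  qed blast
  define a where "a = (\<lambda>i k. g (pair i k))"
  have a: "near_orthonormal F (f i) k (a i k)" for i k
    using g(2) [of "pair i k"] by (simp add: a_def)
  have "vector_code N (a i k)" for i k
    using a [of i k] fM(1) [of i] by (simp add: near_orthonormal_def vector_code_iff Suc_ile_eq)
  moreover have "norm (vec F (a i k) - e i) < 1 / 2 ^ k" for i k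
    unfolding e_def by (rule near_orthonormal_sound(2) [OF a])
  moreover have "recursive_in halting_set (\<lambda>m. a (first m) (second m))"
    using g(1) by (simp add: a_def)
  moreover have "lp_basis 2 e"
    unfolding lp_basis_def
  proof (intro conjI allI)
    fix c n
    have "inj f" using f(2) by (simp add: bij_betw_def)
    then have orth: "ip (e i) (e j) = of_bool (i = j)" for i j
      using fM(2) by (cases "i = j")
        (auto simp: e_def ip_self norm_gram_schmidt gram_schmidt_orthogonal inj_eq)
    have "(norm (\<Sum>i<n. c i *\<^sub>C e i))\<^sup>2 = (\<Sum>i<n. (cmod (c i))\<^sup>2)"
      by (rule orthonormal_norm_square) (auto simp: orth)
    then have "norm (\<Sum>i<n. c i *\<^sub>C e i) = sqrt (\<Sum>i<n. (cmod (c i))\<^sup>2)"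
      by (intro real_sqrt_unique [symmetric] norm_ge_zero)
    then show "norm (\<Sum>i<n. c i *\<^sub>C e i) = (\<Sum>i<n. cmod (c i) powr 2) powr (1 / 2)"
      by (simp add: powr_half_sqrt sum_nonneg)
  next
    show "closure (scaleC.span (range e)) = UNIV"
    proof (rule gram_schmidt_dense [OF gen])
      fix n assume "enat n < N" "residue F n \<noteq> 0"
      then have "n \<in> range f" using f(2) by (simp add: bij_betw_def M_def)
      then show "gram_schmidt F n \<in> range e" by (auto simp: e_def)
    qed
  qed
  ultimately show ?thesis unfolding recursive_basis_def by blast
qed

end

section \<open>The isometry\<close>

lemma recursive_basis_exists:
  fixes F :: "nat \<Rightarrow> 'a::complex_banach"
  assumes "p \<ge> 1" "effective_generating_set N F" "linearly_isometric_to_lp TYPE('a) p"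
  shows "\<exists>e a. recursive_basis halting_set p N F e a"
proof -
  obtain \<Phi> :: "'a \<Rightarrow> nat \<Rightarrow> complex" where \<Phi>: "lp_copy p \<Phi>"
    using assms linearly_isometric_to_lp_iff by blast
  show ?thesis
  proof (cases "p = 2")
    case True
    then have "l2_copy \<Phi>" using \<Phi> by (simp add: l2_copy_def)
    then show ?thesis using l2_copy.recursive_basis_2 assms(2) True by blast
  next
    case False
    then show ?thesis using lp_copy.recursive_basis_neq_2 [OF \<Phi>] assms(2) by blast
  qed
qed

theorem theorem2p3:
  fixes p :: real
    and N0 N1 :: enat
    and F0 :: "nat \<Rightarrow> 'a::complex_banach"
    and F1 :: "nat \<Rightarrow> 'b::complex_banach"
  assumes "computable_real p" and "p \<ge> 1"
    and "effective_generating_set N0 F0"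
    and "effective_generating_set N1 F1"
    and "linearly_isometric_to_lp TYPE('a) p"
    and "linearly_isometric_to_lp TYPE('b) p"
  shows "\<exists>T :: 'a \<Rightarrow> 'b.
    linear_isometry T \<and> surj T \<and> oracle_computes halting_set N0 F0 N1 F1 T"
proof -
  obtain e0 a0 where "recursive_basis halting_set p N0 F0 e0 a0"
    using recursive_basis_exists [OF assms(2,3,5)] by blast
  moreover obtain e1 a1 where "recursive_basis halting_set p N1 F1 e1 a1"
    using recursive_basis_exists [OF assms(2,4,6)] by blast
  ultimately show ?thesis
    by (rule recursive_bases_imp_computable_isometry [OF assms(3)])
qed

end
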